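(* Consider the plant, with $D>0$, described in the context, where the functions $\psi_i,\varphi_j$ satisfy the stated smoothness conditions. Let $Y(0)\in\mathbb{R}^n$, $X(0)\in\mathbb{R}^m$, let the initial input history satisfy $x_1\in C^{m-1}([-D,0])$, and let the target trajectory $s$ be $n+m$ times continuously differentiable. Suppose that (A4) $P(\theta)$ is finite and $P_1(\theta)>s(\theta+D)$ for all $\theta\in[-D,0]$, where $P(\theta)=Y(0)+\int_{-D}^{\theta}f(P(\sigma),bx_1(\sigma))\,d\sigma$; (A5) $b x_1(0)>\Delta(0)$. Choose design parameters $k_1,\dots,k_n,c_1,\dots,c_m$ with $$k_i>\max\{2,\check k_i\}\ (1\le i\le n-1),\quad k_n>1,\qquad c_j>\max\{2,\check c_j\}\ (1\le j\le m-1),\quad c_m>1 .$$ Then the closed-loop system consisting of the plant and the nominal controller $$U(t)=\tfrac1b\Big(\tau_m(\underline x_m(t),\underline\Delta^{(m-1)}(t))+\Delta^{(m)}(t)\Big),$$ with predictor $P$, has the following properties. 1) $|y_1(t)-s(t)|$ converges exponentially to zero, and $$\Psi(t)=|X(t)|+|Y(t)|+\max_{x\in[0,1]}|p(x,t)|+\Big(\int_{t-D}^t x_1(\tau)^2\,d\tau\Big)^{1/2}$$ is bounded, with an ultimate bound depending on the target trajectory. If $s(t)\equiv 0$, then $\Psi(t)$ converges exponentially to zero. 2) $y_1(t)-s(t)\ge 0$ for all $t\ge 0$.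
   Context: Plant. Let $n,m\ge1$ be integers, $b\neq0$ a constant, $D>0$ a delay. The plant is $$\dot y_i(t)=y_{i+1}(t)+\psi_i(\underline y_i(t)),\ i=1,\dots,n-1,\qquad \dot y_n(t)=\psi_n(\underline y_n(t))+b\,x_1(t-D),$$ $$\dot x_j(t)=x_{j+1}(t)+\varphi_j(\underline x_j(t)),\ j=1,\dots,m-1,\qquad \dot x_m(t)=\varphi_m(\underline x_m(t))+U(t),$$ with $Y=(y_1,\dots,y_n)^T$, $X=(x_1,\dots,x_m)^T$, control input $U$, and output $y_1$. Notation: $\underline y_i=(y_1,\dots,y_i)^T$, $\underline s^{(i)}=(s,s^{(1)},\dots,s^{(i)})^T$ (with $s^{(i)}$ the $i$-th time derivative), and similarly for other symbols. Write the $Y$-part as $\dot Y(t)=f(Y(t),bx_1(t-D))$, i.e. $f(Y,v)=(y_2+\psi_1(\underline y_1),\dots,y_n+\psi_{n-1}(\underline y_{n-1}),\psi_n(\underline y_n)+v)^T$. Smoothness conditions: $\psi_i$ is $n+m-i$ times continuously differentiable, $\varphi_j$ is $m-j$ times continuously differentiable, $\psi_i(0)=0$, $\varphi_j(0)=0$. Predictor. $P(t)=(P_1(t),\dots,P_n(t))^T=Y(t+D)$, generated by $P(t)=Y(t)+\int_{t-D}^{t}f(P(\sigma),bx_1(\sigma))\,d\sigma$ for $t\ge0$, with initial values $P(\theta)=Y(0)+\int_{-D}^{\theta}f(P(\sigma),bx_1(\sigma))\,d\sigma$, $\theta\in[-D,0]$. Set $p(x,t)=P(t-D+Dx)$ for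 $x\in[0,1]$, $t\ge0$. Functions $h_i$. With $h_0=0$ and $z_i=y_i-h_{i-1}-s^{(i-1)}$, define recursively for $i=1,\dots,n$ $$h_i(\underline y_i,\underline s^{(i-1)})=-k_iz_i-\psi_i(\underline y_i)+\sum_{k=1}^{i-1}\Big[\frac{\partial h_{i-1}}{\partial y_k}(y_{k+1}+\psi_k(\underline y_k))+\frac{\partial h_{i-1}}{\partial s^{(k-1)}}s^{(k)}\Big].$$ Functions $\Delta,\tau_j$. $\Delta(t)=h_n(P(t),\underline s^{(n-1)}(t+D))+s^{(n)}(t+D)$; its time derivatives $\Delta^{(j)}$ are taken along the solution (using $\dot P(t)=f(P(t),bx_1(t))$ and the $X$-dynamics). With $\tau_0=0$ and $r_j=bx_j-\tau_{j-1}-\Delta^{(j-1)}$, define for $j=1,\dots,m$ $$\tau_j(\underline x_j,\underline\Delta^{(j-1)})=-c_jr_j-b\varphi_j(\underline x_j)+\sum_{k=1}^{j-1}\Big[\frac{\partial\tau_{j-1}}{\partial x_k}(x_{k+1}+\varphi_k(\underline x_k))+\frac{\partial\tau_{j-1}}{\partial\Delta^{(k-1)}}\Delta^{(k)}\Big].$$ Thresholds for the design parameters (recursive: $\check k_i$ depends on $k_1,\dots,k_{i-1}$; $\check c_j$ depends on the $k$'s and $c_1,\dots,c_{j-1}$). For $i=1,\dots,n-1$, with $h_{i-1}$, its partial derivatives and $\psi_k$ evaluated at $\underline P(0)$ (in place of $y$) and at $s^{(\cdot)}(D)$, $$\check k_i=\frac{-P_{i+1}(0)-\psi_i(\underline P_i(0))+s^{(i)}(D)+\sum_{k=1}^{i-1}\big(\frac{\partial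 h_{i-1}}{\partial P_k}(P_{k+1}(0)+\psi_k)+\frac{\partial h_{i-1}}{\partial s^{(k-1)}}s^{(k)}(D)\big)}{P_i(0)-h_{i-1}(\underline P_{i-1}(0),\underline s^{(i-2)}(D))-s^{(i-1)}(D)}.$$ For $j=1,\dots,m-1$, with everything evaluated at $t=0$, $$\check c_j=\frac{-bx_{j+1}(0)-b\varphi_j(\underline x_j(0))+\Delta^{(j)}(0)+\sum_{k=1}^{j-1}\big(\frac{\partial\tau_{j-1}}{\partial x_k}(x_{k+1}(0)+\varphi_k)+\frac{\partial\tau_{j-1}}{\partial\Delta^{(k-1)}}\Delta^{(k)}(0)\big)}{bx_j(0)-\tau_{j-1}(\underline x_{j-1}(0),\underline\Delta^{(j-2)}(0))-\Delta^{(j-1)}(0)}.$$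
   Formalization: Boundedness and the ultimate bound of Ψ are stated only for targets with s, s', …, s^(n+m-1) bounded on [0,∞); without this the claim fails, e.g. for s(t)=t, where y_1 must be unbounded. *)

theory Defs
  imports "HOL-Analysis.Analysis"
begin

text \<open>
  Finite vectors are functions on \<^typ>\<open>nat\<close>. States are indexed from 1, so that
  \<open>y i\<close> is $y_i$; jets (a signal together with its time derivatives) are indexed from 0, so
  that \<open>\<sigma> i\<close> is $s^{(i)}$. A function of the first few coordinates ignores
  the remaining ones.
\<close>

definition on_first :: "nat \<Rightarrow> ((nat \<Rightarrow> real) \<Rightarrow> real) \<Rightarrow> bool" where
  "on_first d f \<longleftrightarrow> (\<forall>u v. (\<forall>i\<in>{1..d}. u i = v i) \<longrightarrow> f u = f v)"

definition partial :: "nat \<Rightarrow> ((nat \<Rightarrow> real) \<Rightarrow> real) \<Rightarrow> (nat \<Rightarrow> real) \<Rightarrow> real" where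
  "partial i f u = deriv (\<lambda>a. f (u(i := a))) (u i)"

text \<open>
  A function of the first \<open>d\<close> coordinates is $C^r$ iff its partial derivatives up to
  order \<open>r\<close> exist and are continuous. Continuity refers to the product topology, which
  for a function of the first \<open>d\<close> coordinates is continuity on $R^d$.
\<close>

primrec partials_cont :: "nat \<Rightarrow> nat \<Rightarrow> ((nat \<Rightarrow> real) \<Rightarrow> real) \<Rightarrow> bool" where
  "partials_cont d 0 f \<longleftrightarrow> continuous_on UNIV f"
| "partials_cont d (Suc r) f \<longleftrightarrow> continuous_on UNIV f \<and>
     (\<forall>i\<in>{1..d}. (\<forall>u. (\<lambda>a. f (u(i := a))) differentiable (at (u i))) \<and>
        partials_cont d r (partial i f))"

definition Cr_fun :: "nat \<Rightarrow> nat \<Rightarrow> ((nat \<Rightarrow> real) \<Rightarrow> real) \<Rightarrow> bool" where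
  "Cr_fun d r f \<longleftrightarrow> on_first d f \<and> partials_cont d r f"

text \<open>Derivatives at a boundary point of \<open>S\<close> are one-sided.\<close>

primrec iter_deriv :: "real set \<Rightarrow> nat \<Rightarrow> (real \<Rightarrow> real) \<Rightarrow> real \<Rightarrow> real" where
  "iter_deriv S 0 f = f"
| "iter_deriv S (Suc r) f = (\<lambda>t. vector_derivative (iter_deriv S r f) (at t within S))"

definition Cr_on :: "real set \<Rightarrow> nat \<Rightarrow> (real \<Rightarrow> real) \<Rightarrow> bool" where
  "Cr_on S r f \<longleftrightarrow>
     (\<forall>j<r. \<forall>t\<in>S. iter_deriv S j f differentiable (at t within S)) \<and>
     continuous_on S (iter_deriv S r f)"

definition jet :: "(real \<Rightarrow> real) \<Rightarrow> real \<Rightarrow> nat \<Rightarrow> real" where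
  "jet s t i = iter_deriv {0..} i s t"

definition plant_f ::
    "nat \<Rightarrow> (nat \<Rightarrow> (nat \<Rightarrow> real) \<Rightarrow> real) \<Rightarrow> (nat \<Rightarrow> real) \<Rightarrow> real \<Rightarrow> nat \<Rightarrow> real" where
  "plant_f n \<psi> y v i = (if i = n then \<psi> n y + v else y (i + 1) + \<psi> i y)"

text \<open>
  The rate of change of \<open>F\<close>, a function of $u_1,\dots,u_i$ and of a jet
  $\sigma_0,\dots,\sigma_{i-1}$, when $\dot u_l = u_{l+1} + g_l(u)$.
\<close>

definition cascade_deriv ::
    "(nat \<Rightarrow> (nat \<Rightarrow> real) \<Rightarrow> real) \<Rightarrow> nat \<Rightarrow> ((nat \<Rightarrow> real) \<Rightarrow> (nat \<Rightarrow> real) \<Rightarrow> real)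
      \<Rightarrow> (nat \<Rightarrow> real) \<Rightarrow> (nat \<Rightarrow> real) \<Rightarrow> real" where
  "cascade_deriv g i F u \<sigma> =
     (\<Sum>l = 1..i. partial l (\<lambda>u. F u \<sigma>) u * (u (l + 1) + g l u)
               + partial (l - 1) (\<lambda>\<sigma>. F u \<sigma>) \<sigma> * \<sigma> l)"

primrec h_fun ::
    "(nat \<Rightarrow> (nat \<Rightarrow> real) \<Rightarrow> real) \<Rightarrow> (nat \<Rightarrow> real) \<Rightarrow> nat
      \<Rightarrow> (nat \<Rightarrow> real) \<Rightarrow> (nat \<Rightarrow> real) \<Rightarrow> real" where
  "h_fun \<psi> k 0 = (\<lambda>y \<sigma>. 0)"
| "h_fun \<psi> k (Suc i) = (\<lambda>y \<sigma>.
     - k (Suc i) * (y (Suc i) - h_fun \<psi> k i y \<sigma> - \<sigma> i) - \<psi> (Suc i) y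
     + cascade_deriv \<psi> i (h_fun \<psi> k i) y \<sigma>)"

primrec tau_fun ::
    "real \<Rightarrow> (nat \<Rightarrow> (nat \<Rightarrow> real) \<Rightarrow> real) \<Rightarrow> (nat \<Rightarrow> real) \<Rightarrow> nat
      \<Rightarrow> (nat \<Rightarrow> real) \<Rightarrow> (nat \<Rightarrow> real) \<Rightarrow> real" where
  "tau_fun b \<phi> c 0 = (\<lambda>x \<delta>. 0)"
| "tau_fun b \<phi> c (Suc j) = (\<lambda>x \<delta>.
     - c (Suc j) * (b * x (Suc j) - tau_fun b \<phi> c j x \<delta> - \<delta> j) - b * \<phi> (Suc j) x
     + cascade_deriv \<phi> j (tau_fun b \<phi> c j) x \<delta>)"

text \<open>
  $\Delta^{(j)}$ as a function of the predictor state \<open>p\<close>, the state \<open>x\<close> and the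
  jet \<open>\<sigma>\<close> of the target at $t + D$: each step is the time derivative along
  $\dot P = f(P, b x_1)$ and the \<open>x\<close>-dynamics. As $\Delta^{(j)}$ involves only
  $x_1,\dots,x_j$, the input does not occur for $j \le m$.
\<close>

primrec Delta_fun ::
    "nat \<Rightarrow> real \<Rightarrow> (nat \<Rightarrow> (nat \<Rightarrow> real) \<Rightarrow> real) \<Rightarrow> (nat \<Rightarrow> (nat \<Rightarrow> real) \<Rightarrow> real) \<Rightarrow> (nat \<Rightarrow> real)
      \<Rightarrow> nat \<Rightarrow> (nat \<Rightarrow> real) \<Rightarrow> (nat \<Rightarrow> real) \<Rightarrow> (nat \<Rightarrow> real) \<Rightarrow> real" where
  "Delta_fun n b \<psi> \<phi> k 0 = (\<lambda>p x \<sigma>. h_fun \<psi> k n p \<sigma> + \<sigma> n)"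
| "Delta_fun n b \<psi> \<phi> k (Suc j) = (\<lambda>p x \<sigma>.
     (\<Sum>l = 1..n. partial l (\<lambda>p. Delta_fun n b \<psi> \<phi> k j p x \<sigma>) p * plant_f n \<psi> p (b * x 1) l)
   + (\<Sum>l = 1..j. partial l (\<lambda>x. Delta_fun n b \<psi> \<phi> k j p x \<sigma>) x * (x (l + 1) + \<phi> l x))
   + (\<Sum>l = 0..n + j. partial l (\<lambda>\<sigma>. Delta_fun n b \<psi> \<phi> k j p x \<sigma>) \<sigma> * \<sigma> (l + 1)))"

definition Delta_jet ::
    "nat \<Rightarrow> real \<Rightarrow> (nat \<Rightarrow> (nat \<Rightarrow> real) \<Rightarrow> real) \<Rightarrow> (nat \<Rightarrow> (nat \<Rightarrow> real) \<Rightarrow> real) \<Rightarrow> (nat \<Rightarrow> real)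
      \<Rightarrow> (nat \<Rightarrow> real) \<Rightarrow> (nat \<Rightarrow> real) \<Rightarrow> (nat \<Rightarrow> real) \<Rightarrow> nat \<Rightarrow> real" where
  "Delta_jet n b \<psi> \<phi> k p x \<sigma> j = Delta_fun n b \<psi> \<phi> k j p x \<sigma>"

definition nominal_control ::
    "nat \<Rightarrow> nat \<Rightarrow> real \<Rightarrow> (nat \<Rightarrow> (nat \<Rightarrow> real) \<Rightarrow> real) \<Rightarrow> (nat \<Rightarrow> (nat \<Rightarrow> real) \<Rightarrow> real)
      \<Rightarrow> (nat \<Rightarrow> real) \<Rightarrow> (nat \<Rightarrow> real) \<Rightarrow> (nat \<Rightarrow> real) \<Rightarrow> (nat \<Rightarrow> real) \<Rightarrow> (nat \<Rightarrow> real) \<Rightarrow> real" where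
  "nominal_control n m b \<psi> \<phi> k c p x \<sigma> =
     (let \<delta> = Delta_jet n b \<psi> \<phi> k p x \<sigma> in (tau_fun b \<phi> c m x \<delta> + \<delta> m) / b)"

definition k_check ::
    "(nat \<Rightarrow> (nat \<Rightarrow> real) \<Rightarrow> real) \<Rightarrow> (nat \<Rightarrow> real) \<Rightarrow> (nat \<Rightarrow> real) \<Rightarrow> (nat \<Rightarrow> real) \<Rightarrow> nat \<Rightarrow> real" where
  "k_check \<psi> k p \<sigma> i =
     (- p (i + 1) - \<psi> i p + \<sigma> i + cascade_deriv \<psi> (i - 1) (h_fun \<psi> k (i - 1)) p \<sigma>)
     / (p i - h_fun \<psi> k (i - 1) p \<sigma> - \<sigma> (i - 1))"

definition c_check ::
    "real \<Rightarrow> (nat \<Rightarrow> (nat \<Rightarrow> real) \<Rightarrow> real) \<Rightarrow> (nat \<Rightarrow> real) \<Rightarrow> (nat \<Rightarrow> real) \<Rightarrow> (nat \<Rightarrow> real) \<Rightarrow> nat \<Rightarrow> real" where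
  "c_check b \<phi> c x \<delta> j =
     (- b * x (j + 1) - b * \<phi> j x + \<delta> j + cascade_deriv \<phi> (j - 1) (tau_fun b \<phi> c (j - 1)) x \<delta>)
     / (b * x j - tau_fun b \<phi> c (j - 1) x \<delta> - \<delta> (j - 1))"

text \<open>
  The initial values of the predictor: \<open>Y0\<close> is $Y(0)$ and \<open>\<xi>\<close> is the history
  of $x_1$ on $[-D,0]$. That this equation has a real-valued solution on all of $[-D,0]$
  is the finiteness of $P$ there.
\<close>

definition predictor_init ::
    "nat \<Rightarrow> real \<Rightarrow> real \<Rightarrow> (nat \<Rightarrow> (nat \<Rightarrow> real) \<Rightarrow> real) \<Rightarrow> (nat \<Rightarrow> real) \<Rightarrow> (real \<Rightarrow> real)
      \<Rightarrow> (real \<Rightarrow> nat \<Rightarrow> real) \<Rightarrow> bool" where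
  "predictor_init n b D \<psi> Y0 \<xi> P0 \<longleftrightarrow>
     (\<forall>\<theta>\<in>{-D..0}. \<forall>i\<in>{1..n}.
        ((\<lambda>\<sigma>. plant_f n \<psi> (P0 \<sigma>) (b * \<xi> \<sigma>) i) has_integral (P0 \<theta> i - Y0 i)) {-D..\<theta>})"

text \<open>
  A closed-loop trajectory on $[0,\infty)$. The predictor is given by its integral equation
  only; $P(t) = Y(t+D)$ is a consequence.
\<close>

definition closed_loop ::
    "nat \<Rightarrow> nat \<Rightarrow> real \<Rightarrow> real \<Rightarrow> (nat \<Rightarrow> (nat \<Rightarrow> real) \<Rightarrow> real) \<Rightarrow> (nat \<Rightarrow> (nat \<Rightarrow> real) \<Rightarrow> real)
      \<Rightarrow> (real \<Rightarrow> real) \<Rightarrow> (nat \<Rightarrow> real) \<Rightarrow> (nat \<Rightarrow> real)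
      \<Rightarrow> (nat \<Rightarrow> real) \<Rightarrow> (nat \<Rightarrow> real) \<Rightarrow> (real \<Rightarrow> real) \<Rightarrow> (real \<Rightarrow> nat \<Rightarrow> real)
      \<Rightarrow> (real \<Rightarrow> nat \<Rightarrow> real) \<Rightarrow> (real \<Rightarrow> nat \<Rightarrow> real) \<Rightarrow> (real \<Rightarrow> nat \<Rightarrow> real) \<Rightarrow> bool" where
  "closed_loop n m b D \<psi> \<phi> s k c Y0 X0 \<xi> P0 Y X P \<longleftrightarrow>
     (\<forall>i\<in>{1..n}. Y 0 i = Y0 i) \<and>
     (\<forall>j\<in>{1..m}. X 0 j = X0 j) \<and>
     (\<forall>\<theta>\<in>{-D..0}. X \<theta> 1 = \<xi> \<theta>) \<and>
     (\<forall>\<theta>\<in>{-D..0}. \<forall>i\<in>{1..n}. P \<theta> i = P0 \<theta> i) \<and>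
     (\<forall>t\<ge>0. \<forall>i\<in>{1..n}.
        ((\<lambda>t. Y t i) has_real_derivative plant_f n \<psi> (Y t) (b * X (t - D) 1) i)
          (at t within {0..})) \<and>
     (\<forall>t\<ge>0. \<forall>j\<in>{1..m}.
        ((\<lambda>t. X t j) has_real_derivative
          (if j = m
           then \<phi> m (X t) + nominal_control n m b \<psi> \<phi> k c (P t) (X t) (jet s (t + D))
           else X t (j + 1) + \<phi> j (X t)))
          (at t within {0..})) \<and>
     (\<forall>t\<ge>0. \<forall>i\<in>{1..n}.
        ((\<lambda>\<sigma>. plant_f n \<psi> (P \<sigma>) (b * X \<sigma> 1) i) has_integral (P t i - Y t i)) {t - D..t})"

definition Psi ::
    "nat \<Rightarrow> nat \<Rightarrow> real \<Rightarrow> (real \<Rightarrow> nat \<Rightarrow> real) \<Rightarrow> (real \<Rightarrow> nat \<Rightarrow> real) \<Rightarrow> (real \<Rightarrow> nat \<Rightarrow> real)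
      \<Rightarrow> real \<Rightarrow> real" where
  "Psi n m D Y X P t =
     L2_set (X t) {1..m} + L2_set (Y t) {1..n}
     + (SUP x\<in>{0..1}. L2_set (P (t - D + D * x)) {1..n})
     + sqrt (integral {t - D..t} (\<lambda>\<tau>. (X \<tau> 1)\<^sup>2))"

definition exp_to_zero :: "(real \<Rightarrow> real) \<Rightarrow> bool" where
  "exp_to_zero f \<longleftrightarrow> (\<exists>C a. a > 0 \<and> (\<forall>t\<ge>0. \<bar>f t\<bar> \<le> C * exp (- a * t)))"

end

theory Submission
  imports Defs
begin

text \<open>
  In the error coordinates $z_i = P_i - h_{i-1} - s^{(i-1)}$ and
  $r_j = b x_j - \tau_{j-1} - \Delta^{(j-1)}$ the closed loop is the linear chain
  $\dot z_i = -k_i z_i + z_{i+1}$, $z_{n+1} = r_1$, $\dot r_j = -c_j r_j + r_{j+1}$, $r_{m+1} = 0$.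
  The lower bounds on the gains, (A4) and (A5) say that all initial values of this chain are
  positive, so it stays nonnegative, and since all gains exceed 1 it decays like $e^{-t}$.
  The transformation is triangular, hence invertible: solving the chain explicitly gives existence
  although $\varphi_m$ is merely continuous, and its inverse turns bounds on the errors into bounds on
  the state. The predictor is exact because $Y(t)$ and $P(t-D)$ solve the same locally Lipschitz
  equation, which is shown on one interval of length $D$ after the other.
\<close>

section \<open>Functions of finitely many coordinates\<close>

text \<open>Derivative counting shapes the proof. A backstepping stage differentiates the previous
  one and so spends one order of smoothness: of the \<open>n + m\<close> orders available at the
  start, \<open>n\<close> are consumed on the way to \<open>h n\<close>, exactly \<open>m\<close>
  remain for the repeated differentiation of \<open>\<Delta>\<close>, and the last
  \<open>\<tau>\<close> is merely continuous. Only stages strictly below \<open>m\<close> may be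
  differentiated, and the closed-loop right-hand side need not be Lipschitz. The change of
  coordinates is therefore treated as an equivalence of differential equations, one stage at a time:
  up to the factor \<open>b\<close>, a state differs from its error by a function of earlier states
  whose derivative is already known. One direction gives the estimates, the other existence. Vectors
  are functions on \<open>nat\<close> with the product topology, so the calculus is coordinatewise,
  and dependence on finitely many coordinates takes the place of finite dimension. The ultimate
  bound must precede the initial data; it comes from inverting the transformation only after all
  errors have dropped below 1.\<close>

definition depends_on :: "'i set \<Rightarrow> (('i \<Rightarrow> real) \<Rightarrow> real) \<Rightarrow> bool" where
  "depends_on I F \<longleftrightarrow> (\<forall>u v. (\<forall>i\<in>I. u i = v i) \<longrightarrow> F u = F v)"

text \<open>\<open>partial\<close> over an arbitrary index type: several vector arguments are later
  merged into a single one indexed by a disjoint sum.\<close>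

definition coord_deriv :: "'i \<Rightarrow> (('i \<Rightarrow> real) \<Rightarrow> real) \<Rightarrow> ('i \<Rightarrow> real) \<Rightarrow> real" where
  "coord_deriv i F u = deriv (\<lambda>a. F (u(i := a))) (u i)"

text \<open>Partial derivatives enter as witnesses \<open>G\<close> rather than as
  \<open>deriv\<close> terms, so closure under sums and products is proved by exhibiting one.
  Dependence on \<open>I\<close> is demanded at every order, so that derivatives of a function of
  finitely many coordinates are again of this kind.\<close>

primrec CR :: "'i set \<Rightarrow> nat \<Rightarrow> (('i \<Rightarrow> real) \<Rightarrow> real) \<Rightarrow> bool" where
  "CR I 0 F \<longleftrightarrow> continuous_on UNIV F \<and> depends_on I F"
| "CR I (Suc r) F \<longleftrightarrow> continuous_on UNIV F \<and> depends_on I F \<and>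
     (\<forall>i\<in>I. \<exists>G. (\<forall>u. ((\<lambda>a. F (u(i := a))) has_real_derivative G u) (at (u i))) \<and> CR I r G)"

lemma depends_onD: "depends_on I F \<Longrightarrow> (\<And>i. i \<in> I \<Longrightarrow> u i = v i) \<Longrightarrow> F u = F v"
  unfolding depends_on_def by blast

lemma CR_continuous: "CR I r F \<Longrightarrow> continuous_on UNIV F"
  by (cases r) auto

lemma CR_depends_on: "CR I r F \<Longrightarrow> depends_on I F"
  by (cases r) auto

lemma CR_SucD:
  assumes "CR I (Suc r) F" "i \<in> I"
  shows "((\<lambda>a. F (u(i := a))) has_real_derivative coord_deriv i F u) (at (u i))"
    and "CR I r (coord_deriv i F)"
proof -
  obtain G where G: "\<And>u. ((\<lambda>a. F (u(i := a))) has_real_derivative G u) (at (u i))" "CR I r G"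
    using assms by auto
  have "coord_deriv i F = G"
    using G(1) by (auto simp: coord_deriv_def fun_eq_iff intro!: DERIV_imp_deriv)
  with G show "((\<lambda>a. F (u(i := a))) has_real_derivative coord_deriv i F u) (at (u i))"
    and "CR I r (coord_deriv i F)" by auto
qed

lemma CR_Suc_lower: "CR I (Suc r) F \<Longrightarrow> CR I r F"
proof (induction r arbitrary: F)
  case (Suc r)
  then have "\<forall>i\<in>I. \<exists>G. (\<forall>u. ((\<lambda>a. F (u(i := a))) has_real_derivative G u) (at (u i))) \<and> CR I (Suc r) G"
    by (subst (asm) CR.simps(2)) blast
  then show ?case
    using Suc.IH Suc.prems by (subst CR.simps(2)) (blast dest: CR_continuous CR_depends_on)
qed auto

lemma CR_lower: "CR I r F \<Longrightarrow> r' \<le> r \<Longrightarrow> CR I r' F"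
proof (induction r)
  case (Suc r)
  then show ?case by (cases "r' = Suc r") (auto dest!: CR_Suc_lower simp del: CR.simps)
qed auto

lemma CR_const [simp]: "CR I r (\<lambda>u. c)"
proof (induction r arbitrary: c)
  case (Suc r)
  have "\<forall>i\<in>I. \<exists>G. (\<forall>u. ((\<lambda>a. c) has_real_derivative G u) (at (u i))) \<and> CR I r G"
    using Suc.IH by (intro ballI exI[of _ "\<lambda>u. 0"]) auto
  then show ?case by (auto simp: depends_on_def)
qed (auto simp: depends_on_def)

lemma CR_coord: "j \<in> I \<Longrightarrow> CR I r (\<lambda>u. u j)"
proof (cases r)
  case (Suc q)
  assume j: "j \<in> I"
  have "\<exists>G. (\<forall>u. ((\<lambda>a. (u(i := a)) j) has_real_derivative G u) (at (u i))) \<and> CR I q G" for i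
    by (rule exI[of _ "\<lambda>u. if i = j then 1 else 0"]) auto
  then show ?thesis using j Suc by (auto simp: depends_on_def intro: continuous_on_product_coordinates)
qed (auto simp: depends_on_def intro: continuous_on_product_coordinates)

lemma CR_add: "CR I r F \<Longrightarrow> CR I r G \<Longrightarrow> CR I r (\<lambda>u. F u + G u)"
proof (induction r arbitrary: F G)
  case 0
  then show ?case by (auto simp: depends_on_def intro!: continuous_intros) metis
next
  case (Suc r)
  have "\<exists>H. (\<forall>u. ((\<lambda>a. F (u(i := a)) + G (u(i := a))) has_real_derivative H u) (at (u i))) \<and> CR I r H"
    if "i \<in> I" for i
    by (intro exI[of _ "\<lambda>u. coord_deriv i F u + coord_deriv i G u"] conjI allI
      Suc.IH DERIV_add CR_SucD[OF Suc.prems(1) that] CR_SucD[OF Suc.prems(2) that])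
  moreover have "continuous_on UNIV (\<lambda>u. F u + G u)" "depends_on I (\<lambda>u. F u + G u)"
    using Suc.prems by (auto simp: depends_on_def intro!: continuous_intros) metis
  ultimately show ?case by (subst CR.simps(2)) blast
qed

lemma CR_mult: "CR I r F \<Longrightarrow> CR I r G \<Longrightarrow> CR I r (\<lambda>u. F u * G u)"
proof (induction r arbitrary: F G)
  case 0
  then show ?case by (auto simp: depends_on_def intro!: continuous_intros) metis
next
  case (Suc r)
  have "\<exists>H. (\<forall>u. ((\<lambda>a. F (u(i := a)) * G (u(i := a))) has_real_derivative H u) (at (u i))) \<and> CR I r H"
    if "i \<in> I" for i
  proof (intro exI[of _ "\<lambda>u. coord_deriv i F u * G u + coord_deriv i G u * F u"] conjI allI)
    show "((\<lambda>a. F (u(i := a)) * G (u(i := a))) has_real_derivative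
        coord_deriv i F u * G u + coord_deriv i G u * F u) (at (u i))" for u
      using DERIV_mult[OF CR_SucD(1)[OF Suc.prems(1) that, of u] CR_SucD(1)[OF Suc.prems(2) that, of u]]
      by (simp only: fun_upd_triv)
    show "CR I r (\<lambda>u. coord_deriv i F u * G u + coord_deriv i G u * F u)"
      by (intro CR_add Suc.IH CR_SucD[OF _ that] Suc.prems CR_Suc_lower)
  qed
  moreover have "continuous_on UNIV (\<lambda>u. F u * G u)" "depends_on I (\<lambda>u. F u * G u)"
    using Suc.prems by (auto simp: depends_on_def intro!: continuous_intros) metis
  ultimately show ?case by (subst CR.simps(2)) blast
qed

lemma CR_uminus: "CR I r F \<Longrightarrow> CR I r (\<lambda>u. - F u)"
  using CR_mult[OF CR_const[of I r "-1"]] by simp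

lemma CR_diff: "CR I r F \<Longrightarrow> CR I r G \<Longrightarrow> CR I r (\<lambda>u. F u - G u)"
  using CR_add[OF _ CR_uminus] by simp

lemma CR_sum: "(\<And>x. x \<in> A \<Longrightarrow> CR I r (F x)) \<Longrightarrow> CR I r (\<lambda>u. \<Sum>x\<in>A. F x u)"
  by (induction A rule: infinite_finite_induct) (auto intro: CR_add)

lemma CR_mono: "CR I r F \<Longrightarrow> I \<subseteq> J \<Longrightarrow> CR J r F"
proof (induction r arbitrary: F)
  case 0
  then show ?case unfolding CR.simps depends_on_def by blast
next
  case (Suc r)
  have dep: "depends_on J F" using CR_depends_on[OF Suc.prems(1)] Suc.prems(2)
    unfolding depends_on_def by blast
  have "\<exists>H. (\<forall>u. ((\<lambda>a. F (u(i := a))) has_real_derivative H u) (at (u i))) \<and> CR J r H"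
    if "i \<in> J" for i
  proof (cases "i \<in> I")
    case True
    show ?thesis
      by (intro exI[of _ "coord_deriv i F"] conjI allI Suc.IH[OF _ Suc.prems(2)]
        CR_SucD[OF Suc.prems(1) True])
  next
    \<comment> \<open>\<open>F\<close> ignores a coordinate outside \<open>I\<close>, so zero is a
      witness for the derivative in that direction.\<close>
    case False
    then have "F (u(i := a)) = F u" for u a
      using CR_depends_on[OF Suc.prems(1)] by (intro depends_onD[of I F]) auto
    then show ?thesis by (intro exI[of _ "\<lambda>u. 0"]) simp
  qed
  then show ?case using dep CR_continuous[OF Suc.prems(1)] by (subst CR.simps(2)) blast
qed

lemma continuous_on_reindex: "continuous_on UNIV (\<lambda>w::'j \<Rightarrow> real. \<lambda>i. w (f i))"
  by (rule continuous_on_coordinatewise_then_product) (rule continuous_on_product_coordinates)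

text \<open>Injectivity makes updating coordinate \<open>f i\<close> of \<open>w\<close> the same as
  updating coordinate \<open>i\<close> of the pullback, so partial derivatives commute with the
  renaming. This embeds functions of one argument among functions of several.\<close>

lemma CR_reindex:
  fixes f :: "'i \<Rightarrow> 'j"
  assumes "inj f" and "CR I r F"
  shows "CR (f ` I) r (\<lambda>w. F (\<lambda>i. w (f i)))"
  using assms(2)
proof (induction r arbitrary: F)
  case 0
  then have "continuous_on UNIV (\<lambda>w. F (\<lambda>i. w (f i)))"
    by (auto intro: continuous_on_compose2[OF _ continuous_on_reindex])
  then show ?case using 0 by (auto simp: depends_on_def)
next
  case (Suc r)
  have c: "continuous_on UNIV (\<lambda>w. F (\<lambda>i. w (f i)))"
    using CR_continuous[OF Suc.prems] by (auto intro: continuous_on_compose2[OF _ continuous_on_reindex])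
  have d: "depends_on (f ` I) (\<lambda>w. F (\<lambda>i. w (f i)))"
    using Suc.prems by (auto simp: depends_on_def)
  have "\<exists>H. (\<forall>w::'j \<Rightarrow> real. ((\<lambda>a. F (\<lambda>j. (w(f i := a)) (f j))) has_real_derivative H w) (at (w (f i)))) \<and> CR (f ` I) r H"
    if "i \<in> I" for i
  proof (intro exI[of _ "\<lambda>w. coord_deriv i F (\<lambda>i. w (f i))"] conjI allI)
    fix w :: "'j \<Rightarrow> real"
    have "(\<lambda>j. (w(f i := a)) (f j)) = (\<lambda>j. w (f j))(i := a)" for a
      using assms(1) by (auto simp: fun_eq_iff inj_eq)
    then show "((\<lambda>a. F (\<lambda>j. (w(f i := a)) (f j))) has_real_derivative coord_deriv i F (\<lambda>i. w (f i)))
        (at (w (f i)))"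
      using CR_SucD(1)[OF Suc.prems that, of "\<lambda>i. w (f i)"] by (simp only:)
    show "CR (f ` I) r (\<lambda>w. coord_deriv i F (\<lambda>i. w (f i)))"
      by (intro Suc.IH CR_SucD(2)[OF Suc.prems that])
  qed
  then show ?case using c d by (subst CR.simps(2)) blast
qed

lemma Cr_fun_imp_CR:
  assumes "Cr_fun d r F"
  shows "CR {1..d} r F"
proof -
  have "on_first d F" "partials_cont d r F" using assms by (auto simp: Cr_fun_def)
  then show ?thesis
  proof (induction r arbitrary: F)
    case 0
    then show ?case by (auto simp: on_first_def depends_on_def)
  next
    case (Suc r)
    have "\<exists>G. (\<forall>u. ((\<lambda>a. F (u(i := a))) has_real_derivative G u) (at (u i))) \<and> CR {1..d} r G"
      if i: "i \<in> {1..d}" for i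
    proof (intro exI[of _ "partial i F"] conjI allI)
      fix u
      show "((\<lambda>a. F (u(i := a))) has_real_derivative partial i F u) (at (u i))"
        unfolding partial_def using Suc.prems(2) i
        by (subst DERIV_deriv_iff_real_differentiable) auto
      \<comment> \<open>\<open>partials_cont\<close> speaks of existence and continuity only; that
        \<open>partial i F\<close> again depends on the first \<open>d\<close> coordinates has to be
        inherited from \<open>F\<close>.\<close>
      have "partial i F u = partial i F v" if "\<forall>i\<in>{1..d}. u i = v i" for u v
      proof -
        have "(\<lambda>a. F (u(i := a))) = (\<lambda>a. F (v(i := a)))"
        proof
          fix a
          have "\<forall>j\<in>{1..d}. (u(i := a)) j = (v(i := a)) j" using that by auto
          then show "F (u(i := a)) = F (v(i := a))"
            using Suc.prems(1) unfolding on_first_def by blast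
        qed
        then show ?thesis using that i by (simp add: partial_def)
      qed
      then have "on_first d (partial i F)" unfolding on_first_def by blast
      then show "CR {1..d} r (partial i F)"
        using Suc i by auto
    qed
    then show ?case using Suc.prems by (auto simp: on_first_def depends_on_def)
  qed
qed

section \<open>Continuity, compactness and differentiation in the product topology\<close>

lemma continuous_on_depends_on:
  fixes u :: "'t::topological_space \<Rightarrow> 'i \<Rightarrow> real"
  assumes "continuous_on UNIV F" "depends_on I F" "\<And>i. i \<in> I \<Longrightarrow> continuous_on S (\<lambda>t. u t i)"
  shows "continuous_on S (\<lambda>t. F (u t))"
proof -
  \<comment> \<open>Coordinates outside \<open>I\<close> are replaced by 0, as nothing is known
    about the continuity of \<open>u\<close> there.\<close>
  have eq: "F (u t) = F (\<lambda>i. if i \<in> I then u t i else 0)" for t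
    by (rule depends_onD[OF assms(2)]) auto
  have "continuous_on S (\<lambda>t i. if i \<in> I then u t i else 0)"
  proof (rule continuous_on_coordinatewise_then_product)
    fix i show "continuous_on S (\<lambda>t. if i \<in> I then u t i else 0)"
      by (cases "i \<in> I") (simp_all add: assms(3))
  qed
  then show ?thesis unfolding eq
    by (rule continuous_on_compose2[OF assms(1)]) auto
qed

lemma tendsto_coordinatewise:
  fixes f :: "'t \<Rightarrow> 'i \<Rightarrow> real"
  assumes "\<And>i. ((\<lambda>t. f t i) \<longlongrightarrow> l i) G"
  shows "(f \<longlongrightarrow> l) G"
proof -
  have "limitin (product_topology (\<lambda>i. euclidean) UNIV) f l G"
    using assms by (simp add: limitin_componentwise)
  then show ?thesis by (simp add: euclidean_product_topology)
qed

text \<open>Tychonoff: the box is a product of compact intervals, over any index type.\<close>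

lemma compact_box: "compact {u :: 'i \<Rightarrow> real. \<forall>i. \<bar>u i\<bar> \<le> M}"
proof -
  have "{u :: 'i \<Rightarrow> real. \<forall>i. \<bar>u i\<bar> \<le> M} = PiE UNIV (\<lambda>i. {- M..M})"
    by (auto simp: PiE_UNIV_domain Pi_iff abs_le_iff minus_le_iff)
  moreover have "compactin (product_topology (\<lambda>i. euclidean) UNIV) (PiE UNIV (\<lambda>i::'i. {- M..M::real}))"
    by (subst compactin_PiE) auto
  ultimately show ?thesis by (simp add: euclidean_product_topology flip: compactin_euclidean_iff)
qed

text \<open>Setting the coordinates outside \<open>I\<close> to zero moves \<open>u\<close> into the
  compact box without changing \<open>F u\<close>; \<open>M \<ge> 0\<close> puts zero itself inside
  the box.\<close>

lemma bounded_on_box: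
  fixes F :: "('i \<Rightarrow> real) \<Rightarrow> real"
  assumes "continuous_on UNIV F" "depends_on I F" "M \<ge> 0"
  obtains K where "K \<ge> 0" "\<And>u. (\<And>i. i \<in> I \<Longrightarrow> \<bar>u i\<bar> \<le> M) \<Longrightarrow> \<bar>F u\<bar> \<le> K"
proof -
  have "bounded (F ` {u. \<forall>i. \<bar>u i\<bar> \<le> M})"
    by (intro compact_imp_bounded compact_continuous_image compact_box continuous_on_subset[OF assms(1)]) auto
  then obtain K where K: "\<And>u. \<forall>i. \<bar>u i\<bar> \<le> M \<Longrightarrow> \<bar>F u\<bar> \<le> K"
    by (auto simp: bounded_iff)
  have "\<bar>F u\<bar> \<le> K" if "\<And>i. i \<in> I \<Longrightarrow> \<bar>u i\<bar> \<le> M" for u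
  proof -
    have "F u = F (\<lambda>i. if i \<in> I then u i else 0)" by (rule depends_onD[OF assms(2)]) auto
    then show ?thesis using K[of "\<lambda>i. if i \<in> I then u i else 0"] that assms(3) by simp
  qed
  then show thesis using that[of "max K 0"] by (meson max.cobounded2 le_max_iff_disj)
qed

text \<open>Changing the coordinates one at a time reduces both the local Lipschitz bound and the
  chain rule to the mean value theorem in one variable.\<close>

lemma CR_lipschitz_on_box:
  assumes F: "CR I (Suc 0) F" and "finite I" and "M \<ge> 0"
  obtains L where "L \<ge> 0"
    "\<And>u v. (\<And>i. i \<in> I \<Longrightarrow> \<bar>u i\<bar> \<le> M) \<Longrightarrow> (\<And>i. i \<in> I \<Longrightarrow> \<bar>v i\<bar> \<le> M) \<Longrightarrow>
       \<bar>F u - F v\<bar> \<le> L * (\<Sum>i\<in>I. \<bar>u i - v i\<bar>)"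
proof -
  have "\<exists>K. K \<ge> 0 \<and> (\<forall>u. (\<forall>i\<in>I. \<bar>u i\<bar> \<le> M) \<longrightarrow> \<bar>coord_deriv j F u\<bar> \<le> K)" if "j \<in> I" for j
    using bounded_on_box[OF CR_continuous CR_depends_on \<open>M \<ge> 0\<close>, OF CR_SucD(2) CR_SucD(2), OF F that F that]
    by metis
  then obtain K where K: "\<And>j. j \<in> I \<Longrightarrow> K j \<ge> 0"
      "\<And>j u. j \<in> I \<Longrightarrow> (\<And>i. i \<in> I \<Longrightarrow> \<bar>u i\<bar> \<le> M) \<Longrightarrow> \<bar>coord_deriv j F u\<bar> \<le> K j"
    by metis
  define L where "L = (\<Sum>j\<in>I. K j)"
  have KL: "K j \<le> L" if "j \<in> I" for j
    unfolding L_def using that K(1) \<open>finite I\<close> by (intro member_le_sum) auto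
  \<comment> \<open>The intermediate points mix coordinates of \<open>u\<close> and
    \<open>v\<close>, so they stay in the box where the bounds on the derivatives hold.\<close>
  have main: "\<bar>F u - F (\<lambda>i. if i \<in> J then v i else u i)\<bar> \<le> L * (\<Sum>i\<in>J. \<bar>u i - v i\<bar>)"
    if "\<And>i. i \<in> I \<Longrightarrow> \<bar>u i\<bar> \<le> M" "\<And>i. i \<in> I \<Longrightarrow> \<bar>v i\<bar> \<le> M" "J \<subseteq> I" for u v J
    using finite_subset[OF that(3) \<open>finite I\<close>] that(3)
  proof (induction J rule: finite_induct)
    case (insert j J)
    define w where "w = (\<lambda>i. if i \<in> J then v i else u i)"
    have j: "j \<in> I" using insert by auto
    have w': "(\<lambda>i. if i \<in> insert j J then v i else u i) = w(j := v j)"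
      by (auto simp: w_def)
    have wj: "w j = u j" using insert by (simp add: w_def)
    have "\<bar>F (w(j := v j)) - F (w(j := u j))\<bar> \<le> L * \<bar>v j - u j\<bar>"
    proof -
      have "norm (F (w(j := v j)) - F (w(j := u j))) \<le> L * norm (v j - u j)"
      proof (rule field_differentiable_bound[of "{- M..M}" _ "\<lambda>a. coord_deriv j F (w(j := a))"])
        fix a assume a: "a \<in> {- M..M}"
        show "((\<lambda>a. F (w(j := a))) has_field_derivative coord_deriv j F (w(j := a))) (at a within {- M..M})"
          using CR_SucD(1)[OF F j, of "w(j := a)"] by (auto intro: has_field_derivative_at_within)
        have "\<bar>coord_deriv j F (w(j := a))\<bar> \<le> K j"
          using a that by (intro K(2)[OF j]) (auto simp: w_def)
        then show "norm (coord_deriv j F (w(j := a))) \<le> L" using KL[OF j] by simp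
      qed (use that j in \<open>auto simp: abs_le_iff minus_le_iff\<close>)
      then show ?thesis by simp
    qed
    moreover have "w(j := u j) = w" using wj by auto
    moreover have "\<bar>F u - F w\<bar> \<le> L * (\<Sum>i\<in>J. \<bar>u i - v i\<bar>)" using insert by (simp add: w_def)
    ultimately show ?case unfolding w' using insert by (simp add: distrib_left abs_minus_commute)
  qed simp
  show thesis
  proof (rule that)
    show "L \<ge> 0" unfolding L_def using K(1) by (intro sum_nonneg) auto
    fix u v assume *: "\<And>i. i \<in> I \<Longrightarrow> \<bar>u i\<bar> \<le> M" "\<And>i. i \<in> I \<Longrightarrow> \<bar>v i\<bar> \<le> M"
    have "F (\<lambda>i. if i \<in> I then v i else u i) = F v"
      by (rule depends_onD[OF CR_depends_on[OF F]]) auto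
    then show "\<bar>F u - F v\<bar> \<le> L * (\<Sum>i\<in>I. \<bar>u i - v i\<bar>)"
      using main[of u v I] * by simp
  qed
qed

lemma CR_chain_rule:
  assumes F: "CR I (Suc 0) F" and "finite I"
    and u': "\<And>i. i \<in> I \<Longrightarrow> ((\<lambda>t. u t i) has_real_derivative u' i) (at t within S)"
  shows "((\<lambda>t. F (u t)) has_real_derivative (\<Sum>i\<in>I. coord_deriv i F (u t) * u' i)) (at t within S)"
proof -
  have main: "((\<lambda>\<tau>. F (\<lambda>i. if i \<in> J then u \<tau> i else u t i)) has_real_derivative
      (\<Sum>i\<in>J. coord_deriv i F (u t) * u' i)) (at t within S)" if "J \<subseteq> I" for J
    using finite_subset[OF that \<open>finite I\<close>] that
  proof (induction J rule: finite_induct)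
    case (insert j J)
    have j: "j \<in> I" using insert by auto
    define w where "w = (\<lambda>\<tau> i. if i \<in> J then u \<tau> i else u t i)"
    have wt: "w t = u t" "w \<tau> j = u t j" for \<tau> using insert by (auto simp: w_def)
    have upd: "(\<lambda>i. if i \<in> insert j J then u \<tau> i else u t i) = (w \<tau>)(j := u \<tau> j)" for \<tau>
      by (auto simp: w_def)
    \<comment> \<open>\<open>\<eta>\<close> is a mean value point between \<open>u t j\<close> and
      \<open>u \<tau> j\<close>. Only its distance to \<open>u t j\<close> is recorded: this makes
      it converge as \<open>\<tau>\<close> tends to \<open>t\<close>, whatever choice is made at
      each \<open>\<tau>\<close>.\<close>
    have "\<exists>\<eta>. \<bar>\<eta> - u t j\<bar> \<le> \<bar>u \<tau> j - u t j\<bar> \<and>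
        F ((w \<tau>)(j := u \<tau> j)) - F (w \<tau>) = coord_deriv j F ((w \<tau>)(j := \<eta>)) * (u \<tau> j - u t j)" for \<tau>
    proof -
      let ?f = "\<lambda>a. F ((w \<tau>)(j := a))"
      have d: "DERIV ?f a :> coord_deriv j F ((w \<tau>)(j := a))" for a
        using CR_SucD(1)[OF F j, of "(w \<tau>)(j := a)"] by simp
      have e: "(w \<tau>)(j := u t j) = w \<tau>" using wt(2)[of \<tau>] by auto
      consider "u \<tau> j = u t j" | "u t j < u \<tau> j" | "u \<tau> j < u t j" by linarith
      then show ?thesis
      proof cases
        case 1 then show ?thesis using e by (intro exI[of _ "u t j"]) simp
      next
        case 2
        from MVT2[OF 2, of ?f, OF d] obtain \<eta> where
          "u t j < \<eta>" "\<eta> < u \<tau> j" "?f (u \<tau> j) - ?f (u t j) = (u \<tau> j - u t j) * coord_deriv j F ((w \<tau>)(j := \<eta>))"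
          by blast
        then show ?thesis unfolding e by (intro exI[of _ \<eta>]) auto
      next
        case 3
        from MVT2[OF 3, of ?f, OF d] obtain \<eta> where
          "u \<tau> j < \<eta>" "\<eta> < u t j" "?f (u t j) - ?f (u \<tau> j) = (u t j - u \<tau> j) * coord_deriv j F ((w \<tau>)(j := \<eta>))"
          by blast
        then show ?thesis unfolding e by (intro exI[of _ \<eta>]) (auto simp: algebra_simps)
      qed
    qed
    then obtain \<eta> where \<eta>: "\<And>\<tau>. \<bar>\<eta> \<tau> - u t j\<bar> \<le> \<bar>u \<tau> j - u t j\<bar>"
      "\<And>\<tau>. F ((w \<tau>)(j := u \<tau> j)) - F (w \<tau>) = coord_deriv j F ((w \<tau>)(j := \<eta> \<tau>)) * (u \<tau> j - u t j)"
      by metis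
    have cont: "((\<lambda>\<tau>. u \<tau> i) \<longlongrightarrow> u t i) (at t within S)" if "i \<in> I" for i
      using has_field_derivative_imp_has_derivative[OF u'[OF that], THEN has_derivative_continuous]
      by (simp add: continuous_within)
    have "((\<lambda>\<tau>. u \<tau> j - u t j) \<longlongrightarrow> 0) (at t within S)"
      using cont[OF j] by (simp add: LIM_zero_iff)
    then have "((\<lambda>\<tau>. \<eta> \<tau> - u t j) \<longlongrightarrow> 0) (at t within S)"
      by (rule Lim_null_comparison[rotated, OF tendsto_norm_zero]) (use \<eta>(1) in auto)
    then have \<eta>lim: "(\<eta> \<longlongrightarrow> u t j) (at t within S)" by (simp add: LIM_zero_iff)
    \<comment> \<open>Coordinates in \<open>J\<close> converge because \<open>u\<close> is
      continuous at \<open>t\<close>, coordinate \<open>j\<close> because \<open>\<eta>\<close>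
      converges, and the others are frozen at their value at \<open>t\<close>.\<close>
    have "((\<lambda>\<tau>. (w \<tau>)(j := \<eta> \<tau>)) \<longlongrightarrow> u t) (at t within S)"
    proof (rule tendsto_coordinatewise)
      fix i
      show "((\<lambda>\<tau>. ((w \<tau>)(j := \<eta> \<tau>)) i) \<longlongrightarrow> u t i) (at t within S)"
        using \<eta>lim cont insert.prems by (cases "i = j"; cases "i \<in> J") (auto simp: w_def)
    qed
    then have lim: "((\<lambda>\<tau>. coord_deriv j F ((w \<tau>)(j := \<eta> \<tau>))) \<longlongrightarrow> coord_deriv j F (u t)) (at t within S)"
      by (rule continuous_on_tendsto_compose[OF CR_continuous[OF CR_SucD(2)[OF F j]]]) auto
    have "((\<lambda>\<tau>. F ((w \<tau>)(j := u \<tau> j)) - F (w \<tau>)) has_real_derivative coord_deriv j F (u t) * u' j) (at t within S)"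
    proof -
      have "((\<lambda>\<tau>. coord_deriv j F ((w \<tau>)(j := \<eta> \<tau>)) * ((u \<tau> j - u t j) / (\<tau> - t))) \<longlongrightarrow>
          coord_deriv j F (u t) * u' j) (at t within S)"
        using lim u'[OF j] by (intro tendsto_mult) (auto simp: has_field_derivative_iff)
      moreover have "(w t)(j := u t j) = w t" using wt by auto
      ultimately show ?thesis by (simp add: has_field_derivative_iff \<eta>(2))
    qed
    moreover have "((\<lambda>\<tau>. F (w \<tau>)) has_real_derivative (\<Sum>i\<in>J. coord_deriv i F (u t) * u' i)) (at t within S)"
      using insert by (simp add: w_def)
    ultimately have "((\<lambda>\<tau>. F ((w \<tau>)(j := u \<tau> j))) has_real_derivative
        coord_deriv j F (u t) * u' j + (\<Sum>i\<in>J. coord_deriv i F (u t) * u' i)) (at t within S)"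
      by (auto dest: DERIV_add)
    then show ?case unfolding upd using insert by simp
  qed simp
  have "F (\<lambda>i. if i \<in> I then u \<tau> i else u t i) = F (u \<tau>)" for \<tau>
    by (rule depends_onD[OF CR_depends_on[OF F]]) auto
  then show ?thesis using main[OF subset_refl] by simp
qed

section \<open>Backstepping transformations\<close>

definition CR2 :: "nat set \<Rightarrow> nat set \<Rightarrow> nat \<Rightarrow> ((nat \<Rightarrow> real) \<Rightarrow> (nat \<Rightarrow> real) \<Rightarrow> real) \<Rightarrow> bool" where
  "CR2 I J r F \<longleftrightarrow> CR (I <+> J) r (\<lambda>w. F (\<lambda>i. w (Inl i)) (\<lambda>i. w (Inr i)))"

definition CR3 :: "nat set \<Rightarrow> nat set \<Rightarrow> nat set \<Rightarrow> nat \<Rightarrow>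
    ((nat \<Rightarrow> real) \<Rightarrow> (nat \<Rightarrow> real) \<Rightarrow> (nat \<Rightarrow> real) \<Rightarrow> real) \<Rightarrow> bool" where
  "CR3 I J K r F \<longleftrightarrow> CR (I <+> (J <+> K)) r
     (\<lambda>w. F (\<lambda>i. w (Inl i)) (\<lambda>i. w (Inr (Inl i))) (\<lambda>i. w (Inr (Inr i))))"

lemma fun_upd_Inl_Inr:
  "(\<lambda>l. (w(Inl i := a)) (Inl l)) = (\<lambda>l. w (Inl l))(i := a)"
  "(\<lambda>l. (w(Inl i := a)) (Inr l)) = (\<lambda>l. w (Inr l))"
  "(\<lambda>l. (w(Inr j := a)) (Inl l)) = (\<lambda>l. w (Inl l))"
  "(\<lambda>l. (w(Inr j := a)) (Inr l)) = (\<lambda>l. w (Inr l))(j := a)"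
  by (auto simp: fun_eq_iff)

lemma fun_upd_Inr_Inl_Inr:
  "(\<lambda>l. (w(Inl i := a)) (Inr (f l))) = (\<lambda>l. w (Inr (f l)))"
  "(\<lambda>l. (w(Inr (Inl i) := a)) (Inr (Inl l))) = (\<lambda>l. w (Inr (Inl l)))(i := a)"
  "(\<lambda>l. (w(Inr (Inl i) := a)) (Inr (Inr l))) = (\<lambda>l. w (Inr (Inr l)))"
  "(\<lambda>l. (w(Inr (Inr j) := a)) (Inr (Inl l))) = (\<lambda>l. w (Inr (Inl l)))"
  "(\<lambda>l. (w(Inr (Inr j) := a)) (Inr (Inr l))) = (\<lambda>l. w (Inr (Inr l)))(j := a)"
  by (auto simp: fun_eq_iff)

lemma coord_deriv_pair:
  "coord_deriv (Inl i) (\<lambda>w. F (\<lambda>i. w (Inl i)) (\<lambda>i. w (Inr i))) w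
     = partial i (\<lambda>u. F u (\<lambda>i. w (Inr i))) (\<lambda>i. w (Inl i))"
  "coord_deriv (Inr j) (\<lambda>w. F (\<lambda>i. w (Inl i)) (\<lambda>i. w (Inr i))) w
     = partial j (\<lambda>v. F (\<lambda>i. w (Inl i)) v) (\<lambda>i. w (Inr i))"
  unfolding coord_deriv_def partial_def fun_upd_Inl_Inr by (rule refl)+

lemma coord_deriv_triple:
  "coord_deriv (Inl i) (\<lambda>w. F (\<lambda>i. w (Inl i)) (\<lambda>i. w (Inr (Inl i))) (\<lambda>i. w (Inr (Inr i)))) w
     = partial i (\<lambda>u. F u (\<lambda>i. w (Inr (Inl i))) (\<lambda>i. w (Inr (Inr i)))) (\<lambda>i. w (Inl i))"
  "coord_deriv (Inr (Inl j)) (\<lambda>w. F (\<lambda>i. w (Inl i)) (\<lambda>i. w (Inr (Inl i))) (\<lambda>i. w (Inr (Inr i)))) w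
     = partial j (\<lambda>v. F (\<lambda>i. w (Inl i)) v (\<lambda>i. w (Inr (Inr i)))) (\<lambda>i. w (Inr (Inl i)))"
  "coord_deriv (Inr (Inr l)) (\<lambda>w. F (\<lambda>i. w (Inl i)) (\<lambda>i. w (Inr (Inl i))) (\<lambda>i. w (Inr (Inr i)))) w
     = partial l (\<lambda>v. F (\<lambda>i. w (Inl i)) (\<lambda>i. w (Inr (Inl i))) v) (\<lambda>i. w (Inr (Inr i)))"
  unfolding coord_deriv_def partial_def fun_upd_Inl_Inr fun_upd_Inr_Inl_Inr by (rule refl)+

lemma CR2_partial:
  assumes "CR2 I J (Suc r) F"
  shows "i \<in> I \<Longrightarrow> CR2 I J r (\<lambda>u v. partial i (\<lambda>u. F u v) u)"
    and "j \<in> J \<Longrightarrow> CR2 I J r (\<lambda>u v. partial j (\<lambda>v. F u v) v)"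
  using CR_SucD(2)[OF assms[unfolded CR2_def], of "Inl i"]
    CR_SucD(2)[OF assms[unfolded CR2_def], of "Inr j"]
  by (auto simp: CR2_def coord_deriv_pair[abs_def])

lemma CR3_partial:
  assumes "CR3 I J K (Suc r) F"
  shows "i \<in> I \<Longrightarrow> CR3 I J K r (\<lambda>u v w. partial i (\<lambda>u. F u v w) u)"
    and "j \<in> J \<Longrightarrow> CR3 I J K r (\<lambda>u v w. partial j (\<lambda>v. F u v w) v)"
    and "l \<in> K \<Longrightarrow> CR3 I J K r (\<lambda>u v w. partial l (\<lambda>w. F u v w) w)"
  using CR_SucD(2)[OF assms[unfolded CR3_def], of "Inl i"]
    CR_SucD(2)[OF assms[unfolded CR3_def], of "Inr (Inl j)"]
    CR_SucD(2)[OF assms[unfolded CR3_def], of "Inr (Inr l)"]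
  by (auto simp: CR3_def coord_deriv_triple[abs_def])

lemma CR2_chain_rule:
  assumes "CR2 I J (Suc 0) F" "finite I" "finite J"
    and "\<And>i. i \<in> I \<Longrightarrow> ((\<lambda>t. u t i) has_real_derivative u' i) (at t within S)"
    and "\<And>j. j \<in> J \<Longrightarrow> ((\<lambda>t. v t j) has_real_derivative v' j) (at t within S)"
  shows "((\<lambda>t. F (u t) (v t)) has_real_derivative
      (\<Sum>i\<in>I. partial i (\<lambda>u. F u (v t)) (u t) * u' i)
    + (\<Sum>j\<in>J. partial j (\<lambda>v. F (u t) v) (v t) * v' j)) (at t within S)"
proof -
  let ?F = "\<lambda>w. F (\<lambda>i. w (Inl i)) (\<lambda>i. w (Inr i))"
  let ?w = "\<lambda>t. case_sum (u t) (v t)" and ?w' = "case_sum u' v'"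
  have "((\<lambda>t. ?F (?w t)) has_real_derivative (\<Sum>i\<in>I <+> J. coord_deriv i ?F (?w t) * ?w' i)) (at t within S)"
    by (rule CR_chain_rule[OF assms(1)[unfolded CR2_def]]) (use assms in auto)
  then show ?thesis using assms(2,3)
    by (simp add: sum.Plus coord_deriv_pair)
qed

lemma CR3_chain_rule:
  assumes "CR3 I J K (Suc 0) F" "finite I" "finite J" "finite K"
    and "\<And>i. i \<in> I \<Longrightarrow> ((\<lambda>t. u t i) has_real_derivative u' i) (at t within S)"
    and "\<And>j. j \<in> J \<Longrightarrow> ((\<lambda>t. v t j) has_real_derivative v' j) (at t within S)"
    and "\<And>l. l \<in> K \<Longrightarrow> ((\<lambda>t. w t l) has_real_derivative w' l) (at t within S)"
  shows "((\<lambda>t. F (u t) (v t) (w t)) has_real_derivative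
      (\<Sum>i\<in>I. partial i (\<lambda>u. F u (v t) (w t)) (u t) * u' i)
    + (\<Sum>j\<in>J. partial j (\<lambda>v. F (u t) v (w t)) (v t) * v' j)
    + (\<Sum>l\<in>K. partial l (\<lambda>w. F (u t) (v t) w) (w t) * w' l)) (at t within S)"
proof -
  let ?F = "\<lambda>w. F (\<lambda>i. w (Inl i)) (\<lambda>i. w (Inr (Inl i))) (\<lambda>i. w (Inr (Inr i)))"
  let ?w = "\<lambda>t. case_sum (u t) (case_sum (v t) (w t))" and ?w' = "case_sum u' (case_sum v' w')"
  have "((\<lambda>t. ?F (?w t)) has_real_derivative (\<Sum>i\<in>I <+> (J <+> K). coord_deriv i ?F (?w t) * ?w' i)) (at t within S)"
    by (rule CR_chain_rule[OF assms(1)[unfolded CR3_def]]) (use assms in auto)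
  then show ?thesis using assms(2-4)
    by (simp add: sum.Plus finite_Plus coord_deriv_triple add.assoc)
qed

lemma CR2_lower: "CR2 I J r F \<Longrightarrow> r' \<le> r \<Longrightarrow> CR2 I J r' F"
  unfolding CR2_def by (rule CR_lower)

lemma CR3_lower: "CR3 I J K r F \<Longrightarrow> r' \<le> r \<Longrightarrow> CR3 I J K r' F"
  unfolding CR3_def by (rule CR_lower)

lemma CR2_mono: "CR2 I J r F \<Longrightarrow> I \<subseteq> I' \<Longrightarrow> J \<subseteq> J' \<Longrightarrow> CR2 I' J' r F"
  unfolding CR2_def by (erule CR_mono) auto

lemma CR3_mono: "CR3 I J K r F \<Longrightarrow> I \<subseteq> I' \<Longrightarrow> J \<subseteq> J' \<Longrightarrow> K \<subseteq> K' \<Longrightarrow> CR3 I' J' K' r F"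
  unfolding CR3_def by (erule CR_mono) auto

lemma CR2_fst: "CR I r F \<Longrightarrow> CR2 I J r (\<lambda>u v. F u)"
  unfolding CR2_def by (rule CR_mono[OF CR_reindex[of Inl]]) auto

lemma CR3_fst: "CR I r F \<Longrightarrow> CR3 I J K r (\<lambda>u v w. F u)"
  unfolding CR3_def by (rule CR_mono[OF CR_reindex[of Inl]]) auto

lemma CR3_snd: "CR J r F \<Longrightarrow> CR3 I J K r (\<lambda>u v w. F v)"
  unfolding CR3_def by (rule CR_mono[OF CR_reindex[of "Inr \<circ> Inl", unfolded o_def]]) (auto simp: inj_def)

text \<open>The embedding that skips the middle argument; it is applied to \<open>h n\<close>, which
  reads the predictor state and the jet but not the state \<open>x\<close>.\<close>

lemma CR3_fst_thd:
  assumes "CR2 I K r F"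
  shows "CR3 I J K r (\<lambda>u v w. F u w)"
proof -
  let ?f = "case_sum Inl (Inr \<circ> Inr)"
  have "inj ?f" by (auto simp: inj_def split: sum.splits)
  then show ?thesis
    using CR_mono[OF CR_reindex[OF _ assms[unfolded CR2_def]], of ?f "I <+> (J <+> K)"]
    unfolding CR3_def by (fastforce simp: o_def)
qed

lemma CR2_coord: "i \<in> I \<Longrightarrow> CR2 I J r (\<lambda>u v. u i)" "j \<in> J \<Longrightarrow> CR2 I J r (\<lambda>u v. v j)"
  unfolding CR2_def by (rule CR_coord; auto)+

lemma CR3_coord:
  "i \<in> I \<Longrightarrow> CR3 I J K r (\<lambda>u v w. u i)" "j \<in> J \<Longrightarrow> CR3 I J K r (\<lambda>u v w. v j)"
  "l \<in> K \<Longrightarrow> CR3 I J K r (\<lambda>u v w. w l)"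
  unfolding CR3_def by (rule CR_coord; auto)+

lemma CR2_arith:
  "CR2 I J r (\<lambda>u v. a)"
  "CR2 I J r F \<Longrightarrow> CR2 I J r G \<Longrightarrow> CR2 I J r (\<lambda>u v. F u v + G u v)"
  "CR2 I J r F \<Longrightarrow> CR2 I J r G \<Longrightarrow> CR2 I J r (\<lambda>u v. F u v - G u v)"
  "CR2 I J r F \<Longrightarrow> CR2 I J r G \<Longrightarrow> CR2 I J r (\<lambda>u v. F u v * G u v)"
  "(\<And>x. x \<in> A \<Longrightarrow> CR2 I J r (H x)) \<Longrightarrow> CR2 I J r (\<lambda>u v. \<Sum>x\<in>A. H x u v)"
  unfolding CR2_def by (fact CR_const CR_add CR_diff CR_mult CR_sum)+

lemma CR3_arith:
  "CR3 I J K r (\<lambda>u v w. a)"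
  "CR3 I J K r F \<Longrightarrow> CR3 I J K r G \<Longrightarrow> CR3 I J K r (\<lambda>u v w. F u v w + G u v w)"
  "CR3 I J K r F \<Longrightarrow> CR3 I J K r G \<Longrightarrow> CR3 I J K r (\<lambda>u v w. F u v w * G u v w)"
  "(\<And>x. x \<in> A \<Longrightarrow> CR3 I J K r (H x)) \<Longrightarrow> CR3 I J K r (\<lambda>u v w. \<Sum>x\<in>A. H x u v w)"
  unfolding CR3_def by (fact CR_const CR_add CR_mult CR_sum)+

lemma CR2_depends_on:
  assumes "CR2 I J r F" "\<And>i. i \<in> I \<Longrightarrow> u i = u' i" "\<And>j. j \<in> J \<Longrightarrow> v j = v' j"
  shows "F u v = F u' v'"
proof -
  have "case_sum u v i = case_sum u' v' i" if "i \<in> I <+> J" for i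
    using that assms(2,3) by auto
  then show ?thesis
    using depends_onD[OF CR_depends_on[OF assms(1)[unfolded CR2_def]], of "case_sum u v" "case_sum u' v'"]
    by simp
qed

lemma CR3_depends_on:
  assumes "CR3 I J K r F" "\<And>i. i \<in> I \<Longrightarrow> u i = u' i" "\<And>j. j \<in> J \<Longrightarrow> v j = v' j"
    "\<And>l. l \<in> K \<Longrightarrow> w l = w' l"
  shows "F u v w = F u' v' w'"
proof -
  have "case_sum u (case_sum v w) i = case_sum u' (case_sum v' w') i" if "i \<in> I <+> (J <+> K)" for i
    using that assms(2-4) by auto
  then show ?thesis
    using depends_onD[OF CR_depends_on[OF assms(1)[unfolded CR3_def]],
        of "case_sum u (case_sum v w)" "case_sum u' (case_sum v' w')"]
    by simp
qed

text \<open>Differentiating along the dynamics costs one order of smoothness and reaches one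
  coordinate further in both arguments, through \<open>u (l + 1)\<close> and
  \<open>\<sigma> l\<close> at \<open>l = i\<close>.\<close>

lemma CR2_cascade_deriv:
  assumes "CR2 {1..i} {..<i} (Suc r) F" and "\<And>l. l \<in> {1..i} \<Longrightarrow> CR {1..l} r (g l)"
  shows "CR2 {1..Suc i} {..<Suc i} r (cascade_deriv g i F)"
proof -
  have "CR2 {1..Suc i} {..<Suc i} r (\<lambda>u \<sigma>. \<Sum>l = 1..i. partial l (\<lambda>u. F u \<sigma>) u * (u (l + 1) + g l u)
               + partial (l - 1) (\<lambda>\<sigma>. F u \<sigma>) \<sigma> * \<sigma> l)"
  proof (intro CR2_arith)
    fix l assume l: "l \<in> {1..i}"
    show "CR2 {1..Suc i} {..<Suc i} r (\<lambda>u \<sigma>. partial l (\<lambda>u. F u \<sigma>) u)"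
      by (rule CR2_mono[OF CR2_partial(1)[OF assms(1) l]]) auto
    show "CR2 {1..Suc i} {..<Suc i} r (\<lambda>u \<sigma>. partial (l - 1) (\<lambda>\<sigma>. F u \<sigma>) \<sigma>)"
      by (rule CR2_mono[OF CR2_partial(2)[OF assms(1)]]) (use l in auto)
    show "CR2 {1..Suc i} {..<Suc i} r (\<lambda>u \<sigma>. g l u)"
      by (rule CR2_fst[OF CR_mono[OF assms(2)[OF l]]]) (use l in auto)
  qed (auto intro!: CR2_coord)
  then show ?thesis unfolding cascade_deriv_def[abs_def] .
qed

lemma cascade_deriv_has_derivative:
  assumes "CR2 {1..i} {..<i} (Suc 0) F"
    and "\<And>l. l \<in> {1..i} \<Longrightarrow> ((\<lambda>t. u t l) has_real_derivative u t (l + 1) + g l (u t)) (at t within S)"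
    and "\<And>l. l < i \<Longrightarrow> ((\<lambda>t. \<sigma> t l) has_real_derivative \<sigma> t (Suc l)) (at t within S)"
  shows "((\<lambda>t. F (u t) (\<sigma> t)) has_real_derivative cascade_deriv g i F (u t) (\<sigma> t)) (at t within S)"
proof -
  \<comment> \<open>\<open>cascade_deriv\<close> pairs jet entry \<open>l - 1\<close> with state
    \<open>l\<close>, whereas the chain rule numbers the jet from 0.\<close>
  have "(\<Sum>j<i. partial j (\<lambda>v. F (u t) v) (\<sigma> t) * \<sigma> t (Suc j))
      = (\<Sum>l=1..i. partial (l - 1) (\<lambda>v. F (u t) v) (\<sigma> t) * \<sigma> t l)"
    by (rule sum.reindex_bij_witness[of _ "\<lambda>l. l - 1" Suc]) auto
  then show ?thesis
    using CR2_chain_rule[OF assms(1), of u "\<lambda>l. u t (l + 1) + g l (u t)" t S \<sigma> "\<lambda>l. \<sigma> t (Suc l)"] assms(2,3)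
    by (simp add: cascade_deriv_def sum.distrib)
qed

text \<open>The two recursions coincide for \<open>b = 1\<close>, so one treatment of cascades
  serves the \<open>Y\<close>-part and the \<open>X\<close>-part.\<close>

lemma h_fun_eq_tau_fun: "h_fun \<psi> k i = tau_fun 1 \<psi> k i"
  by (induction i) (simp_all add: fun_eq_iff[of "h_fun \<psi> k (Suc _)"])

text \<open>\<open>R\<close> is the smoothness budget, of which stage \<open>l\<close> has lost
  \<open>l\<close> orders. The \<open>Y\<close>-part uses \<open>R = n + m\<close>,
  \<open>N = n\<close> and keeps \<open>m\<close> orders at the end; the \<open>X\<close>-part uses
  \<open>R = N = m\<close> and keeps none.\<close>

locale cascade =
  fixes R N :: nat and b :: real and g :: "nat \<Rightarrow> (nat \<Rightarrow> real) \<Rightarrow> real" and c :: "nat \<Rightarrow> real"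
  assumes N_le: "N \<le> R" and b_nz: "b \<noteq> 0"
    and g_CR: "\<And>l. l \<in> {1..N} \<Longrightarrow> CR {1..l} (R - l) (g l)"
    and g_0: "\<And>l. l \<in> {1..N} \<Longrightarrow> g l (\<lambda>_. 0) = 0"
begin

abbreviation "\<tau> \<equiv> tau_fun b g c"

text \<open>The order drops by one per stage both through \<open>cascade_deriv\<close> and in the
  assumption on \<open>g\<close>, so the two losses run in step.\<close>

lemma tau_CR2: "j \<le> N \<Longrightarrow> CR2 {1..j} {..<j} (R - j) (\<tau> j)"
proof (induction j)
  case 0
  then show ?case by (simp add: CR2_arith)
next
  case (Suc j)
  then have IH: "CR2 {1..j} {..<j} (Suc (R - Suc j)) (\<tau> j)"
    using N_le by (simp add: Suc_diff_Suc)
  have "CR2 {1..Suc j} {..<Suc j} (R - Suc j) (\<tau> j)"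
    by (rule CR2_mono[OF CR2_lower[OF IH]]) auto
  moreover have "CR2 {1..Suc j} {..<Suc j} (R - Suc j) (\<lambda>u \<sigma>. g (Suc j) u)"
    using Suc.prems by (intro CR2_fst g_CR) auto
  moreover have "CR2 {1..Suc j} {..<Suc j} (R - Suc j) (cascade_deriv g j (\<tau> j))"
  proof (rule CR2_cascade_deriv[OF IH])
    fix l assume "l \<in> {1..j}"
    then show "CR {1..l} (R - Suc j) (g l)" using Suc.prems by (intro CR_lower[OF g_CR]) auto
  qed
  ultimately show ?case
    unfolding tau_fun.simps by (intro CR2_arith CR2_coord) auto
qed

lemma tau_zero: "j \<le> N \<Longrightarrow> \<tau> j (\<lambda>_. 0) (\<lambda>_. 0) = 0"
proof (induction j)
  case (Suc j)
  \<comment> \<open>The partial derivatives at the origin stay unknown; each is multiplied by a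
    velocity or a jet entry that vanishes there.\<close>
  then have "cascade_deriv g j (\<tau> j) (\<lambda>_. 0) (\<lambda>_. 0) = 0"
    unfolding cascade_deriv_def by (intro sum.neutral) (auto simp: g_0)
  with Suc show ?case by (simp add: g_0)
qed simp

text \<open>\<open>\<tau> j\<close> involves only the first \<open>j\<close> states, so its
  derivative is known beforehand and can be added or subtracted on either side;
  \<open>b \<noteq> 0\<close> allows the way back to the state. \<open>v\<close> is a virtual input:
  the next state, or the actual input at the last stage.\<close>

lemma error_has_derivative_iff:
  assumes "j < N"
    and "\<And>l. l \<in> {1..j} \<Longrightarrow> ((\<lambda>t. u t l) has_real_derivative u t (l + 1) + g l (u t)) (at t within S)"
    and "\<And>l. l \<le> j \<Longrightarrow> ((\<lambda>t. \<sigma> t l) has_real_derivative \<sigma> t (Suc l)) (at t within S)"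
  shows "((\<lambda>t. u t (Suc j)) has_real_derivative v + g (Suc j) (u t)) (at t within S) \<longleftrightarrow>
    ((\<lambda>t. b * u t (Suc j) - \<tau> j (u t) (\<sigma> t) - \<sigma> t j) has_real_derivative
      - c (Suc j) * (b * u t (Suc j) - \<tau> j (u t) (\<sigma> t) - \<sigma> t j)
      + (b * v - \<tau> (Suc j) (u t) (\<sigma> t) - \<sigma> t (Suc j))) (at t within S)"
    (is "?U \<longleftrightarrow> ?E")
proof -
  let ?C = "cascade_deriv g j (\<tau> j) (u t) (\<sigma> t)"
  have "CR2 {1..j} {..<j} (Suc 0) (\<tau> j)"
    using assms(1) N_le by (intro CR2_lower[OF tau_CR2]) auto
  then have d: "((\<lambda>t. \<tau> j (u t) (\<sigma> t) + \<sigma> t j) has_real_derivative ?C + \<sigma> t (Suc j)) (at t within S)"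
    by (intro DERIV_add cascade_deriv_has_derivative assms(2,3)) auto
  show ?thesis
  proof
    assume ?U
    from DERIV_diff[OF DERIV_cmult[OF this, of b] d] show ?E
      by (simp add: algebra_simps)
  next
    assume ?E
    from DERIV_cmult[OF DERIV_add[OF this d], of "1 / b"] show ?U
      using b_nz by (simp add: add_divide_distrib algebra_simps)
  qed
qed

end

section \<open>Chains of first-order filters\<close>

lemma integral_has_derivative_halfline:
  fixes g :: "real \<Rightarrow> real"
  assumes "continuous_on {a..} g" "t \<ge> a"
  shows "((\<lambda>t. integral {a..t} g) has_real_derivative g t) (at t within {a..})"
proof -
  have "((\<lambda>t. integral {a..t} g) has_real_derivative g t) (at t within {a..t + 1})"
    using assms by (intro integral_has_real_derivative continuous_on_subset[OF assms(1)]) auto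
  moreover have "at t within {a..t + 1} = at t within {a..}"
    using assms(2) by (intro at_within_nhd[of t "{t - 1<..<t + 1}"]) auto
  ultimately show ?thesis by simp
qed

lemma has_derivative_halfline_imp_continuous:
  fixes f :: "real \<Rightarrow> real"
  assumes "\<And>t. t \<ge> a \<Longrightarrow> (f has_real_derivative f' t) (at t within {a..})"
  shows "continuous_on {a..} f"
  using assms by (intro DERIV_continuous_on) auto

lemma derivative_nonneg_imp_le:
  fixes f :: "real \<Rightarrow> real"
  assumes "\<And>t. a \<le> t \<Longrightarrow> t \<le> T \<Longrightarrow> (f has_real_derivative f' t) (at t within {a..T})"
    and "\<And>t. a \<le> t \<Longrightarrow> t \<le> T \<Longrightarrow> f' t \<ge> 0" and "a \<le> T"
  shows "f a \<le> f T"
proof (rule DERIV_nonneg_imp_increasing_open[OF assms(3)])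
  fix x assume x: "a < x" "x < T"
  have "at x within {a..T} = at x" using x by (intro at_within_interior) auto
  then show "\<exists>y. (f has_real_derivative y) (at x) \<and> 0 \<le> y"
    using assms(1,2)[of x] x by auto
next
  show "continuous_on {a..T} f"
    by (rule DERIV_continuous_on[OF assms(1)]) auto
qed

lemma derivative_nonneg_imp_le_halfline:
  fixes f :: "real \<Rightarrow> real"
  assumes "\<And>t. t \<ge> a \<Longrightarrow> (f has_real_derivative f' t) (at t within {a..})"
    and "\<And>t. t \<ge> a \<Longrightarrow> f' t \<ge> 0" and "a \<le> T"
  shows "f a \<le> f T"
  by (rule derivative_nonneg_imp_le[OF has_field_derivative_subset[OF assms(1)]]) (use assms in auto)

lemma exp_weighted_derivative:
  assumes "(z has_real_derivative - \<kappa> * z t + w) (at t within S)"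
  shows "((\<lambda>t. exp (\<kappa> * t) * z t) has_real_derivative exp (\<kappa> * t) * w) (at t within S)"
proof -
  have "((\<lambda>t. exp (\<kappa> * t)) has_real_derivative exp (\<kappa> * t) * \<kappa>) (at t within S)"
    by (auto intro!: derivative_eq_intros)
  from DERIV_mult[OF this assms] show ?thesis by (simp add: algebra_simps)
qed

text \<open>\<open>C / (\<kappa> - 1)\<close> is the amplitude of the particular solution driven by
  \<open>C * exp (- t)\<close>, and \<open>\<kappa> > 1\<close> makes the homogeneous part decay at
  least as fast as \<open>exp (- t)\<close>. The rate is thus passed on unchanged and only the
  constant grows.\<close>

lemma stable_upper_bound:
  assumes z: "\<And>t. t \<ge> 0 \<Longrightarrow> (z has_real_derivative - \<kappa> * z t + w t) (at t within {0..})"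
    and w: "\<And>t. t \<ge> 0 \<Longrightarrow> w t \<le> C * exp (- t)" and "C \<ge> 0" "\<kappa> > 1" "t \<ge> 0"
  shows "z t \<le> (\<bar>z 0\<bar> + C / (\<kappa> - 1)) * exp (- t)"
proof -
  define A where "A = C / (\<kappa> - 1)"
  have A: "A \<ge> 0" "A * (\<kappa> - 1) = C" using assms by (auto simp: A_def)
  \<comment> \<open>The derivative of \<open>?f\<close> is \<open>exp (\<kappa> * t)\<close> times
    \<open>C * exp (- t) - w t\<close>, hence nonnegative.\<close>
  let ?f = "\<lambda>t. A * exp ((\<kappa> - 1) * t) - exp (\<kappa> * t) * z t"
  have "?f 0 \<le> ?f t"
  proof (rule derivative_nonneg_imp_le_halfline[OF _ _ \<open>t \<ge> 0\<close>])
    fix t :: real assume t: "t \<ge> 0"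
    have "((\<lambda>t. A * exp ((\<kappa> - 1) * t)) has_real_derivative C * exp ((\<kappa> - 1) * t)) (at t within {0..})"
      using A(2) by (auto intro!: derivative_eq_intros)
    then show "(?f has_real_derivative C * exp ((\<kappa> - 1) * t) - exp (\<kappa> * t) * w t) (at t within {0..})"
      by (intro DERIV_diff exp_weighted_derivative z[OF t])
    have "exp (\<kappa> * t) * w t \<le> exp (\<kappa> * t) * (C * exp (- t))"
      using w[OF t] by simp
    also have "\<dots> = C * exp ((\<kappa> - 1) * t)"
      by (simp add: exp_add[symmetric] algebra_simps)
    finally show "0 \<le> C * exp ((\<kappa> - 1) * t) - exp (\<kappa> * t) * w t" by simp
  qed
  then have "exp (\<kappa> * t) * z t \<le> \<bar>z 0\<bar> + A * exp ((\<kappa> - 1) * t)"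
    using A(1) by simp
  also have "\<dots> \<le> \<bar>z 0\<bar> * exp ((\<kappa> - 1) * t) + A * exp ((\<kappa> - 1) * t)"
    using assms(4,5) by (simp add: mult_le_cancel_left1)
  also have "\<dots> = exp (\<kappa> * t) * ((\<bar>z 0\<bar> + A) * exp (- t))"
    by (simp add: exp_add[symmetric] algebra_simps)
  finally show ?thesis by (simp add: A_def)
qed

lemma stable_bound:
  assumes z: "\<And>t. t \<ge> 0 \<Longrightarrow> (z has_real_derivative - \<kappa> * z t + w t) (at t within {0..})"
    and w: "\<And>t. t \<ge> 0 \<Longrightarrow> \<bar>w t\<bar> \<le> C * exp (- t)" and "C \<ge> 0" "\<kappa> > 1" "t \<ge> 0"
  shows "\<bar>z t\<bar> \<le> (\<bar>z 0\<bar> + C / (\<kappa> - 1)) * exp (- t)"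
proof -
  have "((\<lambda>t. - z t) has_real_derivative - \<kappa> * - z t + - w t) (at t within {0..})" if "t \<ge> 0" for t
    using DERIV_minus[OF z[OF that]] by simp
  from stable_upper_bound[OF this] stable_upper_bound[OF z] w assms(3-5)
  show ?thesis by (simp add: abs_le_iff minus_le_iff)
qed

text \<open>\<open>z (Suc N)\<close> is the input of the chain.\<close>

definition filter_chain :: "nat \<Rightarrow> (nat \<Rightarrow> real) \<Rightarrow> (nat \<Rightarrow> real \<Rightarrow> real) \<Rightarrow> bool" where
  "filter_chain N \<kappa> z \<longleftrightarrow> (\<forall>i\<in>{1..N}. \<forall>t\<ge>0.
     (z i has_real_derivative - \<kappa> i * z i t + z (Suc i) t) (at t within {0..}))"

text \<open>The sign travels from the input end downwards, which is the direction of
  \<open>inc_induct\<close>: while \<open>z (Suc i)\<close> is nonnegative,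
  \<open>exp (\<kappa> i * t) * z i t\<close> cannot decrease.\<close>

lemma filter_chain_nonneg:
  assumes "filter_chain N \<kappa> z" "\<And>i. i \<in> {1..N} \<Longrightarrow> z i 0 \<ge> 0"
    and "\<And>t. t \<ge> 0 \<Longrightarrow> z (Suc N) t \<ge> 0" and "i \<in> {1..Suc N}" "t \<ge> 0"
  shows "z i t \<ge> 0"
proof -
  have "i \<le> Suc N" "1 \<le> i" using assms(4) by auto
  then have "\<forall>t\<ge>0. z i t \<ge> 0"
  proof (induction i rule: inc_induct)
    case base
    then show ?case using assms(3) by auto
  next
    case (step i)
    show ?case
    proof (intro allI impI)
      fix t :: real assume t: "t \<ge> 0"
      have "exp (\<kappa> i * 0) * z i 0 \<le> exp (\<kappa> i * t) * z i t"
      proof (rule derivative_nonneg_imp_le_halfline[OF _ _ t])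
        show "((\<lambda>t. exp (\<kappa> i * t) * z i t) has_real_derivative exp (\<kappa> i * t) * z (Suc i) t) (at t within {0..})"
          if "t \<ge> 0" for t
          using assms(1) step that by (intro exp_weighted_derivative) (auto simp: filter_chain_def)
        show "0 \<le> exp (\<kappa> i * t) * z (Suc i) t" if "0 \<le> t" for t
          using step that by simp
      qed
      moreover have "z i 0 \<ge> 0" using assms(2) step by auto
      ultimately have "0 \<le> exp (\<kappa> i * t) * z i t" by simp
      then show "z i t \<ge> 0" by (simp add: zero_le_mult_iff)
    qed
  qed
  then show ?thesis using assms(5) by simp
qed

text \<open>Because every gain strictly exceeds 1, the common rate \<open>exp (- t)\<close> survives
  each stage without polynomial factors.\<close>

lemma filter_chain_decay:
  assumes "filter_chain N \<kappa> z" "\<And>i. i \<in> {1..N} \<Longrightarrow> \<kappa> i > 1"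
    and "\<exists>C. \<forall>t\<ge>0. \<bar>z (Suc N) t\<bar> \<le> C * exp (- t)" and "i \<in> {1..Suc N}"
  shows "\<exists>C. \<forall>t\<ge>0. \<bar>z i t\<bar> \<le> C * exp (- t)"
proof -
  have "i \<le> Suc N" "1 \<le> i" using assms(4) by auto
  then show ?thesis
  proof (induction i rule: inc_induct)
    case base
    then show ?case using assms(3) by auto
  next
    case (step i)
    then obtain C where C: "\<And>t. t \<ge> 0 \<Longrightarrow> \<bar>z (Suc i) t\<bar> \<le> C * exp (- t)" by auto
    from C[of 0] have "C \<ge> 0" by simp
    moreover have "(z i has_real_derivative - \<kappa> i * z i t + z (Suc i) t) (at t within {0..})" if "t \<ge> 0" for t
      using assms(1) step that by (auto simp: filter_chain_def)
    moreover have "\<kappa> i > 1" using assms(2) step by auto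
    ultimately have "\<bar>z i t\<bar> \<le> (\<bar>z i 0\<bar> + C / (\<kappa> i - 1)) * exp (- t)" if "t \<ge> 0" for t
      using stable_bound[of "z i"] C that by blast
    then show ?case by blast
  qed
qed

lemma filter_exists:
  assumes "continuous_on {0..} w"
  obtains z where "z 0 = z0"
    and "\<And>t. t \<ge> 0 \<Longrightarrow> (z has_real_derivative - \<kappa> * z t + w t) (at t within {0..})"
proof -
  let ?I = "\<lambda>t. integral {0..t} (\<lambda>\<tau>. exp (\<kappa> * \<tau>) * w \<tau>)"
  let ?z = "\<lambda>t. exp (- \<kappa> * t) * (z0 + ?I t)"
  have "(?z has_real_derivative - \<kappa> * ?z t + w t) (at t within {0..})" if t: "t \<ge> 0" for t
  proof -
  have "(?I has_real_derivative exp (\<kappa> * t) * w t) (at t within {0..})"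
    using assms t by (intro integral_has_derivative_halfline continuous_intros) auto
  then have *: "((\<lambda>t. z0 + ?I t) has_real_derivative exp (\<kappa> * t) * w t) (at t within {0..})"
    by (auto intro!: derivative_eq_intros)
  have "((\<lambda>t. exp (- \<kappa> * t)) has_real_derivative exp (- \<kappa> * t) * - \<kappa>) (at t within {0..})"
    by (auto intro!: derivative_eq_intros)
  from DERIV_mult[OF this *] have "(?z has_real_derivative
      exp (- \<kappa> * t) * - \<kappa> * (z0 + ?I t) + exp (\<kappa> * t) * w t * exp (- \<kappa> * t)) (at t within {0..})" .
  moreover have "exp (\<kappa> * t) * w t * exp (- \<kappa> * t) = w t"
    by (simp add: exp_minus)
  moreover have "exp (- \<kappa> * t) * - \<kappa> * (z0 + ?I t) = - \<kappa> * ?z t" by (simp only: mult_ac)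
  ultimately show ?thesis by (simp only:)
  qed
  then show thesis by (intro that[of ?z]) auto
qed

text \<open>Solved from the input end: each filter just solved is differentiable, hence continuous,
  and can drive the one below it.\<close>

lemma filter_chain_exists:
  assumes "continuous_on {0..} w"
  obtains z where "filter_chain N \<kappa> z" "\<And>i. i \<in> {1..N} \<Longrightarrow> z i 0 = z0 i" "z (Suc N) = w"
proof -
  have "\<exists>z. (\<forall>i\<in>{j..N}. z i 0 = z0 i \<and> (\<forall>t\<ge>0.
     (z i has_real_derivative - \<kappa> i * z i t + z (Suc i) t) (at t within {0..}))) \<and> z (Suc N) = w"
    if "j \<le> Suc N" for j
    using that
  proof (induction j rule: inc_induct)
    case base
    show ?case by (intro exI[of _ "\<lambda>_. w"]) auto
  next
    case (step j)
    then obtain z where z: "\<And>i. i \<in> {Suc j..N} \<Longrightarrow> z i 0 = z0 i"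
      "\<And>i t. i \<in> {Suc j..N} \<Longrightarrow> t \<ge> 0 \<Longrightarrow>
         (z i has_real_derivative - \<kappa> i * z i t + z (Suc i) t) (at t within {0..})"
      "z (Suc N) = w" by blast
    have "continuous_on {0..} (z (Suc j))"
    proof (cases "j = N")
      case False
      then show ?thesis using step(2) z(2)[of "Suc j"]
        by (intro has_derivative_halfline_imp_continuous) auto
    qed (use z(3) assms in simp)
    then obtain y where y: "y 0 = z0 j"
      "\<And>t. t \<ge> 0 \<Longrightarrow> (y has_real_derivative - \<kappa> j * y t + z (Suc j) t) (at t within {0..})"
      using filter_exists by blast
    show ?case
    proof (intro exI[of _ "z(j := y)"] conjI ballI allI impI)
      fix i assume i: "i \<in> {j..N}"
      show "(z(j := y)) i 0 = z0 i" using y(1) z(1)[of i] i by auto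
      fix t :: real assume t: "t \<ge> 0"
      show "((z(j := y)) i has_real_derivative - \<kappa> i * (z(j := y)) i t + (z(j := y)) (Suc i) t)
          (at t within {0..})"
        using y(2)[OF t] z(2)[OF _ t, of i] i by (cases "i = j") auto
    qed (use z(3) step(2) in auto)
  qed
  from this[of 1] obtain z where "\<forall>i\<in>{1..N}. z i 0 = z0 i \<and> (\<forall>t\<ge>0.
     (z i has_real_derivative - \<kappa> i * z i t + z (Suc i) t) (at t within {0..}))" "z (Suc N) = w"
    by auto
  then show thesis unfolding filter_chain_def by (intro that[of z, unfolded filter_chain_def]) blast+
qed

section \<open>The closed loop\<close>

locale predictor_feedback =
  fixes n m :: nat and b D :: real
    and \<psi> \<phi> :: "nat \<Rightarrow> (nat \<Rightarrow> real) \<Rightarrow> real"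
    and s :: "real \<Rightarrow> real" and k c :: "nat \<Rightarrow> real"
  assumes n_ge: "n \<ge> 1" and m_ge: "m \<ge> 1" and b_nz: "b \<noteq> 0" and D_pos: "D > 0"
    and \<psi>: "\<forall>i\<in>{1..n}. Cr_fun i (n + m - i) (\<psi> i) \<and> \<psi> i (\<lambda>_. 0) = 0"
    and \<phi>: "\<forall>j\<in>{1..m}. Cr_fun j (m - j) (\<phi> j) \<and> \<phi> j (\<lambda>_. 0) = 0"
    and s: "Cr_on {0..} (n + m) s"
begin

lemma \<psi>_CR: "i \<in> {1..n} \<Longrightarrow> CR {1..i} (n + m - i) (\<psi> i)"
  using \<psi> Cr_fun_imp_CR by blast

lemma \<phi>_CR: "j \<in> {1..m} \<Longrightarrow> CR {1..j} (m - j) (\<phi> j)"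
  using \<phi> Cr_fun_imp_CR by blast

sublocale Y: cascade "n + m" n 1 \<psi> k
  using \<psi> \<psi>_CR by unfold_locales auto

sublocale X: cascade m m b \<phi> c
  using \<phi> \<phi>_CR b_nz by unfold_locales auto

abbreviation "h \<equiv> h_fun \<psi> k"
abbreviation "\<Delta> \<equiv> Delta_fun n b \<psi> \<phi> k"

lemma h_CR2: "j \<le> n \<Longrightarrow> CR2 {1..j} {..<j} (n + m - j) (h j)"
  using Y.tau_CR2 by (simp add: h_fun_eq_tau_fun)

lemma plant_f_CR3:
  assumes "l \<in> {1..n}" "r \<le> m" "1 \<in> J"
  shows "CR3 {1..n} J K r (\<lambda>p x \<sigma>. plant_f n \<psi> p (b * x 1) l)"
proof -
  have *: "CR3 {1..n} J K r (\<lambda>p x \<sigma>. \<psi> l p)"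
    using assms by (intro CR3_fst CR_mono[OF CR_lower[OF \<psi>_CR]]) auto
  show ?thesis
  proof (cases "l = n")
    case True
    then have "CR3 {1..n} J K r (\<lambda>p x \<sigma>. \<psi> l p + b * x 1)"
      using * assms by (intro CR3_arith CR3_coord)
    with True show ?thesis by (simp add: plant_f_def)
  next
    case False
    then have "CR3 {1..n} J K r (\<lambda>p x \<sigma>. p (l + 1) + \<psi> l p)"
      using * assms by (intro CR3_arith CR3_coord) auto
    with False show ?thesis by (simp add: plant_f_def)
  qed
qed

text \<open>\<open>h n\<close> has \<open>m\<close> orders left, and so does the roughest component
  of \<open>plant_f\<close>, that with \<open>\<psi> n\<close>. Each total derivative spends one
  order and brings in one more state and one more jet entry; the \<open>\<phi> l\<close> with
  \<open>l \<le> j\<close> are smooth enough for this.\<close>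

lemma Delta_CR3: "j \<le> m \<Longrightarrow> CR3 {1..n} {1..j} {..n + j} (m - j) (\<Delta> j)"
proof (induction j)
  case 0
  have "CR2 {1..n} {..n} m (h n)" by (rule CR2_mono[OF CR2_lower[OF h_CR2]]) auto
  then show ?case by (auto intro!: CR2_arith CR2_coord CR3_fst_thd)
next
  case (Suc j)
  then have IH: "CR3 {1..n} {1..j} {..n + j} (Suc (m - Suc j)) (\<Delta> j)"
    by (simp add: Suc_diff_Suc)
  note mono = CR3_mono[of "{1..n}" "{1..j}" "{..n + j}" _ _ "{1..n}" "{1..Suc j}" "{..n + Suc j}"]
  have \<phi>': "CR3 {1..n} {1..Suc j} {..n + Suc j} (m - Suc j) (\<lambda>p x \<sigma>. \<phi> l x)" if "l \<in> {1..j}" for l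
    using that Suc.prems by (intro CR3_snd CR_mono[OF CR_lower[OF \<phi>_CR]]) auto
  show ?case unfolding Delta_fun.simps
    by (intro CR3_arith CR3_coord plant_f_CR3 \<phi>' mono CR3_partial[OF IH]) auto
qed

lemma Delta_has_derivative:
  assumes "j < m"
    and "\<And>l. l \<in> {1..n} \<Longrightarrow> ((\<lambda>t. p t l) has_real_derivative plant_f n \<psi> (p t) (b * x t 1) l) (at t within S)"
    and "\<And>l. l \<in> {1..j} \<Longrightarrow> ((\<lambda>t. x t l) has_real_derivative x t (l + 1) + \<phi> l (x t)) (at t within S)"
    and "\<And>l. l \<le> n + j \<Longrightarrow> ((\<lambda>t. \<sigma> t l) has_real_derivative \<sigma> t (l + 1)) (at t within S)"
  shows "((\<lambda>t. \<Delta> j (p t) (x t) (\<sigma> t)) has_real_derivative \<Delta> (Suc j) (p t) (x t) (\<sigma> t)) (at t within S)"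
proof -
  have "CR3 {1..n} {1..j} {..n + j} (Suc 0) (\<Delta> j)"
    using assms(1) by (intro CR3_lower[OF Delta_CR3]) auto
  from CR3_chain_rule[OF this finite_atLeastAtMost finite_atLeastAtMost finite_atMost,
      of p "plant_f n \<psi> (p t) (b * x t 1)" t S x "\<lambda>l. x t (l + 1) + \<phi> l (x t)" \<sigma> "\<lambda>l. \<sigma> t (l + 1)"]
  show ?thesis using assms(2-4) by (simp add: atLeast0AtMost)
qed

lemma Delta_zero: "j \<le> m \<Longrightarrow> \<Delta> j (\<lambda>_. 0) (\<lambda>_. 0) (\<lambda>_. 0) = 0"
proof (cases j)
  case 0
  then show ?thesis using Y.tau_zero[of n] by (simp add: h_fun_eq_tau_fun)
next
  case (Suc i)
  assume "j \<le> m"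
  with \<psi> \<phi> Suc show ?thesis
    by (auto simp: plant_f_def intro!: sum.neutral)
qed

lemma jet_has_derivative:
  assumes "i < n + m" "t \<ge> 0"
  shows "((\<lambda>t. jet s (t + D) i) has_real_derivative jet s (t + D) (Suc i)) (at t within {0..})"
proof -
  have "(iter_deriv {0..} i s has_real_derivative jet s (t + D) (Suc i)) (at (t + D) within {0..})"
    using s assms D_pos
    by (auto simp: Cr_on_def jet_def has_real_derivative_iff_has_vector_derivative
        simp flip: vector_derivative_works)
  then have "((\<lambda>t. jet s (t + D) i) has_real_derivative jet s (t + D) (Suc i) * 1) (at t within {0..})"
    unfolding jet_def
    by (intro DERIV_image_chain[unfolded o_def, OF has_field_derivative_subset])
      (use D_pos in \<open>auto intro!: derivative_eq_intros\<close>)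
  then show ?thesis by simp
qed

end

section \<open>Exactness of the predictor\<close>

lemma continuous_on_halfline:
  fixes f :: "real \<Rightarrow> real"
  assumes "\<And>T. T \<ge> a \<Longrightarrow> continuous_on {a..T} f"
  shows "continuous_on {a..} f"
  unfolding continuous_on_eq_continuous_within
proof
  fix t assume t: "t \<in> {a..}"
  then have "continuous (at t within {a..t + 1}) f"
    using assms[of "t + 1"] by (auto simp: continuous_on_eq_continuous_within)
  moreover have "at t within {a..t + 1} = at t within {a..}"
    using t by (intro at_within_nhd[of t "{t - 1<..<t + 1}"]) auto
  ultimately show "continuous (at t within {a..}) f" by (simp add: continuous_within)
qed

context predictor_feedback
begin

text \<open>Trajectories are prescribed only on coordinates 1 to \<open>n\<close>, the other values
  being arbitrary; equality on these coordinates has to suffice throughout.\<close>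

lemma plant_f_cong:
  assumes "i \<in> {1..n}" "\<And>l. l \<in> {1..n} \<Longrightarrow> p l = q l"
  shows "plant_f n \<psi> p v i = plant_f n \<psi> q v i"
proof -
  have "\<psi> i p = \<psi> i q"
    using assms by (intro depends_onD[OF CR_depends_on[OF \<psi>_CR]]) auto
  then show ?thesis using assms by (auto simp: plant_f_def)
qed

lemma continuous_on_plant_f:
  assumes "i \<in> {1..n}" "\<And>l. l \<in> {1..n} \<Longrightarrow> continuous_on S (\<lambda>t. p t l)" "continuous_on S v"
  shows "continuous_on S (\<lambda>t. plant_f n \<psi> (p t) (v t) i)"
proof -
  have "continuous_on S (\<lambda>t. \<psi> i (p t))"
    using assms by (intro continuous_on_depends_on[OF CR_continuous[OF \<psi>_CR] CR_depends_on[OF \<psi>_CR]]) auto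
  then show ?thesis using assms unfolding plant_f_def
    by (cases "i = n") (auto intro!: continuous_intros)
qed

lemma plant_f_lipschitz_on_box:
  assumes "M \<ge> 0"
  obtains L where "L \<ge> 0"
    "\<And>p q v i. i \<in> {1..n} \<Longrightarrow> (\<And>l. l \<in> {1..n} \<Longrightarrow> \<bar>p l\<bar> \<le> M) \<Longrightarrow> (\<And>l. l \<in> {1..n} \<Longrightarrow> \<bar>q l\<bar> \<le> M) \<Longrightarrow>
       \<bar>plant_f n \<psi> p v i - plant_f n \<psi> q v i\<bar> \<le> L * (\<Sum>l\<in>{1..n}. \<bar>p l - q l\<bar>)"
proof -
  have "\<exists>L\<ge>0. \<forall>p q. (\<forall>l\<in>{1..n}. \<bar>p l\<bar> \<le> M) \<longrightarrow> (\<forall>l\<in>{1..n}. \<bar>q l\<bar> \<le> M) \<longrightarrow>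
      \<bar>\<psi> i p - \<psi> i q\<bar> \<le> L * (\<Sum>l\<in>{1..n}. \<bar>p l - q l\<bar>)" if "i \<in> {1..n}" for i
  proof -
    have "CR {1..n} (Suc 0) (\<psi> i)"
      using that m_ge by (intro CR_mono[OF CR_lower[OF \<psi>_CR]]) auto
    from CR_lipschitz_on_box[OF this _ assms] show ?thesis by (metis finite_atLeastAtMost)
  qed
  then obtain L where L: "\<And>i. i \<in> {1..n} \<Longrightarrow> L i \<ge> 0"
    "\<And>i p q. i \<in> {1..n} \<Longrightarrow> (\<forall>l\<in>{1..n}. \<bar>p l\<bar> \<le> M) \<Longrightarrow> (\<forall>l\<in>{1..n}. \<bar>q l\<bar> \<le> M) \<Longrightarrow>
      \<bar>\<psi> i p - \<psi> i q\<bar> \<le> L i * (\<Sum>l\<in>{1..n}. \<bar>p l - q l\<bar>)" by metis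
  \<comment> \<open>The summand 1 pays for the shifted coordinate \<open>p (i + 1)\<close>, the sum
    for \<open>\<psi> i\<close>. The input \<open>v\<close> cancels in the difference, so the
    constant is uniform in it.\<close>
  define K where "K = 1 + (\<Sum>i\<in>{1..n}. L i)"
  show thesis
  proof (rule that)
    show "K \<ge> 0" unfolding K_def using L(1) by (intro add_nonneg_nonneg sum_nonneg) auto
    fix p q v i assume i: "i \<in> {1..n}" and
      box: "\<And>l. l \<in> {1..n} \<Longrightarrow> \<bar>p l\<bar> \<le> M" "\<And>l. l \<in> {1..n} \<Longrightarrow> \<bar>q l\<bar> \<le> M"
    let ?d = "\<Sum>l\<in>{1..n}. \<bar>p l - q l\<bar>"
    have d: "?d \<ge> 0" by (intro sum_nonneg) auto
    have "L i \<le> (\<Sum>i\<in>{1..n}. L i)" using i L(1) by (intro member_le_sum) auto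
    then have \<psi>d: "\<bar>\<psi> i p - \<psi> i q\<bar> \<le> (\<Sum>i\<in>{1..n}. L i) * ?d"
      using L(2)[OF i, of p q] box mult_right_mono[OF _ d] by (meson order_trans)
    have K: "K * ?d = ?d + (\<Sum>i\<in>{1..n}. L i) * ?d" by (simp add: K_def algebra_simps)
    show "\<bar>plant_f n \<psi> p v i - plant_f n \<psi> q v i\<bar> \<le> K * ?d"
    proof (cases "i = n")
      case True
      then have "plant_f n \<psi> p v i - plant_f n \<psi> q v i = \<psi> i p - \<psi> i q" by (simp add: plant_f_def)
      then show ?thesis using \<psi>d d K by linarith
    next
      case False
      have "\<bar>p (i + 1) - q (i + 1)\<bar> \<le> ?d"
        using i False by (intro member_le_sum) auto
      moreover have "plant_f n \<psi> p v i - plant_f n \<psi> q v i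
          = (p (i + 1) - q (i + 1)) + (\<psi> i p - \<psi> i q)"
        using False by (simp add: plant_f_def)
      ultimately show ?thesis using \<psi>d K by linarith
    qed
  qed
qed

text \<open>A Gronwall argument. On a compact interval both continuous trajectories lie in one box,
  where the plant is Lipschitz uniformly in the input; the squared distance \<open>V\<close> then
  grows at most like \<open>exp (K * t)\<close> times its initial value, which is 0.\<close>

lemma plant_ode_unique:
  assumes p: "\<And>t i. 0 \<le> t \<Longrightarrow> t \<le> T \<Longrightarrow> i \<in> {1..n} \<Longrightarrow>
      ((\<lambda>t. p t i) has_real_derivative plant_f n \<psi> (p t) (v t) i) (at t within {0..T})"
    and q: "\<And>t i. 0 \<le> t \<Longrightarrow> t \<le> T \<Longrightarrow> i \<in> {1..n} \<Longrightarrow>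
      ((\<lambda>t. q t i) has_real_derivative plant_f n \<psi> (q t) (v t) i) (at t within {0..T})"
    and init: "\<And>i. i \<in> {1..n} \<Longrightarrow> p 0 i = q 0 i"
    and t: "0 \<le> t" "t \<le> T" and i: "i \<in> {1..n}"
  shows "p t i = q t i"
proof -
  have bd: "\<exists>M. \<forall>t\<in>{0..T}. \<forall>i\<in>{1..n}. \<bar>f t i\<bar> \<le> M"
    if d: "\<And>t i. 0 \<le> t \<Longrightarrow> t \<le> T \<Longrightarrow> i \<in> {1..n} \<Longrightarrow>
      ((\<lambda>t. f t i) has_real_derivative f' t i) (at t within {0..T})" for f f' :: "real \<Rightarrow> nat \<Rightarrow> real"
  proof -
    have "\<exists>M. \<forall>t\<in>{0..T}. \<bar>f t i\<bar> \<le> M" if i: "i \<in> {1..n}" for i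
    proof -
      have "compact ((\<lambda>t. f t i) ` {0..T})"
        using d i by (intro compact_continuous_image DERIV_continuous_on) auto
      then show ?thesis using compact_imp_bounded by (fastforce simp: bounded_iff)
    qed
    then obtain M where M: "\<And>i t. i \<in> {1..n} \<Longrightarrow> t \<in> {0..T} \<Longrightarrow> \<bar>f t i\<bar> \<le> M i" by metis
    have "\<bar>f t i\<bar> \<le> (\<Sum>i\<in>{1..n}. \<bar>M i\<bar>)" if "t \<in> {0..T}" "i \<in> {1..n}" for t i
    proof -
      have "\<bar>f t i\<bar> \<le> \<bar>M i\<bar>" using M[OF that(2,1)] by simp
      also have "\<dots> \<le> (\<Sum>i\<in>{1..n}. \<bar>M i\<bar>)" using that by (intro member_le_sum) auto
      finally show ?thesis .
    qed
    then show ?thesis by blast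
  qed
  from bd[of p, OF p] obtain M1 where M1: "\<forall>t\<in>{0..T}. \<forall>i\<in>{1..n}. \<bar>p t i\<bar> \<le> M1" by auto
  from bd[of q, OF q] obtain M2 where M2: "\<forall>t\<in>{0..T}. \<forall>i\<in>{1..n}. \<bar>q t i\<bar> \<le> M2" by auto
  have M12: "\<bar>p t i\<bar> \<le> M1" "\<bar>q t i\<bar> \<le> M2" if "t \<in> {0..T}" "i \<in> {1..n}" for t i
    using M1 M2 that by auto
  define M where "M = max 0 (max M1 M2)"
  have "M \<ge> 0" by (simp add: M_def)
  then obtain L where L: "L \<ge> 0"
    "\<And>p q v i. i \<in> {1..n} \<Longrightarrow> (\<And>l. l \<in> {1..n} \<Longrightarrow> \<bar>p l\<bar> \<le> M) \<Longrightarrow> (\<And>l. l \<in> {1..n} \<Longrightarrow> \<bar>q l\<bar> \<le> M) \<Longrightarrow>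
       \<bar>plant_f n \<psi> p v i - plant_f n \<psi> q v i\<bar> \<le> L * (\<Sum>l\<in>{1..n}. \<bar>p l - q l\<bar>)"
    by (rule plant_f_lipschitz_on_box) blast
  define e where "e = (\<lambda>t i. p t i - q t i)"
  define F where "F = (\<lambda>t i. plant_f n \<psi> (p t) (v t) i - plant_f n \<psi> (q t) (v t) i)"
  define V where "V = (\<lambda>t. \<Sum>i\<in>{1..n}. (e t i)\<^sup>2)"
  \<comment> \<open>\<open>L\<close> comes from the Lipschitz bound in the sum norm, 2 from
    differentiating squares, and \<open>n\<close> from Cauchy-Schwarz, which compares the squared
    sum norm with \<open>V\<close>.\<close>
  define K where "K = 2 * (L * n)"
  have V': "(V has_real_derivative (\<Sum>i\<in>{1..n}. 2 * e t i * F t i)) (at t within {0..T})"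
    if "0 \<le> t" "t \<le> T" for t
  proof -
    have "((\<lambda>t. (e t i)\<^sup>2) has_real_derivative 2 * e t i * F t i) (at t within {0..T})"
      if "i \<in> {1..n}" for i
    proof -
      have "((\<lambda>t. e t i) has_real_derivative F t i) (at t within {0..T})"
        unfolding e_def F_def using \<open>0 \<le> t\<close> \<open>t \<le> T\<close> that by (intro DERIV_diff p q) auto
      from DERIV_power[OF this, of 2] show ?thesis by (simp add: mult_ac)
    qed
    then show ?thesis unfolding V_def by (rule DERIV_sum)
  qed
  have V'_le: "(\<Sum>i\<in>{1..n}. 2 * e t i * F t i) \<le> K * V t" if "0 \<le> t" "t \<le> T" for t
  proof -
    let ?A = "\<Sum>i\<in>{1..n}. \<bar>e t i\<bar>"
    have "(\<Sum>i\<in>{1..n}. 2 * e t i * F t i) \<le> (\<Sum>i\<in>{1..n}. 2 * \<bar>e t i\<bar> * (L * ?A))"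
    proof (rule sum_mono)
      fix i assume i: "i \<in> {1..n}"
      have box: "\<bar>p t l\<bar> \<le> M" "\<bar>q t l\<bar> \<le> M" if "l \<in> {1..n}" for l
        using M12[of t l] that \<open>0 \<le> t\<close> \<open>t \<le> T\<close> by (auto simp: M_def)
      have "\<bar>F t i\<bar> \<le> L * ?A"
        unfolding F_def e_def by (rule L(2)[OF i box])
      then have "\<bar>e t i\<bar> * \<bar>F t i\<bar> \<le> \<bar>e t i\<bar> * (L * ?A)" by (intro mult_left_mono) auto
      moreover have "e t i * F t i \<le> \<bar>e t i\<bar> * \<bar>F t i\<bar>" by (metis abs_ge_self abs_mult)
      ultimately show "2 * e t i * F t i \<le> 2 * \<bar>e t i\<bar> * (L * ?A)" by linarith
    qed
    also have "\<dots> = 2 * L * ?A\<^sup>2"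
      by (simp add: power2_eq_square mult_ac flip: sum_distrib_left sum_distrib_right)
    also have "\<dots> \<le> 2 * L * (V t * n)"
    proof -
      have "?A\<^sup>2 \<le> V t * n"
        using sum_squared_le_sum_of_squares[of "\<lambda>i. \<bar>e t i\<bar>" "{1..n}"] by (simp add: V_def)
      then show ?thesis using L(1) by (intro mult_left_mono) auto
    qed
    finally show ?thesis by (simp add: K_def mult_ac)
  qed
  have "- (exp (- K * 0) * V 0) \<le> - (exp (- K * t) * V t)"
  proof (rule derivative_nonneg_imp_le[OF _ _ t(1)])
    fix \<tau> assume \<tau>: "0 \<le> \<tau>" "\<tau> \<le> t"
    let ?V' = "\<Sum>i\<in>{1..n}. 2 * e \<tau> i * F \<tau> i"
    have "(V has_real_derivative - (- K) * V \<tau> + (?V' - K * V \<tau>)) (at \<tau> within {0..t})"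
      using has_field_derivative_subset[OF V'[of \<tau>], of "{0..t}"] \<tau> t by simp
    from DERIV_minus[OF exp_weighted_derivative[OF this]]
    show "((\<lambda>t. - (exp (- K * t) * V t)) has_real_derivative
        - (exp (- K * \<tau>) * (?V' - K * V \<tau>))) (at \<tau> within {0..t})" .
    show "- (exp (- K * \<tau>) * (?V' - K * V \<tau>)) \<ge> 0"
      using V'_le[of \<tau>] \<tau> t by (simp add: mult_le_0_iff)
  qed
  moreover have "V 0 = 0" using init by (simp add: V_def e_def)
  ultimately have "V t \<le> 0" by (simp add: mult_le_0_iff)
  then have "V t = 0" using sum_nonneg[of "{1..n}" "\<lambda>i. (e t i)\<^sup>2"] by (simp add: V_def)
  then show ?thesis using i by (simp add: V_def e_def sum_nonneg_eq_0_iff)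
qed

text \<open>The integral equation ties \<open>P\<close> to \<open>Y\<close>, but differentiating it
  yields an equation for \<open>P\<close> alone only once \<open>Y t = P (t - D)\<close> is known.
  The claim is therefore recast as \<open>P = Y0 + G\<close>, with \<open>G\<close> the integral of
  the velocity from \<open>-D\<close>, and propagated in steps of length \<open>D\<close>.\<close>

lemma predictor_exact:
  assumes init: "predictor_init n b D \<psi> Y0 \<xi> P0"
    and \<xi>: "continuous_on {-D..0} \<xi>" "\<xi> 0 = X0 1"
    and cl: "closed_loop n m b D \<psi> \<phi> s k c Y0 X0 \<xi> P0 Y X P"
  shows "continuous_on {-D..} (\<lambda>t. X t 1)"
    and "\<And>t i. t \<ge> -D \<Longrightarrow> i \<in> {1..n} \<Longrightarrow>
      ((\<lambda>t. P t i) has_real_derivative plant_f n \<psi> (P t) (b * X t 1) i) (at t within {-D..})"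
    and "\<And>t i. t \<ge> 0 \<Longrightarrow> i \<in> {1..n} \<Longrightarrow> Y t i = P (t - D) i"
proof -
  note cl = cl[unfolded closed_loop_def]
  define g where "g = (\<lambda>i \<sigma>. plant_f n \<psi> (P \<sigma>) (b * X \<sigma> 1) i)"
  define G where "G = (\<lambda>i t. integral {-D..t} (g i))"
  have X1: "X \<theta> 1 = \<xi> \<theta>" if "\<theta> \<in> {-D..0}" for \<theta> using cl that by auto
  have "continuous_on ({-D..0} \<union> {0..}) (\<lambda>t. X t 1)"
  proof (rule continuous_on_closed_Un)
    show "continuous_on {-D..0} (\<lambda>t. X t 1)" using \<xi>(1) by (subst continuous_on_cong[OF refl X1])
    have "\<exists>d. ((\<lambda>t. X t 1) has_real_derivative d) (at t within {0..})" if "t \<ge> 0" for t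
      using cl m_ge that by (metis atLeastAtMost_iff order_refl)
    then show "continuous_on {0..} (\<lambda>t. X t 1)"
      by (auto simp: continuous_on_eq_continuous_within intro: DERIV_continuous)
  qed auto
  moreover have un: "{-D..0} \<union> {0..} = {-D..}" using D_pos by auto
  ultimately show X1_cont: "continuous_on {-D..} (\<lambda>t. X t 1)" by simp
  have step: "(g i has_integral (P t i - Y t i)) {t - D..t}" if "t \<ge> 0" "i \<in> {1..n}" for t i
    using cl that unfolding g_def by auto
  \<comment> \<open>The integral equation gives integrability only on windows
    \<open>{t - D..t}\<close>, which are glued together here.\<close>
  have "g i integrable_on {-D..real N * D}" if "i \<in> {1..n}" for i N
  proof (induction N)
    case 0
    then show ?case using step[of 0 i] that by auto
  next
    case (Suc N)
    have "g i integrable_on {real N * D..real (Suc N) * D}"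
      using step[of "real (Suc N) * D" i] that D_pos by (auto simp: algebra_simps)
    then show ?case using Suc D_pos
      by (intro Henstock_Kurzweil_Integration.integrable_combine[of "-D" "real N * D" "real (Suc N) * D"])
        (auto simp: algebra_simps order_trans[of "-D" 0])
  qed
  moreover have "\<exists>N. T \<le> real N * D" for T
    using reals_Archimedean3[OF D_pos] less_imp_le by blast
  ultimately have g_int: "g i integrable_on {-D..T}" if "i \<in> {1..n}" for i T
    using that integrable_on_subinterval by (metis atLeastatMost_subset_iff order_refl)
  have G_cont: "continuous_on {-D..} (G i)" if "i \<in> {1..n}" for i
    unfolding G_def by (intro continuous_on_halfline indefinite_integral_continuous_1 g_int that)
  have P_hist: "P t i = Y0 i + G i t" if "t \<in> {-D..0}" "i \<in> {1..n}" for t i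
  proof -
    have "((\<lambda>\<sigma>. plant_f n \<psi> (P0 \<sigma>) (b * \<xi> \<sigma>) i) has_integral (P0 t i - Y0 i)) {-D..t}"
      using init that unfolding predictor_init_def by auto
    moreover have "plant_f n \<psi> (P0 \<sigma>) (b * \<xi> \<sigma>) i = g i \<sigma>" if "\<sigma> \<in> {-D..t}" for \<sigma>
    proof -
      have \<sigma>: "\<sigma> \<in> {-D..0}" using that \<open>t \<in> _\<close> by auto
      then have "P \<sigma> l = P0 \<sigma> l" if "l \<in> {1..n}" for l using cl that by auto
      then show ?thesis unfolding g_def X1[OF \<sigma>] using \<open>i \<in> _\<close> by (intro plant_f_cong) auto
    qed
    ultimately have "(g i has_integral (P0 t i - Y0 i)) {-D..t}"
      by (rule has_integral_eq[rotated])
    moreover have "P t i = P0 t i" using cl that by auto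
    ultimately show ?thesis unfolding G_def by (simp add: integral_unique)
  qed
  \<comment> \<open>Once \<open>Y t i\<close> is known to be \<open>Y0 i + G i (t - D)\<close>, this
    identity turns into \<open>P t i = Y0 i + G i t\<close>.\<close>
  have P_step: "P t i - G i t = Y t i - G i (t - D)" if "t \<ge> 0" "i \<in> {1..n}" for t i
  proof -
    have "G i (t - D) + integral {t - D..t} (g i) = G i t"
      unfolding G_def using that D_pos
      by (intro Henstock_Kurzweil_Integration.integral_combine g_int) auto
    then show ?thesis using integral_unique[OF step[OF that]] by simp
  qed
  have Y_deriv: "((\<lambda>t. Y t i) has_real_derivative plant_f n \<psi> (Y t) (b * X (t - D) 1) i) (at t within {0..})"
    if "t \<ge> 0" "i \<in> {1..n}" for t i using cl that by auto
  \<comment> \<open>Solving \<open>P_step\<close> for \<open>P\<close> gives continuity after time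
    zero before any differential equation for \<open>P\<close> is available.\<close>
  have P_cont: "continuous_on {-D..} (\<lambda>t. P t i)" if i: "i \<in> {1..n}" for i
  proof -
    have "continuous_on ({-D..0} \<union> {0..}) (\<lambda>t. P t i)"
    proof (rule continuous_on_closed_Un)
      have "continuous_on {-D..0} (\<lambda>t. Y0 i + G i t)"
        by (intro continuous_intros continuous_on_subset[OF G_cont[OF i]]) auto
      then show "continuous_on {-D..0} (\<lambda>t. P t i)"
        by (subst continuous_on_cong[OF refl P_hist]) (use i in auto)
      have "continuous_on {0..} (\<lambda>t. Y t i)"
        using Y_deriv i by (intro has_derivative_halfline_imp_continuous)
      moreover have "continuous_on {0..} (G i)"
        using D_pos by (intro continuous_on_subset[OF G_cont[OF i]]) auto
      moreover have "continuous_on {0..} (\<lambda>t. G i (t - D))"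
        by (rule continuous_on_compose2[OF G_cont[OF i]]) (auto intro!: continuous_intros)
      ultimately have "continuous_on {0..} (\<lambda>t. Y t i - G i (t - D) + G i t)"
        by (intro continuous_intros)
      moreover have "Y t i - G i (t - D) + G i t = P t i" if "t \<in> {0..}" for t
        using P_step[of t i] that i by auto
      ultimately show "continuous_on {0..} (\<lambda>t. P t i)" by (rule continuous_on_eq)
    qed auto
    then show ?thesis using un by simp
  qed
  have g_cont: "continuous_on {-D..} (g i)" if "i \<in> {1..n}" for i
    unfolding g_def using that P_cont X1_cont by (intro continuous_on_plant_f continuous_intros) auto
  have G_deriv: "(G i has_real_derivative g i t) (at t within {-D..})" if "t \<ge> -D" "i \<in> {1..n}" for t i
    unfolding G_def by (rule integral_has_derivative_halfline[OF g_cont that(1)]) (rule that)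
  \<comment> \<open>\<open>Q\<close> is the candidate for \<open>Y\<close>. Its derivative exists
    without knowing that it equals the delayed predictor.\<close>
  define Q where "Q = (\<lambda>t i. Y0 i + G i (t - D))"
  have Q_deriv: "((\<lambda>t. Q t i) has_real_derivative g i (t - D)) (at t within {0..})"
    if "t \<ge> 0" "i \<in> {1..n}" for t i
  proof -
    have "(G i \<circ> (\<lambda>t. t - D) has_real_derivative g i (t - D) * 1) (at t within {0..})"
      using that D_pos
      by (intro DERIV_image_chain[OF has_field_derivative_subset[OF G_deriv]])
        (auto intro!: derivative_eq_intros)
    then show ?thesis unfolding Q_def by (auto simp: o_def intro!: derivative_eq_intros)
  qed
  \<comment> \<open>If the identity holds up to \<open>real N * D\<close>, then \<open>Q t\<close>
    is \<open>P (t - D)\<close> for \<open>t\<close> up to \<open>real (Suc N) * D\<close>. There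
    \<open>Q\<close> solves the plant equation with the initial state of \<open>Y\<close>, so
    uniqueness gives \<open>Y = Q\<close>, and \<open>P_step\<close> extends the identity by one
    interval.\<close>
  have exact: "\<forall>t\<in>{-D..real N * D}. \<forall>i\<in>{1..n}. P t i = Y0 i + G i t" for N
  proof (induction N)
    case 0
    then show ?case using P_hist by auto
  next
    case (Suc N)
    define T where "T = real (Suc N) * D"
    have PQ: "P (t - D) i = Q t i" if "0 \<le> t" "t \<le> T" "i \<in> {1..n}" for t i
    proof -
      have "t - D \<in> {-D..real N * D}" using that by (auto simp: T_def algebra_simps)
      then show ?thesis using Suc that(3) by (auto simp: Q_def)
    qed
    have YQ: "Y t i = Q t i" if "0 \<le> t" "t \<le> T" "i \<in> {1..n}" for t i
    proof (rule plant_ode_unique[OF _ _ _ that])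
      fix \<tau> j assume \<tau>: "0 \<le> \<tau>" "\<tau> \<le> T" and j: "j \<in> {1..n}"
      show "((\<lambda>t. Y t j) has_real_derivative plant_f n \<psi> (Y \<tau>) (b * X (\<tau> - D) 1) j) (at \<tau> within {0..T})"
        by (rule has_field_derivative_subset[OF Y_deriv]) (use \<tau> j in auto)
      have "g j (\<tau> - D) = plant_f n \<psi> (Q \<tau>) (b * X (\<tau> - D) 1) j"
        unfolding g_def using PQ \<tau> j by (intro plant_f_cong) auto
      then show "((\<lambda>t. Q t j) has_real_derivative plant_f n \<psi> (Q \<tau>) (b * X (\<tau> - D) 1) j) (at \<tau> within {0..T})"
        using has_field_derivative_subset[OF Q_deriv[OF \<tau>(1) j], of "{0..T}"] by simp
    next
      fix j assume "j \<in> {1..n}"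
      then show "Y 0 j = Q 0 j" using cl by (simp add: Q_def G_def)
    qed
    show ?case
    proof (intro ballI)
      fix t i assume t: "t \<in> {-D..real (Suc N) * D}" and i: "i \<in> {1..n}"
      show "P t i = Y0 i + G i t"
      proof (cases "t \<le> 0")
        case True
        then show ?thesis using P_hist t i by auto
      next
        case False
        then show ?thesis using P_step[of t i] YQ[of t i] t i by (auto simp: T_def Q_def)
      qed
    qed
  qed
  have P_eq: "P t i = Y0 i + G i t" if "t \<ge> -D" "i \<in> {1..n}" for t i
  proof -
    obtain N where "t \<le> real N * D" using reals_Archimedean3[OF D_pos] less_imp_le by metis
    then show ?thesis using exact[of N] that by auto
  qed
  show "((\<lambda>t. P t i) has_real_derivative plant_f n \<psi> (P t) (b * X t 1) i) (at t within {-D..})"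
    if t: "t \<ge> -D" and i: "i \<in> {1..n}" for t i
  proof -
    have "((\<lambda>t. Y0 i + G i t) has_real_derivative g i t) (at t within {-D..})"
      using G_deriv[OF t i] by (auto intro!: derivative_eq_intros)
    then show ?thesis unfolding g_def
      by (rule has_field_derivative_transform_within[of _ _ _ _ 1]) (use t i P_eq in auto)
  qed
  show "Y t i = P (t - D) i" if t: "t \<ge> 0" and i: "i \<in> {1..n}" for t i
    using P_step[OF t i] P_eq[of t i] P_eq[of "t - D" i] t i D_pos by simp
qed

end

section \<open>Error coordinates\<close>

lemma triangular_solve:
  fixes A :: "nat \<Rightarrow> (nat \<Rightarrow> real) \<Rightarrow> real"
  assumes "\<And>j u v. j < N \<Longrightarrow> (\<And>i. i \<in> {1..j} \<Longrightarrow> u i = v i) \<Longrightarrow> A j u = A j v"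
  shows "\<exists>u. \<forall>j<N. u (Suc j) = A j u"
  using assms
proof (induction N)
  case (Suc N)
  have "\<exists>u. \<forall>j<N. u (Suc j) = A j u" by (rule Suc.IH) (rule Suc.prems, auto)
  then obtain u where u: "\<forall>j<N. u (Suc j) = A j u" by blast
  \<comment> \<open>Overwriting the newest coordinate leaves every right-hand side unchanged, as
    \<open>A j\<close> reads coordinates up to \<open>j\<close> only.\<close>
  have "A j (u(Suc N := A N u)) = A j u" if "j < Suc N" for j
    using that by (intro Suc.prems) auto
  with u have "\<forall>j<Suc N. (u(Suc N := A N u)) (Suc j) = A j (u(Suc N := A N u))"
    by (simp only: less_Suc_eq) (metis fun_upd_apply nat.inject)
  then show ?case by blast
qed auto

lemma triangular_unique:
  fixes A :: "nat \<Rightarrow> (nat \<Rightarrow> real) \<Rightarrow> real"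
  assumes "\<And>j u v. j < N \<Longrightarrow> (\<And>i. i \<in> {1..j} \<Longrightarrow> u i = v i) \<Longrightarrow> A j u = A j v"
    and "\<And>j. j < N \<Longrightarrow> u (Suc j) = A j u" "\<And>j. j < N \<Longrightarrow> v (Suc j) = A j v" and "i \<in> {1..N}"
  shows "u i = v i"
proof -
  have "\<forall>i\<in>{1..k}. u i = v i" if "k \<le> N" for k
    using that
  proof (induction k)
    case (Suc k)
    then have "u (Suc k) = v (Suc k)" using assms(2,3)[of k] assms(1)[of k u v] by auto
    with Suc show ?case by (auto simp: le_Suc_eq)
  qed auto
  then show ?thesis using assms(4) by blast
qed

context predictor_feedback
begin

abbreviation "\<delta> \<equiv> Delta_jet n b \<psi> \<phi> k"

text \<open>\<open>p_err\<close> and \<open>x_err\<close> are $z_i$ and $r_j$, each extended by the input of its chain: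
  $z_{n+1} = r_1$ and $r_{m+1} = 0$.\<close>

definition p_err :: "(nat \<Rightarrow> real) \<Rightarrow> (nat \<Rightarrow> real) \<Rightarrow> (nat \<Rightarrow> real) \<Rightarrow> nat \<Rightarrow> real" where
  "p_err p x \<sigma> i = (if i \<le> n then p i - h (i - 1) p \<sigma> - \<sigma> (i - 1) else b * x 1 - \<Delta> 0 p x \<sigma>)"

definition x_err :: "(nat \<Rightarrow> real) \<Rightarrow> (nat \<Rightarrow> real) \<Rightarrow> (nat \<Rightarrow> real) \<Rightarrow> nat \<Rightarrow> real" where
  "x_err p x \<sigma> j = (if j \<le> m then b * x j - X.\<tau> (j - 1) x (\<delta> p x \<sigma>) - \<delta> p x \<sigma> (j - 1) else 0)"

text \<open>Stated at a single time, so that for fixed \<open>t\<close> the stages can be settled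
  one after the other.\<close>

definition P_dyn :: "(real \<Rightarrow> nat \<Rightarrow> real) \<Rightarrow> (real \<Rightarrow> nat \<Rightarrow> real) \<Rightarrow> nat \<Rightarrow> real \<Rightarrow> bool" where
  "P_dyn P X i t \<longleftrightarrow>
     ((\<lambda>t. P t i) has_real_derivative plant_f n \<psi> (P t) (b * X t 1) i) (at t within {0..})"

definition X_dyn :: "(real \<Rightarrow> nat \<Rightarrow> real) \<Rightarrow> (real \<Rightarrow> nat \<Rightarrow> real) \<Rightarrow> nat \<Rightarrow> real \<Rightarrow> bool" where
  "X_dyn P X j t \<longleftrightarrow>
     ((\<lambda>t. X t j) has_real_derivative
        (if j = m
         then \<phi> m (X t) + nominal_control n m b \<psi> \<phi> k c (P t) (X t) (jet s (t + D))
         else X t (j + 1) + \<phi> j (X t)))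
       (at t within {0..})"

lemma P_dyn_iff_error:
  assumes t: "t \<ge> 0" and j: "j < n" and low: "\<And>l. l \<in> {1..j} \<Longrightarrow> P_dyn P X l t"
  shows "P_dyn P X (Suc j) t \<longleftrightarrow>
    ((\<lambda>t. p_err (P t) (X t) (jet s (t + D)) (Suc j)) has_real_derivative
      - k (Suc j) * p_err (P t) (X t) (jet s (t + D)) (Suc j)
      + p_err (P t) (X t) (jet s (t + D)) (Suc (Suc j))) (at t within {0..})"
proof -
  \<comment> \<open>At the last stage \<open>b * x_1\<close> plays the part of the next state, which
    matches the value given to \<open>p_err\<close> at \<open>Suc n\<close>.\<close>
  define v where "v = (if Suc j = n then b * X t 1 else P t (Suc (Suc j)))"
  have "((\<lambda>t. P t l) has_real_derivative P t (l + 1) + \<psi> l (P t)) (at t within {0..})"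
    if "l \<in> {1..j}" for l
    using low[OF that] that j by (auto simp: P_dyn_def plant_f_def)
  moreover have "((\<lambda>t. jet s (t + D) l) has_real_derivative jet s (t + D) (Suc l)) (at t within {0..})"
    if "l \<le> j" for l
    using that j m_ge t by (intro jet_has_derivative) auto
  moreover have "plant_f n \<psi> (P t) (b * X t 1) (Suc j) = v + \<psi> (Suc j) (P t)"
    by (simp add: plant_f_def v_def)
  moreover have "p_err (P t) (X t) (jet s (t + D)) (Suc (Suc j))
      = v - h (Suc j) (P t) (jet s (t + D)) - jet s (t + D) (Suc j)"
    using j by (cases "Suc j = n") (auto simp: p_err_def v_def simp del: h_fun.simps)
  ultimately show ?thesis
    using Y.error_has_derivative_iff[OF j, of P t "{0..}" "\<lambda>t. jet s (t + D)" v] j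
    by (simp add: P_dyn_def p_err_def h_fun_eq_tau_fun)
qed

lemma X_dyn_iff_error:
  assumes t: "t \<ge> 0" and j: "j < m" and low: "\<And>l. l \<in> {1..j} \<Longrightarrow> X_dyn P X l t"
    and P: "\<And>i. i \<in> {1..n} \<Longrightarrow> P_dyn P X i t"
  shows "X_dyn P X (Suc j) t \<longleftrightarrow>
    ((\<lambda>t. x_err (P t) (X t) (jet s (t + D)) (Suc j)) has_real_derivative
      - c (Suc j) * x_err (P t) (X t) (jet s (t + D)) (Suc j)
      + x_err (P t) (X t) (jet s (t + D)) (Suc (Suc j))) (at t within {0..})"
proof -
  let ?\<delta> = "\<lambda>t. \<delta> (P t) (X t) (jet s (t + D))"
  define U where "U = nominal_control n m b \<psi> \<phi> k c (P t) (X t) (jet s (t + D))"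
  define v where "v = (if Suc j = m then U else X t (Suc (Suc j)))"
  have X: "((\<lambda>t. X t l) has_real_derivative X t (l + 1) + \<phi> l (X t)) (at t within {0..})"
    if "l \<in> {1..j}" for l
    using low[OF that] that j by (auto simp: X_dyn_def)
  \<comment> \<open>The jet entry of order \<open>l\<close> involves \<open>x_1, ..., x_l\<close>
    only, and as \<open>l \<le> j\<close> their equations are supplied by
    \<open>low\<close>.\<close>
  moreover have "((\<lambda>t. ?\<delta> t l) has_real_derivative ?\<delta> t (Suc l)) (at t within {0..})"
    if l: "l \<le> j" for l
    unfolding Delta_jet_def
  proof (rule Delta_has_derivative)
    show "((\<lambda>t. jet s (t + D) i) has_real_derivative jet s (t + D) (i + 1)) (at t within {0..})"
      if "i \<le> n + l" for i
      using jet_has_derivative[of i t] that l j t by simp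
  qed (use l j X P in \<open>auto simp: P_dyn_def\<close>)
  \<comment> \<open>The nominal control is what makes the input of the error chain vanish: at
    \<open>Suc j = m\<close> both sides are 0.\<close>
  moreover have "x_err (P t) (X t) (jet s (t + D)) (Suc (Suc j))
      = b * v - X.\<tau> (Suc j) (X t) (?\<delta> t) - ?\<delta> t (Suc j)"
    using j b_nz by (cases "Suc j = m") (auto simp: x_err_def v_def U_def nominal_control_def Let_def simp del: tau_fun.simps)
  moreover have "X_dyn P X (Suc j) t \<longleftrightarrow>
      ((\<lambda>t. X t (Suc j)) has_real_derivative v + \<phi> (Suc j) (X t)) (at t within {0..})"
    by (simp add: X_dyn_def v_def U_def add.commute)
  ultimately show ?thesis
    using X.error_has_derivative_iff[OF j, of X t "{0..}" ?\<delta> v] j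
    by (simp add: x_err_def)
qed

text \<open>From errors to states, all stages of \<open>P\<close> come first: the last of them needs
  only the value of \<open>x_1\<close>, whereas every stage of \<open>X\<close> differentiates
  \<open>\<Delta>\<close> along \<open>P\<close>.\<close>

lemma dyn_iff_filter_chain:
  "(\<forall>t\<ge>0. (\<forall>i\<in>{1..n}. P_dyn P X i t) \<and> (\<forall>j\<in>{1..m}. X_dyn P X j t)) \<longleftrightarrow>
     filter_chain n k (\<lambda>i t. p_err (P t) (X t) (jet s (t + D)) i) \<and>
     filter_chain m c (\<lambda>j t. x_err (P t) (X t) (jet s (t + D)) j)" (is "?L \<longleftrightarrow> ?PC \<and> ?XC")
proof
  assume L: ?L
  have ?PC unfolding filter_chain_def
  proof (intro ballI allI impI)
    fix i and t :: real assume i: "i \<in> {1..n}" and t: "t \<ge> 0"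
    then obtain j where j: "i = Suc j" "j < n" by (cases i) auto
    show "((\<lambda>t. p_err (P t) (X t) (jet s (t + D)) i) has_real_derivative
        - k i * p_err (P t) (X t) (jet s (t + D)) i + p_err (P t) (X t) (jet s (t + D)) (Suc i)) (at t within {0..})"
      unfolding j(1) using L t j by (subst P_dyn_iff_error[symmetric]) auto
  qed
  moreover have ?XC unfolding filter_chain_def
  proof (intro ballI allI impI)
    fix i and t :: real assume i: "i \<in> {1..m}" and t: "t \<ge> 0"
    then obtain j where j: "i = Suc j" "j < m" by (cases i) auto
    show "((\<lambda>t. x_err (P t) (X t) (jet s (t + D)) i) has_real_derivative
        - c i * x_err (P t) (X t) (jet s (t + D)) i + x_err (P t) (X t) (jet s (t + D)) (Suc i)) (at t within {0..})"
      unfolding j(1) using L t j by (subst X_dyn_iff_error[symmetric]) auto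
  qed
  ultimately show "?PC \<and> ?XC" ..
next
  assume C: "?PC \<and> ?XC"
  show ?L
  proof (intro allI impI)
    fix t :: real assume t: "t \<ge> 0"
    have "\<forall>i\<in>{1..N}. P_dyn P X i t" if "N \<le> n" for N
      using that
    proof (induction N)
      case (Suc N)
      then have "P_dyn P X (Suc N) t"
        using C t by (subst P_dyn_iff_error) (auto simp: filter_chain_def)
      with Suc show ?case by (auto simp: le_Suc_eq)
    qed simp
    then have P: "\<forall>i\<in>{1..n}. P_dyn P X i t" by blast
    have "\<forall>i\<in>{1..N}. X_dyn P X i t" if "N \<le> m" for N
      using that
    proof (induction N)
      case (Suc N)
      then have "X_dyn P X (Suc N) t"
        using C t P by (subst X_dyn_iff_error) (auto simp: filter_chain_def)
      with Suc show ?case by (auto simp: le_Suc_eq)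
    qed simp
    with P show "(\<forall>i\<in>{1..n}. P_dyn P X i t) \<and> (\<forall>j\<in>{1..m}. X_dyn P X j t)" by blast
  qed
qed

section \<open>Invertibility of the error transformation\<close>

lemma h_cong:
  "j \<le> n \<Longrightarrow> (\<And>i. i \<in> {1..j} \<Longrightarrow> p i = q i) \<Longrightarrow> h j p \<sigma> = h j q \<sigma>"
  by (rule CR2_depends_on[OF h_CR2]) auto

lemma Delta_cong:
  "j \<le> m \<Longrightarrow> (\<And>i. i \<in> {1..n} \<Longrightarrow> p i = q i) \<Longrightarrow> (\<And>i. i \<in> {1..j} \<Longrightarrow> x i = y i) \<Longrightarrow>
     \<Delta> j p x \<sigma> = \<Delta> j q y \<sigma>"
  by (rule CR3_depends_on[OF Delta_CR3]) auto

lemma tau_delta_cong: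
  assumes "j \<le> m" "\<And>i. i \<in> {1..n} \<Longrightarrow> p i = q i" "\<And>i. i \<in> {1..j} \<Longrightarrow> x i = y i"
  shows "X.\<tau> j x (\<delta> p x \<sigma>) = X.\<tau> j y (\<delta> q y \<sigma>)"
  by (rule CR2_depends_on[OF X.tau_CR2]) (use assms in \<open>auto simp: Delta_jet_def intro!: Delta_cong\<close>)

lemma err_cong:
  assumes "\<And>i. i \<in> {1..n} \<Longrightarrow> p i = q i" "\<And>j. j \<in> {1..m} \<Longrightarrow> x j = y j"
  shows "i \<in> {1..Suc n} \<Longrightarrow> p_err p x \<sigma> i = p_err q y \<sigma> i"
    and "j \<in> {1..Suc m} \<Longrightarrow> x_err p x \<sigma> j = x_err q y \<sigma> j"
proof -
  assume i: "i \<in> {1..Suc n}"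
  show "p_err p x \<sigma> i = p_err q y \<sigma> i"
  proof (cases "i \<le> n")
    case True
    then show ?thesis using i h_cong[of "i - 1" p q] assms by (auto simp: p_err_def)
  next
    case False
    then show ?thesis using Delta_cong[of 0 p q x y] assms m_ge
      by (auto simp: p_err_def simp del: Delta_fun.simps)
  qed
next
  assume j: "j \<in> {1..Suc m}"
  show "x_err p x \<sigma> j = x_err q y \<sigma> j"
  proof (cases "j \<le> m")
    case True
    then have "X.\<tau> (j - 1) x (\<delta> p x \<sigma>) = X.\<tau> (j - 1) y (\<delta> q y \<sigma>)"
      using j by (intro tau_delta_cong assms) auto
    moreover have "\<delta> p x \<sigma> (j - 1) = \<delta> q y \<sigma> (j - 1)"
      unfolding Delta_jet_def using j True by (intro Delta_cong assms) auto
    ultimately show ?thesis using j True assms by (auto simp: x_err_def)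
  qed (simp add: x_err_def)
qed

text \<open>\<open>p\<close> is recovered before \<open>x\<close>, because the jet of
  \<open>\<Delta>\<close> depends on all of \<open>p\<close>. Both systems are triangular:
  \<open>h j\<close> reads the first \<open>j\<close> entries of \<open>p\<close>, and the
  right-hand side for \<open>x (Suc j)\<close> only \<open>x_1, ..., x_j\<close>.\<close>

lemma err_surj:
  "\<exists>p x. (\<forall>i\<in>{1..n}. p_err p x \<sigma> i = z i) \<and> (\<forall>j\<in>{1..m}. x_err p x \<sigma> j = r j)"
proof -
  have "\<exists>p. \<forall>j<n. p (Suc j) = z (Suc j) + h j p \<sigma> + \<sigma> j"
    by (rule triangular_solve) (use h_cong in \<open>metis less_imp_le\<close>)
  then obtain p where p: "\<And>j. j < n \<Longrightarrow> p (Suc j) = z (Suc j) + h j p \<sigma> + \<sigma> j" by blast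
  have "\<exists>x. \<forall>j<m. x (Suc j) = (r (Suc j) + X.\<tau> j x (\<delta> p x \<sigma>) + \<delta> p x \<sigma> j) / b"
  proof (rule triangular_solve)
    fix j and x y :: "nat \<Rightarrow> real" assume j: "j < m" and xy: "\<And>i. i \<in> {1..j} \<Longrightarrow> x i = y i"
    have "X.\<tau> j x (\<delta> p x \<sigma>) = X.\<tau> j y (\<delta> p y \<sigma>)" using j xy by (intro tau_delta_cong) auto
    moreover have "\<delta> p x \<sigma> j = \<delta> p y \<sigma> j"
      unfolding Delta_jet_def using j xy by (intro Delta_cong) auto
    ultimately show "(r (Suc j) + X.\<tau> j x (\<delta> p x \<sigma>) + \<delta> p x \<sigma> j) / b
        = (r (Suc j) + X.\<tau> j y (\<delta> p y \<sigma>) + \<delta> p y \<sigma> j) / b" by simp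
  qed
  then obtain x where x: "\<And>j. j < m \<Longrightarrow> x (Suc j) = (r (Suc j) + X.\<tau> j x (\<delta> p x \<sigma>) + \<delta> p x \<sigma> j) / b"
    by blast
  have "p_err p x \<sigma> i = z i" if "i \<in> {1..n}" for i
    using p[of "i - 1"] that by (cases i) (auto simp: p_err_def)
  moreover have "x_err p x \<sigma> j = r j" if "j \<in> {1..m}" for j
    using x[of "j - 1"] that b_nz by (cases j) (auto simp: x_err_def)
  ultimately show ?thesis by blast
qed

text \<open>Needed for the initial state: a solution constructed in error coordinates starts at the
  prescribed point because its errors determine it.\<close>

lemma err_inj:
  assumes pe: "\<And>i. i \<in> {1..n} \<Longrightarrow> p_err p x \<sigma> i = p_err q y \<sigma> i"
    and xe: "\<And>j. j \<in> {1..m} \<Longrightarrow> x_err p x \<sigma> j = x_err q y \<sigma> j"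
  shows "i \<in> {1..n} \<Longrightarrow> p i = q i" and "j \<in> {1..m} \<Longrightarrow> x j = y j"
proof -
  have pq: "p i = q i" if "i \<in> {1..n}" for i
  proof (rule triangular_unique[OF _ _ _ that])
    show "h j u \<sigma> + p_err p x \<sigma> (Suc j) + \<sigma> j = h j v \<sigma> + p_err p x \<sigma> (Suc j) + \<sigma> j"
      if "j < n" "\<And>i. i \<in> {1..j} \<Longrightarrow> u i = v i" for j u v using h_cong[of j u v] that by simp
    show "p (Suc j) = h j p \<sigma> + p_err p x \<sigma> (Suc j) + \<sigma> j" if "j < n" for j
      using that by (simp add: p_err_def)
    show "q (Suc j) = h j q \<sigma> + p_err p x \<sigma> (Suc j) + \<sigma> j" if "j < n" for j
      using that pe[of "Suc j"] by (simp add: p_err_def)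
  qed
  then show "i \<in> {1..n} \<Longrightarrow> p i = q i" .
  show "x j = y j" if "j \<in> {1..m}"
  proof (rule triangular_unique[OF _ _ _ that])
    show "(x_err p x \<sigma> (Suc j) + X.\<tau> j u (\<delta> p u \<sigma>) + \<delta> p u \<sigma> j) / b
        = (x_err p x \<sigma> (Suc j) + X.\<tau> j v (\<delta> p v \<sigma>) + \<delta> p v \<sigma> j) / b"
      if "j < m" "\<And>i. i \<in> {1..j} \<Longrightarrow> u i = v i" for j u v
      using tau_delta_cong[of j p p u v \<sigma>] Delta_cong[of j p p u v \<sigma>] that by (simp add: Delta_jet_def)
    show "x (Suc j) = (x_err p x \<sigma> (Suc j) + X.\<tau> j x (\<delta> p x \<sigma>) + \<delta> p x \<sigma> j) / b" if "j < m" for j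
      using that b_nz by (simp add: x_err_def)
    show "y (Suc j) = (x_err p x \<sigma> (Suc j) + X.\<tau> j y (\<delta> p y \<sigma>) + \<delta> p y \<sigma> j) / b" if "j < m" for j
    proof -
      have "X.\<tau> j y (\<delta> q y \<sigma>) = X.\<tau> j y (\<delta> p y \<sigma>)" "\<delta> q y \<sigma> j = \<delta> p y \<sigma> j"
        using tau_delta_cong[of j q p y y \<sigma>] Delta_cong[of j q p y y \<sigma>] that pq by (auto simp: Delta_jet_def)
      then show ?thesis using xe[of "Suc j"] that b_nz by (simp add: x_err_def)
    qed
  qed
qed

text \<open>The chains are solved in error coordinates, that of \<open>X\<close> first since
  \<open>r_1\<close> drives that of \<open>P\<close>. The preimages \<open>P t\<close> and
  \<open>X t\<close> are then chosen independently at each time; their differentiability in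
  \<open>t\<close> is delivered by \<open>dyn_iff_filter_chain\<close>.\<close>

lemma dyn_exists:
  obtains P X where "\<And>i. i \<in> {1..n} \<Longrightarrow> P 0 i = p0 i" "\<And>j. j \<in> {1..m} \<Longrightarrow> X 0 j = x0 j"
    and "\<And>t i. t \<ge> 0 \<Longrightarrow> i \<in> {1..n} \<Longrightarrow> P_dyn P X i t"
    and "\<And>t j. t \<ge> 0 \<Longrightarrow> j \<in> {1..m} \<Longrightarrow> X_dyn P X j t"
proof -
  obtain r where r: "filter_chain m c r"
    "\<And>j. j \<in> {1..m} \<Longrightarrow> r j 0 = x_err p0 x0 (jet s D) j" "r (Suc m) = (\<lambda>t. 0)"
    by (rule filter_chain_exists[of "\<lambda>t. 0" m c "x_err p0 x0 (jet s D)"]) auto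
  have "continuous_on {0..} (r 1)"
    using r(1) m_ge by (intro has_derivative_halfline_imp_continuous) (auto simp: filter_chain_def)
  then obtain z where z: "filter_chain n k z"
    "\<And>i. i \<in> {1..n} \<Longrightarrow> z i 0 = p_err p0 x0 (jet s D) i" "z (Suc n) = r 1"
    by (rule filter_chain_exists[of "r 1" n k "p_err p0 x0 (jet s D)"]) blast
  have "\<forall>t. \<exists>p x. (\<forall>i\<in>{1..n}. p_err p x (jet s (t + D)) i = z i t)
      \<and> (\<forall>j\<in>{1..m}. x_err p x (jet s (t + D)) j = r j t)"
    by (intro allI err_surj)
  then obtain P X where PX:
    "\<And>t i. i \<in> {1..n} \<Longrightarrow> p_err (P t) (X t) (jet s (t + D)) i = z i t"
    "\<And>t j. j \<in> {1..m} \<Longrightarrow> x_err (P t) (X t) (jet s (t + D)) j = r j t" by metis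
  have P': "p_err (P t) (X t) (jet s (t + D)) i = z i t" if "i \<in> {1..Suc n}" for i t
  proof (cases "i = Suc n")
    case True
    then have "p_err (P t) (X t) (jet s (t + D)) i = x_err (P t) (X t) (jet s (t + D)) 1"
      using m_ge by (simp add: p_err_def x_err_def Delta_jet_def)
    then show ?thesis using PX(2)[of 1 t] m_ge z(3) True by simp
  qed (use that PX in auto)
  have X': "x_err (P t) (X t) (jet s (t + D)) j = r j t" if "j \<in> {1..Suc m}" for j t
    using that PX(2) r(3) by (cases "j = Suc m") (auto simp: x_err_def)
  have "filter_chain n k (\<lambda>i t. p_err (P t) (X t) (jet s (t + D)) i)"
    using z(1) P' by (simp add: filter_chain_def)
  moreover have "filter_chain m c (\<lambda>j t. x_err (P t) (X t) (jet s (t + D)) j)"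
    using r(1) X' by (simp add: filter_chain_def)
  ultimately have "\<forall>t\<ge>0. (\<forall>i\<in>{1..n}. P_dyn P X i t) \<and> (\<forall>j\<in>{1..m}. X_dyn P X j t)"
    using dyn_iff_filter_chain by blast
  moreover have "p_err (P 0) (X 0) (jet s D) i = p_err p0 x0 (jet s D) i" if "i \<in> {1..n}" for i
    using PX(1)[OF that, of 0] z(2)[OF that] by simp
  moreover have "x_err (P 0) (X 0) (jet s D) j = x_err p0 x0 (jet s D) j" if "j \<in> {1..m}" for j
    using PX(2)[OF that, of 0] r(2)[OF that] by simp
  ultimately show thesis using err_inj[of "P 0" "X 0" "jet s D" p0 x0] by (intro that[of P X]) auto
qed

lemma closed_loop_exists:
  assumes init: "predictor_init n b D \<psi> Y0 \<xi> P0"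
    and \<xi>: "continuous_on {-D..0} \<xi>" "\<xi> 0 = X0 1"
  shows "\<exists>Y X P. closed_loop n m b D \<psi> \<phi> s k c Y0 X0 \<xi> P0 Y X P"
proof -
  obtain P1 X1 where i1: "\<And>i. i \<in> {1..n} \<Longrightarrow> P1 0 i = P0 0 i" "\<And>j. j \<in> {1..m} \<Longrightarrow> X1 0 j = X0 j"
    and dP: "\<And>t i. t \<ge> 0 \<Longrightarrow> i \<in> {1..n} \<Longrightarrow> P_dyn P1 X1 i t"
    and dX: "\<And>t j. t \<ge> 0 \<Longrightarrow> j \<in> {1..m} \<Longrightarrow> X_dyn P1 X1 j t"
    by (rule dyn_exists[of "P0 0" X0]) blast
  define P where "P = (\<lambda>t. if t < 0 then P0 t else P1 t)"
  \<comment> \<open>Before time zero only the first coordinate is prescribed; the history value in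
    the other coordinates is a filler.\<close>
  define X where "X = (\<lambda>t. if t < 0 then (\<lambda>_. \<xi> t) else X1 t)"
  define g where "g = (\<lambda>i t. plant_f n \<psi> (P t) (b * X t 1) i)"
  have P_hist: "P \<theta> i = P0 \<theta> i" if "\<theta> \<in> {-D..0}" "i \<in> {1..n}" for \<theta> i
    using that i1 by (cases "\<theta> = 0") (auto simp: P_def)
  have X_hist: "X \<theta> 1 = \<xi> \<theta>" if "\<theta> \<in> {-D..0}" for \<theta>
    using that i1 m_ge \<xi>(2) by (cases "\<theta> = 0") (auto simp: X_def)
  have un: "{-D..0} \<union> {0..} = {-D..}" using D_pos by auto
  have init': "(g i has_integral (P \<theta> i - Y0 i)) {-D..\<theta>}" if "\<theta> \<in> {-D..0}" "i \<in> {1..n}" for \<theta> i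
  proof -
    have "((\<lambda>\<sigma>. plant_f n \<psi> (P0 \<sigma>) (b * \<xi> \<sigma>) i) has_integral (P0 \<theta> i - Y0 i)) {-D..\<theta>}"
      using init that unfolding predictor_init_def by auto
    moreover have "plant_f n \<psi> (P0 \<sigma>) (b * \<xi> \<sigma>) i = g i \<sigma>" if "\<sigma> \<in> {-D..\<theta>}" for \<sigma>
    proof -
      have \<sigma>: "\<sigma> \<in> {-D..0}" using that \<open>\<theta> \<in> _\<close> by auto
      show ?thesis unfolding g_def X_hist[OF \<sigma>] using \<open>i \<in> _\<close> P_hist[OF \<sigma>] by (intro plant_f_cong) auto
    qed
    ultimately show ?thesis unfolding P_hist[OF that] by (rule has_integral_eq[rotated])
  qed
  have P_cont: "continuous_on {-D..} (\<lambda>t. P t i)" if i: "i \<in> {1..n}" for i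
  proof -
    have "continuous_on ({-D..0} \<union> {0..}) (\<lambda>t. P t i)"
    proof (rule continuous_on_closed_Un)
      have "continuous_on {-D..0} (\<lambda>t. Y0 i + integral {-D..t} (g i))"
        using init'[of 0 i] i D_pos
        by (intro continuous_intros indefinite_integral_continuous_1) auto
      moreover have "Y0 i + integral {-D..t} (g i) = P t i" if "t \<in> {-D..0}" for t
        using integral_unique[OF init'[OF that i]] by simp
      ultimately show "continuous_on {-D..0} (\<lambda>t. P t i)" by (rule continuous_on_eq)
      have "continuous_on {0..} (\<lambda>t. P1 t i)"
        using dP[OF _ i] unfolding P_dyn_def by (rule has_derivative_halfline_imp_continuous)
      moreover have "P1 t i = P t i" if "t \<in> {0..}" for t using that by (simp add: P_def)
      ultimately show "continuous_on {0..} (\<lambda>t. P t i)" by (rule continuous_on_eq)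
    qed auto
    then show ?thesis using un by simp
  qed
  have X_cont: "continuous_on {-D..} (\<lambda>t. X t 1)"
  proof -
    have "continuous_on ({-D..0} \<union> {0..}) (\<lambda>t. X t 1)"
    proof (rule continuous_on_closed_Un)
      show "continuous_on {-D..0} (\<lambda>t. X t 1)"
        using \<xi>(1) by (subst continuous_on_cong[OF refl X_hist])
      have "continuous_on {0..} (\<lambda>t. X1 t 1)"
        using dX[of _ 1] m_ge unfolding X_dyn_def by (intro has_derivative_halfline_imp_continuous) auto
      moreover have "X1 t 1 = X t 1" if "t \<in> {0..}" for t using that by (simp add: X_def)
      ultimately show "continuous_on {0..} (\<lambda>t. X t 1)" by (rule continuous_on_eq)
    qed auto
    then show ?thesis using un by simp
  qed
  have g_cont: "continuous_on {-D..} (g i)" if "i \<in> {1..n}" for i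
    unfolding g_def using that P_cont X_cont by (intro continuous_on_plant_f continuous_intros) auto
  have P_int: "(g i has_integral (P t i - Y0 i)) {-D..t}" if t: "t \<ge> -D" and i: "i \<in> {1..n}" for t i
  proof (cases "t \<le> 0")
    case False
    have "(g i has_integral (P t i - P 0 i)) {0..t}"
    proof (rule fundamental_theorem_of_calculus)
      fix \<tau> assume \<tau>: "\<tau> \<in> {0..t}"
      have "((\<lambda>t. P1 t i) has_real_derivative g i \<tau>) (at \<tau> within {0..t})"
        using dP[of \<tau> i] \<tau> i unfolding P_dyn_def
        by (auto simp: g_def P_def X_def intro: has_field_derivative_subset)
      then have "((\<lambda>t. P t i) has_real_derivative g i \<tau>) (at \<tau> within {0..t})"
        by (rule has_field_derivative_transform_within[of _ _ _ _ 1]) (use \<tau> in \<open>auto simp: P_def\<close>)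
      then show "((\<lambda>t. P t i) has_vector_derivative g i \<tau>) (at \<tau> within {0..t})"
        by (simp add: has_real_derivative_iff_has_vector_derivative)
    qed (use False in auto)
    from has_integral_combine[OF _ _ init'[of 0, OF _ i] this] False D_pos show ?thesis by simp
  qed (use t i init' in auto)
  \<comment> \<open>Viewing \<open>P\<close> as the integral of the continuous function
    \<open>g\<close>, instead of piecewise, gives its derivative across time zero as well.\<close>
  have P_deriv: "((\<lambda>t. P t i) has_real_derivative g i t) (at t within {-D..})"
    if t: "t \<ge> -D" and i: "i \<in> {1..n}" for t i
  proof -
    have "((\<lambda>t. Y0 i + integral {-D..t} (g i)) has_real_derivative g i t) (at t within {-D..})"
      using integral_has_derivative_halfline[OF g_cont[OF i] t] by (auto intro!: derivative_eq_intros)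
    moreover have "Y0 i + integral {-D..\<tau>} (g i) = P \<tau> i" if "\<tau> \<ge> -D" for \<tau>
      using integral_unique[OF P_int[OF that i]] by simp
    ultimately show ?thesis
      by (elim has_field_derivative_transform_within[where d = 1]) (use t in simp_all)
  qed
  \<comment> \<open>Exactness holds by construction: \<open>Y\<close> is the delayed predictor, and
    the integral equation becomes the fundamental theorem of calculus on a window.\<close>
  define Y where "Y = (\<lambda>t. P (t - D))"
  have "Y 0 i = Y0 i" if "i \<in> {1..n}" for i
    using integral_unique[OF init'[of "-D" i]] that D_pos by (simp add: Y_def)
  moreover have "X 0 j = X0 j" if "j \<in> {1..m}" for j using that i1 by (simp add: X_def)
  moreover have "((\<lambda>t. Y t i) has_real_derivative plant_f n \<psi> (Y t) (b * X (t - D) 1) i) (at t within {0..})"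
    if t: "t \<ge> 0" and i: "i \<in> {1..n}" for t i
  proof -
    have "((\<lambda>t. P t i) \<circ> (\<lambda>t. t - D) has_real_derivative g i (t - D) * 1) (at t within {0..})"
      using t i D_pos
      by (intro DERIV_image_chain[OF has_field_derivative_subset[OF P_deriv]])
        (auto intro!: derivative_eq_intros)
    then show ?thesis by (simp add: o_def Y_def g_def)
  qed
  moreover have "((\<lambda>t. X t j) has_real_derivative
      (if j = m
       then \<phi> m (X t) + nominal_control n m b \<psi> \<phi> k c (P t) (X t) (jet s (t + D))
       else X t (j + 1) + \<phi> j (X t))) (at t within {0..})" if t: "t \<ge> 0" and j: "j \<in> {1..m}" for t j
  proof -
    have "P t = P1 t" "X t = X1 t" using t by (auto simp: P_def X_def)
    with dX[OF t j] show ?thesis unfolding X_dyn_def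
      by (intro has_field_derivative_transform_within[of "\<lambda>t. X1 t j" _ _ _ 1 "\<lambda>t. X t j"])
        (use t in \<open>auto simp: X_def\<close>)
  qed
  moreover have "(g i has_integral (P t i - Y t i)) {t - D..t}" if t: "t \<ge> 0" and i: "i \<in> {1..n}" for t i
    unfolding Y_def
  proof (rule fundamental_theorem_of_calculus)
    fix \<tau> assume "\<tau> \<in> {t - D..t}"
    then show "((\<lambda>t. P t i) has_vector_derivative g i \<tau>) (at \<tau> within {t - D..t})"
      using has_field_derivative_subset[OF P_deriv[OF _ i], of \<tau> "{t - D..t}"] t
      by (auto simp: has_real_derivative_iff_has_vector_derivative)
  qed (use D_pos in auto)
  ultimately have "closed_loop n m b D \<psi> \<phi> s k c Y0 X0 \<xi> P0 Y X P"
    unfolding closed_loop_def g_def using P_hist X_hist by blast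
  then show ?thesis by blast
qed

end

section \<open>From errors to states\<close>

text \<open>With \<open>E = {1}\<close> these express boundedness on boxes, with \<open>E = {0..1}\<close> a linear bound near the
  origin; bounded trajectories and exponential decay are then treated alike.\<close>

definition LB2 :: "real set \<Rightarrow> nat set \<Rightarrow> nat set \<Rightarrow> ((nat \<Rightarrow> real) \<Rightarrow> (nat \<Rightarrow> real) \<Rightarrow> real) \<Rightarrow> bool" where
  "LB2 E I J F \<longleftrightarrow> (\<forall>L\<ge>0. \<exists>L'\<ge>0. \<forall>\<epsilon>\<in>E. \<forall>u v.
     (\<forall>i\<in>I. \<bar>u i\<bar> \<le> L * \<epsilon>) \<longrightarrow> (\<forall>j\<in>J. \<bar>v j\<bar> \<le> L * \<epsilon>) \<longrightarrow> \<bar>F u v\<bar> \<le> L' * \<epsilon>)"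

definition LB3 :: "real set \<Rightarrow> nat set \<Rightarrow> nat set \<Rightarrow> nat set \<Rightarrow>
    ((nat \<Rightarrow> real) \<Rightarrow> (nat \<Rightarrow> real) \<Rightarrow> (nat \<Rightarrow> real) \<Rightarrow> real) \<Rightarrow> bool" where
  "LB3 E I J K F \<longleftrightarrow> (\<forall>L\<ge>0. \<exists>L'\<ge>0. \<forall>\<epsilon>\<in>E. \<forall>u v w.
     (\<forall>i\<in>I. \<bar>u i\<bar> \<le> L * \<epsilon>) \<longrightarrow> (\<forall>j\<in>J. \<bar>v j\<bar> \<le> L * \<epsilon>) \<longrightarrow> (\<forall>l\<in>K. \<bar>w l\<bar> \<le> L * \<epsilon>) \<longrightarrow>
     \<bar>F u v w\<bar> \<le> L' * \<epsilon>)"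

definition lin_bounded :: "real set \<Rightarrow> 'i set \<Rightarrow> (('i \<Rightarrow> real) \<Rightarrow> real) \<Rightarrow> bool" where
  "lin_bounded E I F \<longleftrightarrow> (\<forall>L\<ge>0. \<exists>L'\<ge>0. \<forall>\<epsilon>\<in>E. \<forall>u. (\<forall>i\<in>I. \<bar>u i\<bar> \<le> L * \<epsilon>) \<longrightarrow> \<bar>F u\<bar> \<le> L' * \<epsilon>)"

lemma CR_imp_bounded:
  assumes "CR I r F"
  shows "lin_bounded {1} I F"
  unfolding lin_bounded_def
proof (intro allI impI)
  fix L :: real assume "L \<ge> 0"
  from bounded_on_box[OF CR_continuous[OF assms] CR_depends_on[OF assms] this] obtain L' where
    "L' \<ge> 0" "\<And>u. (\<And>i. i \<in> I \<Longrightarrow> \<bar>u i\<bar> \<le> L) \<Longrightarrow> \<bar>F u\<bar> \<le> L'" by blast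
  then show "\<exists>L'\<ge>0. \<forall>\<epsilon>\<in>{1}. \<forall>u. (\<forall>i\<in>I. \<bar>u i\<bar> \<le> L * \<epsilon>) \<longrightarrow> \<bar>F u\<bar> \<le> L' * \<epsilon>"
    by (intro exI[of _ L']) simp
qed

text \<open>A Lipschitz bound against the origin, where \<open>F\<close> vanishes;
  \<open>\<epsilon> \<le> 1\<close> keeps the argument inside the box of size \<open>L\<close> on
  which the Lipschitz constant is valid.\<close>

lemma CR_imp_lin_bounded:
  assumes F: "CR I (Suc 0) F" and fin: "finite I" and zero: "F (\<lambda>_. 0) = 0"
  shows "lin_bounded {0..1} I F"
  unfolding lin_bounded_def
proof (intro allI impI)
  fix L :: real assume L: "L \<ge> 0"
  obtain K where K: "K \<ge> 0"
    "\<And>u v. (\<And>i. i \<in> I \<Longrightarrow> \<bar>u i\<bar> \<le> L) \<Longrightarrow> (\<And>i. i \<in> I \<Longrightarrow> \<bar>v i\<bar> \<le> L) \<Longrightarrow>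
       \<bar>F u - F v\<bar> \<le> K * (\<Sum>i\<in>I. \<bar>u i - v i\<bar>)"
    using CR_lipschitz_on_box[OF F fin L] by blast
  have "\<bar>F u\<bar> \<le> K * (card I * L) * \<epsilon>"
    if \<epsilon>: "\<epsilon> \<in> {0..1}" and u: "\<forall>i\<in>I. \<bar>u i\<bar> \<le> L * \<epsilon>" for \<epsilon> u
  proof -
    have "L * \<epsilon> \<le> L" using \<epsilon> L by (simp add: mult_left_le)
    then have "\<bar>u i\<bar> \<le> L" if "i \<in> I" for i using u that by force
    then have "\<bar>F u - F (\<lambda>_. 0)\<bar> \<le> K * (\<Sum>i\<in>I. \<bar>u i - 0\<bar>)"
      using L by (intro K(2)) auto
    also have "\<dots> \<le> K * (card I * (L * \<epsilon>))"
      using u K(1) by (intro mult_left_mono sum_bounded_above) auto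
    finally show ?thesis using zero by (simp add: mult_ac)
  qed
  moreover have "K * (card I * L) \<ge> 0" using K L by simp
  ultimately show "\<exists>L'\<ge>0. \<forall>\<epsilon>\<in>{0..1}. \<forall>u. (\<forall>i\<in>I. \<bar>u i\<bar> \<le> L * \<epsilon>) \<longrightarrow> \<bar>F u\<bar> \<le> L' * \<epsilon>" by blast
qed

lemma lin_bounded_pair:
  assumes "lin_bounded E (I <+> J) (\<lambda>w. F (\<lambda>i. w (Inl i)) (\<lambda>i. w (Inr i)))"
  shows "LB2 E I J F"
  unfolding LB2_def
proof (intro allI impI)
  fix L :: real assume L: "L \<ge> 0"
  obtain L' where L': "L' \<ge> 0"
    "\<And>\<epsilon> w. \<epsilon> \<in> E \<Longrightarrow> \<forall>i\<in>I <+> J. \<bar>w i\<bar> \<le> L * \<epsilon> \<Longrightarrow> \<bar>F (\<lambda>i. w (Inl i)) (\<lambda>i. w (Inr i))\<bar> \<le> L' * \<epsilon>"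
    using assms[unfolded lin_bounded_def, rule_format, OF L] by metis
  have "\<bar>F u v\<bar> \<le> L' * \<epsilon>" if "\<epsilon> \<in> E" "\<forall>i\<in>I. \<bar>u i\<bar> \<le> L * \<epsilon>" "\<forall>j\<in>J. \<bar>v j\<bar> \<le> L * \<epsilon>" for \<epsilon> u v
  proof -
    have "\<forall>i\<in>I <+> J. \<bar>case_sum u v i\<bar> \<le> L * \<epsilon>" using that by auto
    from L'(2)[OF that(1) this] show ?thesis by simp
  qed
  with L'(1) show "\<exists>L'\<ge>0. \<forall>\<epsilon>\<in>E. \<forall>u v. (\<forall>i\<in>I. \<bar>u i\<bar> \<le> L * \<epsilon>) \<longrightarrow> (\<forall>j\<in>J. \<bar>v j\<bar> \<le> L * \<epsilon>) \<longrightarrow>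
      \<bar>F u v\<bar> \<le> L' * \<epsilon>" by blast
qed

lemma lin_bounded_triple:
  assumes "lin_bounded E (I <+> (J <+> K))
    (\<lambda>w. F (\<lambda>i. w (Inl i)) (\<lambda>i. w (Inr (Inl i))) (\<lambda>i. w (Inr (Inr i))))"
  shows "LB3 E I J K F"
  unfolding LB3_def
proof (intro allI impI)
  fix L :: real assume L: "L \<ge> 0"
  obtain L' where L': "L' \<ge> 0"
    "\<And>\<epsilon> w. \<epsilon> \<in> E \<Longrightarrow> \<forall>i\<in>I <+> (J <+> K). \<bar>w i\<bar> \<le> L * \<epsilon> \<Longrightarrow>
      \<bar>F (\<lambda>i. w (Inl i)) (\<lambda>i. w (Inr (Inl i))) (\<lambda>i. w (Inr (Inr i)))\<bar> \<le> L' * \<epsilon>"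
    using assms[unfolded lin_bounded_def, rule_format, OF L] by metis
  have "\<bar>F u v w\<bar> \<le> L' * \<epsilon>" if "\<epsilon> \<in> E" "\<forall>i\<in>I. \<bar>u i\<bar> \<le> L * \<epsilon>" "\<forall>j\<in>J. \<bar>v j\<bar> \<le> L * \<epsilon>"
    "\<forall>l\<in>K. \<bar>w l\<bar> \<le> L * \<epsilon>" for \<epsilon> u v w
  proof -
    have "\<forall>i\<in>I <+> (J <+> K). \<bar>case_sum u (case_sum v w) i\<bar> \<le> L * \<epsilon>" using that by auto
    from L'(2)[OF that(1) this] show ?thesis by simp
  qed
  with L'(1) show "\<exists>L'\<ge>0. \<forall>\<epsilon>\<in>E. \<forall>u v w. (\<forall>i\<in>I. \<bar>u i\<bar> \<le> L * \<epsilon>) \<longrightarrow> (\<forall>j\<in>J. \<bar>v j\<bar> \<le> L * \<epsilon>) \<longrightarrow>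
      (\<forall>l\<in>K. \<bar>w l\<bar> \<le> L * \<epsilon>) \<longrightarrow> \<bar>F u v w\<bar> \<le> L' * \<epsilon>" by blast
qed

lemma CR2_LB2_bounded: "CR2 I J r F \<Longrightarrow> LB2 {1} I J F"
  unfolding CR2_def by (intro lin_bounded_pair CR_imp_bounded)

lemma CR2_LB2_linear:
  "CR2 I J (Suc 0) F \<Longrightarrow> finite I \<Longrightarrow> finite J \<Longrightarrow> F (\<lambda>_. 0) (\<lambda>_. 0) = 0 \<Longrightarrow> LB2 {0..1} I J F"
  unfolding CR2_def by (intro lin_bounded_pair CR_imp_lin_bounded finite_Plus)

lemma CR3_LB3_bounded: "CR3 I J K r F \<Longrightarrow> LB3 {1} I J K F"
  unfolding CR3_def by (intro lin_bounded_triple CR_imp_bounded)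

lemma CR3_LB3_linear:
  "CR3 I J K (Suc 0) F \<Longrightarrow> finite I \<Longrightarrow> finite J \<Longrightarrow> finite K \<Longrightarrow>
     F (\<lambda>_. 0) (\<lambda>_. 0) (\<lambda>_. 0) = 0 \<Longrightarrow> LB3 {0..1} I J K F"
  unfolding CR3_def by (intro lin_bounded_triple CR_imp_lin_bounded finite_Plus)

context predictor_feedback
begin

definition errors_le :: "(nat \<Rightarrow> real) \<Rightarrow> (nat \<Rightarrow> real) \<Rightarrow> (nat \<Rightarrow> real) \<Rightarrow> real \<Rightarrow> bool" where
  "errors_le p x \<sigma> a \<longleftrightarrow>
     (\<forall>i\<in>{1..n}. \<bar>p_err p x \<sigma> i\<bar> \<le> a) \<and> (\<forall>j\<in>{1..m}. \<bar>x_err p x \<sigma> j\<bar> \<le> a)"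

text \<open>The triangular inverse is followed coordinate by coordinate. It uses \<open>h j\<close>
  for \<open>j < n\<close> and \<open>\<tau> j\<close>, \<open>\<Delta> j\<close> for
  \<open>j < m\<close> only; all of these have at least one derivative left, which the linear bound
  near the origin requires. Keeping \<open>M \<ge> K\<close> lets one box contain the states and the
  jet.\<close>

lemma state_bound_from_errors:
  assumes E: "E \<subseteq> {0..}" and K: "K \<ge> 0"
    and h: "\<And>j. j < n \<Longrightarrow> LB2 E {1..j} {..<j} (h j)"
    and tau: "\<And>j. j < m \<Longrightarrow> LB2 E {1..j} {..<j} (X.\<tau> j)"
    and Delta: "\<And>j. j < m \<Longrightarrow> LB3 E {1..n} {1..j} {..n + j} (\<Delta> j)"
  obtains M where "M \<ge> 0"
    "\<And>\<epsilon> p x \<sigma> i. \<epsilon> \<in> E \<Longrightarrow> (\<And>i. i < n + m \<Longrightarrow> \<bar>\<sigma> i\<bar> \<le> K * \<epsilon>) \<Longrightarrow> errors_le p x \<sigma> (K * \<epsilon>) \<Longrightarrow>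
       i \<in> {1..n} \<Longrightarrow> \<bar>p i\<bar> \<le> M * \<epsilon>"
    "\<And>\<epsilon> p x \<sigma> j. \<epsilon> \<in> E \<Longrightarrow> (\<And>i. i < n + m \<Longrightarrow> \<bar>\<sigma> i\<bar> \<le> K * \<epsilon>) \<Longrightarrow> errors_le p x \<sigma> (K * \<epsilon>) \<Longrightarrow>
       j \<in> {1..m} \<Longrightarrow> \<bar>x j\<bar> \<le> M * \<epsilon>"
proof -
  define Q where "Q = {(\<epsilon>, p, x, \<sigma>). \<epsilon> \<in> E \<and> (\<forall>i<n + m. \<bar>\<sigma> i\<bar> \<le> K * \<epsilon>) \<and> errors_le p x \<sigma> (K * \<epsilon>)}"
  have \<epsilon>_nonneg: "\<epsilon> \<ge> 0" if "(\<epsilon>, p, x, \<sigma>) \<in> Q" for \<epsilon> p x \<sigma> using that E by (auto simp: Q_def)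
  have "\<exists>M\<ge>K. \<forall>\<epsilon> p x \<sigma> i. (\<epsilon>, p, x, \<sigma>) \<in> Q \<longrightarrow> i \<in> {1..N} \<longrightarrow> \<bar>p i\<bar> \<le> M * \<epsilon>" if "N \<le> n" for N
    using that
  proof (induction N)
    case 0
    then show ?case by auto
  next
    case (Suc N)
    have "N \<le> n" using Suc.prems by simp
    from Suc.IH[OF this] obtain M where M: "M \<ge> K"
      "\<And>\<epsilon> p x \<sigma> i. (\<epsilon>, p, x, \<sigma>) \<in> Q \<Longrightarrow> i \<in> {1..N} \<Longrightarrow> \<bar>p i\<bar> \<le> M * \<epsilon>" by blast
    obtain L where L: "L \<ge> 0" "\<And>\<epsilon> u v. \<epsilon> \<in> E \<Longrightarrow> (\<forall>i\<in>{1..N}. \<bar>u i\<bar> \<le> M * \<epsilon>) \<Longrightarrow>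
        (\<forall>j\<in>{..<N}. \<bar>v j\<bar> \<le> M * \<epsilon>) \<Longrightarrow> \<bar>h N u v\<bar> \<le> L * \<epsilon>"
    proof -
      have "LB2 E {1..N} {..<N} (h N)" using h Suc.prems by simp
      moreover have "M \<ge> 0" using M(1) K by simp
      ultimately show thesis unfolding LB2_def using that by metis
    qed
    \<comment> \<open>\<open>L\<close> bounds \<open>h N\<close>, one \<open>K\<close> the error and
      the other the jet entry; \<open>M\<close> keeps the bound valid for the earlier
      coordinates.\<close>
    have "\<bar>p i\<bar> \<le> (M + L + 2 * K) * \<epsilon>" if q: "(\<epsilon>, p, x, \<sigma>) \<in> Q" and i: "i \<in> {1..Suc N}" for \<epsilon> p x \<sigma> i
    proof -
      note \<epsilon> = \<epsilon>_nonneg[OF q]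
      have nn: "0 \<le> M * \<epsilon>" "0 \<le> L * \<epsilon>" "0 \<le> K * \<epsilon>" "K * \<epsilon> \<le> M * \<epsilon>"
        using \<epsilon> M(1) L(1) K by (auto intro: mult_right_mono)
      show ?thesis
      proof (cases "i = Suc N")
        case True
        have "\<bar>h N p \<sigma>\<bar> \<le> L * \<epsilon>"
        proof (rule L(2))
          show "\<epsilon> \<in> E" using q by (auto simp: Q_def)
          show "\<forall>i\<in>{1..N}. \<bar>p i\<bar> \<le> M * \<epsilon>" using M(2)[OF q] by blast
          have "\<bar>\<sigma> j\<bar> \<le> K * \<epsilon>" if "j < N" for j using q that Suc.prems by (auto simp: Q_def)
          then show "\<forall>j\<in>{..<N}. \<bar>\<sigma> j\<bar> \<le> M * \<epsilon>" using nn(4) by (meson lessThan_iff order_trans)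
        qed
        moreover have "\<bar>\<sigma> N\<bar> \<le> K * \<epsilon>" "\<bar>p_err p x \<sigma> (Suc N)\<bar> \<le> K * \<epsilon>"
          using q Suc.prems by (auto simp: Q_def errors_le_def)
        moreover have "p (Suc N) = p_err p x \<sigma> (Suc N) + h N p \<sigma> + \<sigma> N"
          using Suc.prems by (simp add: p_err_def)
        ultimately show ?thesis using True nn by (simp add: algebra_simps)
      next
        case False
        then have "\<bar>p i\<bar> \<le> M * \<epsilon>" using M(2)[OF q] i by auto
        then show ?thesis using nn by (simp add: algebra_simps)
      qed
    qed
    moreover have "M + L + 2 * K \<ge> K" using M(1) L(1) K by simp
    ultimately show ?case by blast
  qed
  from this[of n] obtain M0 where M0: "M0 \<ge> K"
    "\<And>\<epsilon> p x \<sigma> i. (\<epsilon>, p, x, \<sigma>) \<in> Q \<Longrightarrow> i \<in> {1..n} \<Longrightarrow> \<bar>p i\<bar> \<le> M0 * \<epsilon>"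
    by blast
  have "\<exists>M\<ge>M0. \<forall>\<epsilon> p x \<sigma> i. (\<epsilon>, p, x, \<sigma>) \<in> Q \<longrightarrow> i \<in> {1..N} \<longrightarrow> \<bar>x i\<bar> \<le> M * \<epsilon>" if "N \<le> m" for N
    using that
  proof (induction N)
    case 0
    then show ?case by auto
  next
    case (Suc N)
    have "N \<le> m" using Suc.prems by simp
    from Suc.IH[OF this] obtain M where M: "M \<ge> M0"
      "\<And>\<epsilon> p x \<sigma> i. (\<epsilon>, p, x, \<sigma>) \<in> Q \<Longrightarrow> i \<in> {1..N} \<Longrightarrow> \<bar>x i\<bar> \<le> M * \<epsilon>" by blast
    have M_ge: "M \<ge> K" "M \<ge> 0" using M(1) M0(1) K by auto
    have "\<exists>L\<ge>0. \<forall>\<epsilon> p x \<sigma>. (\<epsilon>, p, x, \<sigma>) \<in> Q \<longrightarrow> \<bar>\<Delta> l p x \<sigma>\<bar> \<le> L * \<epsilon>" if l: "l \<le> N" for l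
    proof -
      obtain L where L: "L \<ge> 0" "\<And>\<epsilon> u v w. \<epsilon> \<in> E \<Longrightarrow> (\<forall>i\<in>{1..n}. \<bar>u i\<bar> \<le> M * \<epsilon>) \<Longrightarrow>
          (\<forall>j\<in>{1..l}. \<bar>v j\<bar> \<le> M * \<epsilon>) \<Longrightarrow> (\<forall>j\<in>{..n + l}. \<bar>w j\<bar> \<le> M * \<epsilon>) \<Longrightarrow> \<bar>\<Delta> l u v w\<bar> \<le> L * \<epsilon>"
      proof -
        have "LB3 E {1..n} {1..l} {..n + l} (\<Delta> l)" using Delta Suc.prems l by simp
        then show thesis unfolding LB3_def using M_ge(2) that by metis
      qed
      have "\<bar>\<Delta> l p x \<sigma>\<bar> \<le> L * \<epsilon>" if q: "(\<epsilon>, p, x, \<sigma>) \<in> Q" for \<epsilon> p x \<sigma>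
      proof (rule L(2))
        have le: "K * \<epsilon> \<le> M * \<epsilon>" "M0 * \<epsilon> \<le> M * \<epsilon>"
          using \<epsilon>_nonneg[OF q] M_ge M(1) by (auto intro: mult_right_mono)
        show "\<epsilon> \<in> E" using q by (auto simp: Q_def)
        show "\<forall>i\<in>{1..n}. \<bar>p i\<bar> \<le> M * \<epsilon>" using M0(2)[OF q] le by force
        show "\<forall>j\<in>{1..l}. \<bar>x j\<bar> \<le> M * \<epsilon>" using M(2)[OF q] l by force
        have "\<bar>\<sigma> j\<bar> \<le> K * \<epsilon>" if "j \<le> n + l" for j using q that l Suc.prems by (auto simp: Q_def)
        then show "\<forall>j\<in>{..n + l}. \<bar>\<sigma> j\<bar> \<le> M * \<epsilon>" using le(1) by (meson atMost_iff order_trans)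
      qed
      then show ?thesis using L(1) by blast
    qed
    then obtain Ld where Ld: "\<And>l. l \<le> N \<Longrightarrow> Ld l \<ge> 0"
      "\<And>l \<epsilon> p x \<sigma>. l \<le> N \<Longrightarrow> (\<epsilon>, p, x, \<sigma>) \<in> Q \<Longrightarrow> \<bar>\<Delta> l p x \<sigma>\<bar> \<le> Ld l * \<epsilon>"
      by metis
    \<comment> \<open>\<open>M1\<close> dominates the states found so far and the entries of the jet
      of \<open>\<Delta>\<close>, the two arguments of \<open>\<tau> N\<close>.\<close>
    define M1 where "M1 = M + (\<Sum>l\<le>N. Ld l)"
    have Ld_le: "Ld l \<le> M1" if "l \<le> N" for l
    proof -
      have "Ld l \<le> (\<Sum>l\<le>N. Ld l)" using that Ld(1) by (intro member_le_sum) auto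
      then show ?thesis using M_ge by (simp add: M1_def)
    qed
    have M1: "M1 \<ge> M" using Ld(1) by (auto simp: M1_def intro!: sum_nonneg)
    have \<delta>_le: "\<bar>\<delta> p x \<sigma> l\<bar> \<le> M1 * \<epsilon>" if "l \<le> N" "(\<epsilon>, p, x, \<sigma>) \<in> Q" for l \<epsilon> p x \<sigma>
      using Ld(2)[OF that] mult_right_mono[OF Ld_le[OF that(1)] \<epsilon>_nonneg[OF that(2)]]
      by (simp add: Delta_jet_def)
    obtain L where L: "L \<ge> 0" "\<And>\<epsilon> u v. \<epsilon> \<in> E \<Longrightarrow> (\<forall>i\<in>{1..N}. \<bar>u i\<bar> \<le> M1 * \<epsilon>) \<Longrightarrow>
        (\<forall>j\<in>{..<N}. \<bar>v j\<bar> \<le> M1 * \<epsilon>) \<Longrightarrow> \<bar>X.\<tau> N u v\<bar> \<le> L * \<epsilon>"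
    proof -
      have "LB2 E {1..N} {..<N} (X.\<tau> N)" using tau Suc.prems by simp
      moreover have "M1 \<ge> 0" using M1 M_ge by simp
      ultimately show thesis unfolding LB2_def using that by metis
    qed
    \<comment> \<open>The quotient comes from solving
      \<open>b * x (Suc N) = r + \<tau> + \<delta>\<close>, whose three terms are bounded by
      \<open>K\<close>, \<open>L\<close> and \<open>M1\<close>.\<close>
    define M' where "M' = M + (K + L + M1) / \<bar>b\<bar>"
    have M'_ge: "(K + L + M1) / \<bar>b\<bar> \<ge> 0" using K L(1) M1 M_ge by simp
    have "\<bar>x i\<bar> \<le> M' * \<epsilon>" if q: "(\<epsilon>, p, x, \<sigma>) \<in> Q" and i: "i \<in> {1..Suc N}" for \<epsilon> p x \<sigma> i
    proof -
      note \<epsilon> = \<epsilon>_nonneg[OF q]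
      have nn: "0 \<le> M * \<epsilon>" "M * \<epsilon> \<le> M1 * \<epsilon>" "0 \<le> (K + L + M1) / \<bar>b\<bar> * \<epsilon>"
        using \<epsilon> M_ge M1 M'_ge by (auto intro: mult_right_mono mult_nonneg_nonneg simp del: times_divide_eq_left)
      have M'_eq: "M' * \<epsilon> = M * \<epsilon> + (K + L + M1) / \<bar>b\<bar> * \<epsilon>" by (simp add: M'_def distrib_right)
      show ?thesis
      proof (cases "i = Suc N")
        case True
        have "\<bar>X.\<tau> N x (\<delta> p x \<sigma>)\<bar> \<le> L * \<epsilon>"
        proof (rule L(2))
          show "\<epsilon> \<in> E" using q by (auto simp: Q_def)
          show "\<forall>i\<in>{1..N}. \<bar>x i\<bar> \<le> M1 * \<epsilon>" using M(2)[OF q] nn(2) by force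
          show "\<forall>j\<in>{..<N}. \<bar>\<delta> p x \<sigma> j\<bar> \<le> M1 * \<epsilon>" using \<delta>_le[OF _ q] by simp
        qed
        moreover have "\<bar>\<delta> p x \<sigma> N\<bar> \<le> M1 * \<epsilon>" "\<bar>x_err p x \<sigma> (Suc N)\<bar> \<le> K * \<epsilon>"
          using q Suc.prems \<delta>_le[OF _ q] by (auto simp: Q_def errors_le_def)
        moreover have bx: "b * x (Suc N) = x_err p x \<sigma> (Suc N) + X.\<tau> N x (\<delta> p x \<sigma>) + \<delta> p x \<sigma> N"
          using Suc.prems by (simp add: x_err_def)
        ultimately have "\<bar>b * x (Suc N)\<bar> \<le> (K + L + M1) * \<epsilon>" by (simp add: algebra_simps)
        then have "\<bar>x (Suc N)\<bar> \<le> (K + L + M1) / \<bar>b\<bar> * \<epsilon>"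
          using b_nz by (simp add: abs_mult field_simps)
        then show ?thesis using True nn(1) M'_eq by simp
      next
        case False
        then have "\<bar>x i\<bar> \<le> M * \<epsilon>" using M(2)[OF q] i by auto
        then show ?thesis using nn(3) M'_eq by linarith
      qed
    qed
    moreover have "M' \<ge> M0" unfolding M'_def using M(1) M'_ge by linarith
    ultimately show ?case by blast
  qed
  from this[of m] obtain M where M: "M \<ge> M0"
    "\<And>\<epsilon> p x \<sigma> i. (\<epsilon>, p, x, \<sigma>) \<in> Q \<Longrightarrow> i \<in> {1..m} \<Longrightarrow> \<bar>x i\<bar> \<le> M * \<epsilon>"
    by blast
  show thesis
  proof (rule that)
    show "M \<ge> 0" using M(1) M0(1) K by simp
    fix \<epsilon> p x \<sigma> i
    assume a: "\<epsilon> \<in> E" "\<And>i. i < n + m \<Longrightarrow> \<bar>\<sigma> i\<bar> \<le> K * \<epsilon>" "errors_le p x \<sigma> (K * \<epsilon>)"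
    then have q: "(\<epsilon>, p, x, \<sigma>) \<in> Q" by (simp add: Q_def)
    show "\<bar>x i\<bar> \<le> M * \<epsilon>" if "i \<in> {1..m}" by (rule M(2)[OF q that])
    show "\<bar>p i\<bar> \<le> M * \<epsilon>" if "i \<in> {1..n}"
      using M0(2)[OF q that] mult_right_mono[OF M(1) \<epsilon>_nonneg[OF q]] by simp
  qed
qed

lemma state_bounded:
  assumes "K \<ge> 0"
  obtains M where "M \<ge> 0"
    "\<And>p x \<sigma> i. (\<And>i. i < n + m \<Longrightarrow> \<bar>\<sigma> i\<bar> \<le> K) \<Longrightarrow> errors_le p x \<sigma> K \<Longrightarrow> i \<in> {1..n} \<Longrightarrow> \<bar>p i\<bar> \<le> M"
    "\<And>p x \<sigma> j. (\<And>i. i < n + m \<Longrightarrow> \<bar>\<sigma> i\<bar> \<le> K) \<Longrightarrow> errors_le p x \<sigma> K \<Longrightarrow> j \<in> {1..m} \<Longrightarrow> \<bar>x j\<bar> \<le> M"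
proof (rule state_bound_from_errors[of "{1}" K])
  show "LB2 {1} {1..j} {..<j} (h j)" if "j < n" for j
    using that by (intro CR2_LB2_bounded[OF h_CR2]) simp
  show "LB2 {1} {1..j} {..<j} (X.\<tau> j)" if "j < m" for j
    using that by (intro CR2_LB2_bounded[OF X.tau_CR2]) simp
  show "LB3 {1} {1..n} {1..j} {..n + j} (\<Delta> j)" if "j < m" for j
    using that by (intro CR3_LB3_bounded[OF Delta_CR3]) simp
next
  fix M assume "M \<ge> 0"
    "\<And>\<epsilon> p x \<sigma> i. \<epsilon> \<in> {1} \<Longrightarrow> (\<And>i. i < n + m \<Longrightarrow> \<bar>\<sigma> i\<bar> \<le> K * \<epsilon>) \<Longrightarrow> errors_le p x \<sigma> (K * \<epsilon>) \<Longrightarrow>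
       i \<in> {1..n} \<Longrightarrow> \<bar>p i\<bar> \<le> M * \<epsilon>"
    "\<And>\<epsilon> p x \<sigma> j. \<epsilon> \<in> {1} \<Longrightarrow> (\<And>i. i < n + m \<Longrightarrow> \<bar>\<sigma> i\<bar> \<le> K * \<epsilon>) \<Longrightarrow> errors_le p x \<sigma> (K * \<epsilon>) \<Longrightarrow>
       j \<in> {1..m} \<Longrightarrow> \<bar>x j\<bar> \<le> M * \<epsilon>"
  from this(1) this(2,3)[of 1, simplified] show thesis by (rule that[OF _ _ _]; simp)
qed (use assms in auto)

lemma state_linearly_bounded:
  assumes "K \<ge> 0"
  obtains M where "M \<ge> 0"
    "\<And>\<epsilon> p x \<sigma> i. \<epsilon> \<in> {0..1} \<Longrightarrow> (\<And>i. i < n + m \<Longrightarrow> \<bar>\<sigma> i\<bar> \<le> K * \<epsilon>) \<Longrightarrow> errors_le p x \<sigma> (K * \<epsilon>) \<Longrightarrow>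
       i \<in> {1..n} \<Longrightarrow> \<bar>p i\<bar> \<le> M * \<epsilon>"
    "\<And>\<epsilon> p x \<sigma> j. \<epsilon> \<in> {0..1} \<Longrightarrow> (\<And>i. i < n + m \<Longrightarrow> \<bar>\<sigma> i\<bar> \<le> K * \<epsilon>) \<Longrightarrow> errors_le p x \<sigma> (K * \<epsilon>) \<Longrightarrow>
       j \<in> {1..m} \<Longrightarrow> \<bar>x j\<bar> \<le> M * \<epsilon>"
proof (rule state_bound_from_errors[of "{0..1}" K])
  show "LB2 {0..1} {1..j} {..<j} (h j)" if "j < n" for j
    using that Y.tau_zero[of j] by (intro CR2_LB2_linear CR2_lower[OF h_CR2]) (auto simp: h_fun_eq_tau_fun)
  show "LB2 {0..1} {1..j} {..<j} (X.\<tau> j)" if "j < m" for j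
    using that X.tau_zero[of j] by (intro CR2_LB2_linear CR2_lower[OF X.tau_CR2]) auto
  show "LB3 {0..1} {1..n} {1..j} {..n + j} (\<Delta> j)" if "j < m" for j
    using that Delta_zero[of j] by (intro CR3_LB3_linear CR3_lower[OF Delta_CR3]) auto
qed (use assms in \<open>auto intro: that\<close>)

end

section \<open>Tracking and boundedness\<close>

text \<open>The target is known to vanish on the half-line only, so its one-sided derivative is
  pinned down by the nontriviality of the filter at each point.\<close>

lemma vector_derivative_halfline_zero:
  fixes f :: "real \<Rightarrow> real"
  assumes "\<And>t. t \<ge> a \<Longrightarrow> f t = 0" "t \<ge> a"
  shows "vector_derivative f (at t within {a..}) = 0"
proof (rule vector_derivative_within)
  have "at_right t \<le> at t within {a..}" using assms(2) by (intro at_le) auto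
  then show "at t within {a..} \<noteq> bot"
    using trivial_limit_at_right_real[of t] by (metis bot_unique)
  show "(f has_vector_derivative 0) (at t within {a..})"
    by (rule has_vector_derivative_transform_within[of "\<lambda>_. 0" _ _ _ 1]) (use assms in auto)
qed

lemma iter_deriv_zero:
  assumes "\<And>t. t \<ge> 0 \<Longrightarrow> s t = 0" "t \<ge> 0"
  shows "iter_deriv {0..} i s t = 0"
  using assms(2) by (induction i arbitrary: t) (auto simp: assms(1) vector_derivative_halfline_zero)

lemma continuous_on_interval_abs_bounded:
  fixes f :: "real \<Rightarrow> real"
  assumes "continuous_on {a..b} f"
  shows "\<exists>R\<ge>0. \<forall>t\<in>{a..b}. \<bar>f t\<bar> \<le> R"
proof -
  have "bounded (f ` {a..b})"
    using assms by (intro compact_imp_bounded compact_continuous_image) auto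
  then obtain R where "\<forall>t\<in>{a..b}. \<bar>f t\<bar> \<le> R" by (auto simp: bounded_iff)
  then show ?thesis by (intro exI[of _ "max R 0"]) (auto simp: le_max_iff_disj)
qed

lemma Cr_on_imp_continuous_on:
  assumes "Cr_on S r f"
  shows "continuous_on S f"
proof (cases r)
  case (Suc q)
  then have "f differentiable (at t within S)" if "t \<in> S" for t
    using assms that by (auto simp: Cr_on_def dest: bspec spec[of _ 0])
  then show ?thesis
    by (auto simp: continuous_on_eq_continuous_within intro: differentiable_imp_continuous_within)
qed (use assms in \<open>simp add: Cr_on_def\<close>)

section \<open>\<open>Psi\<close> in terms of coordinate bounds\<close>

lemma L2_set_le_card_mult:
  fixes R :: real
  assumes "\<And>i. i \<in> A \<Longrightarrow> \<bar>f i\<bar> \<le> R"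
  shows "L2_set f A \<le> card A * R"
  using L2_set_le_sum_abs[of f A] sum_bounded_above[of A "\<lambda>i. \<bar>f i\<bar>" R] assms by force

text \<open>The constant counts \<open>m\<close> coordinates of \<open>X\<close>, \<open>n\<close>
  each for \<open>Y\<close> and for the predictor profile, and \<open>sqrt D\<close> for the
  square-integral norm of a function bounded by \<open>R\<close> on an interval of length
  \<open>D\<close>.\<close>

lemma Psi_bounds:
  fixes R D :: real
  assumes "D > 0" "R \<ge> 0"
    and Y: "\<And>i. i \<in> {1..n} \<Longrightarrow> Y t i = P (t - D) i"
    and P: "\<And>\<tau> i. t - D \<le> \<tau> \<Longrightarrow> \<tau> \<le> t \<Longrightarrow> i \<in> {1..n} \<Longrightarrow> \<bar>P \<tau> i\<bar> \<le> R"
    and X: "\<And>j. j \<in> {1..m} \<Longrightarrow> \<bar>X t j\<bar> \<le> R"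
    and X1: "\<And>\<tau>. t - D \<le> \<tau> \<Longrightarrow> \<tau> \<le> t \<Longrightarrow> \<bar>X \<tau> 1\<bar> \<le> R"
    and X1_cont: "continuous_on {t - D..t} (\<lambda>\<tau>. X \<tau> 1)"
  shows "0 \<le> Psi n m D Y X P t" "Psi n m D Y X P t \<le> (real m + 2 * real n + sqrt D) * R"
proof -
  let ?p = "\<lambda>x. L2_set (P (t - D + D * x)) {1..n}"
  have p_le: "?p x \<le> n * R" if "x \<in> {0..1}" for x
  proof -
    have "D * x \<le> D" "0 \<le> D * x" using that \<open>D > 0\<close> by (auto simp: mult_left_le)
    then show ?thesis
      using L2_set_le_card_mult[where A = "{1..n}" and f = "P (t - D + D * x)" and R = R] P[of "t - D + D * x"] by simp
  qed
  have Sup_le: "(SUP x\<in>{0..1}. ?p x) \<le> n * R"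
    using p_le by (intro cSUP_least) auto
  have "?p 0 \<le> (SUP x\<in>{0..1}. ?p x)"
    using p_le by (intro cSUP_upper bdd_aboveI2[of _ _ "n * R"]) auto
  then have Sup_nonneg: "0 \<le> (SUP x\<in>{0..1}. ?p x)" using L2_set_nonneg order_trans by blast
  have Xt: "L2_set (X t) {1..m} \<le> m * R" using L2_set_le_card_mult[where A = "{1..m}" and f = "X t" and R = R] X by simp
  have "L2_set (Y t) {1..n} = L2_set (P (t - D)) {1..n}" using Y by (intro L2_set_cong) auto
  also have "\<dots> \<le> n * R" using p_le[of 0] by simp
  finally have Yt: "L2_set (Y t) {1..n} \<le> n * R" .
  have int: "(\<lambda>\<tau>. (X \<tau> 1)\<^sup>2) integrable_on {t - D..t}"
    using X1_cont by (intro integrable_continuous_interval continuous_intros)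
  have int_nonneg: "0 \<le> integral {t - D..t} (\<lambda>\<tau>. (X \<tau> 1)\<^sup>2)"
    by (rule integral_nonneg[OF int]) simp
  have "integral {t - D..t} (\<lambda>\<tau>. (X \<tau> 1)\<^sup>2) \<le> integral {t - D..t} (\<lambda>\<tau>. R\<^sup>2)"
    using int X1 by (intro integral_le) (auto simp: abs_le_square_iff[symmetric] \<open>R \<ge> 0\<close>)
  also have "\<dots> = D * R\<^sup>2" using \<open>D > 0\<close> by simp
  finally have "sqrt (integral {t - D..t} (\<lambda>\<tau>. (X \<tau> 1)\<^sup>2)) \<le> sqrt (D * R\<^sup>2)" by simp
  also have "\<dots> = sqrt D * R" using \<open>R \<ge> 0\<close> by (simp add: real_sqrt_mult)
  finally have X1t: "sqrt (integral {t - D..t} (\<lambda>\<tau>. (X \<tau> 1)\<^sup>2)) \<le> sqrt D * R" .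
  show "Psi n m D Y X P t \<le> (real m + 2 * real n + sqrt D) * R"
    unfolding Psi_def using Sup_le Xt Yt X1t by (simp add: algebra_simps)
  show "0 \<le> Psi n m D Y X P t"
    unfolding Psi_def using Sup_nonneg int_nonneg by (intro add_nonneg_nonneg L2_set_nonneg) auto
qed

context predictor_feedback
begin

text \<open>This is the origin of \<open>k_check\<close>: with \<open>A\<close> the numerator,
  \<open>k_check\<close> is \<open>A / z_i\<close> while \<open>z_(i+1) = k_i * z_i - A\<close>. For
  \<open>z_i > 0\<close> the gain condition says exactly that the next error is positive.\<close>

lemma p_err_Suc_pos:
  assumes "i \<in> {1..n - 1}" "p_err p x \<sigma> i > 0" "k i > k_check \<psi> k p \<sigma> i"
  shows "p_err p x \<sigma> (Suc i) > 0"
proof -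
  define A where "A = - p (i + 1) - \<psi> i p + \<sigma> i + cascade_deriv \<psi> (i - 1) (h (i - 1)) p \<sigma>"
  obtain j where j: "i = Suc j" using assms(1) by (cases i) auto
  have "k_check \<psi> k p \<sigma> i = A / p_err p x \<sigma> i"
    using assms(1) by (auto simp: k_check_def A_def p_err_def)
  then have "A < k i * p_err p x \<sigma> i" using assms(2,3) by (simp add: pos_divide_less_eq)
  moreover have "p_err p x \<sigma> (Suc i) = k i * p_err p x \<sigma> i - A"
    using assms(1) by (auto simp: A_def p_err_def j)
  ultimately show ?thesis by simp
qed

text \<open>\<open>c_check\<close> arises in the same way from
  \<open>r_(j+1) = c_j * r_j - A\<close>.\<close>

lemma x_err_Suc_pos:
  assumes "j \<in> {1..m - 1}" "x_err p x \<sigma> j > 0" "c j > c_check b \<phi> c x (\<delta> p x \<sigma>) j"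
  shows "x_err p x \<sigma> (Suc j) > 0"
proof -
  define A where "A = - b * x (j + 1) - b * \<phi> j x + \<delta> p x \<sigma> j
    + cascade_deriv \<phi> (j - 1) (X.\<tau> (j - 1)) x (\<delta> p x \<sigma>)"
  obtain l where l: "j = Suc l" using assms(1) by (cases j) auto
  have "c_check b \<phi> c x (\<delta> p x \<sigma>) j = A / x_err p x \<sigma> j"
    using assms(1) by (auto simp: c_check_def A_def x_err_def)
  then have "A < c j * x_err p x \<sigma> j" using assms(2,3) by (simp add: pos_divide_less_eq)
  moreover have "x_err p x \<sigma> (Suc j) = c j * x_err p x \<sigma> j - A"
    using assms(1) by (auto simp: A_def x_err_def l)
  ultimately show ?thesis by simp
qed

lemma p_err_Suc_n: "p_err p x \<sigma> (Suc n) = x_err p x \<sigma> 1"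
  using m_ge by (simp add: p_err_def x_err_def Delta_jet_def)

text \<open>What the remaining estimates use of a solution: errors of size
  \<open>C * exp (- t)\<close> after time zero and a bound \<open>R\<close> on the initial stretch.
  Both constants vary with the solution, so the ultimate bound has to avoid them.\<close>

definition tracking ::
    "real \<Rightarrow> real \<Rightarrow> (real \<Rightarrow> nat \<Rightarrow> real) \<Rightarrow> (real \<Rightarrow> nat \<Rightarrow> real) \<Rightarrow> (real \<Rightarrow> nat \<Rightarrow> real) \<Rightarrow> bool" where
  "tracking C R Y X P \<longleftrightarrow> C \<ge> 0 \<and> R \<ge> 0 \<and>
     (\<forall>t\<ge>0. errors_le (P t) (X t) (jet s (t + D)) (C * exp (- t))) \<and>
     (\<forall>t\<in>{-D..0}. \<bar>X t 1\<bar> \<le> R \<and> (\<forall>i\<in>{1..n}. \<bar>P t i\<bar> \<le> R)) \<and>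
     continuous_on {-D..} (\<lambda>t. X t 1) \<and>
     (\<forall>t\<ge>0. \<forall>i\<in>{1..n}. Y t i = P (t - D) i) \<and>
     (\<forall>t\<in>{0..D}. \<bar>Y t 1 - s t\<bar> \<le> R) \<and>
     (\<forall>t\<ge>0. Y t 1 - s t \<ge> 0)"

lemma closed_loop_tracking:
  assumes init: "predictor_init n b D \<psi> Y0 \<xi> P0"
    and \<xi>: "continuous_on {-D..0} \<xi>" "\<xi> 0 = X0 1"
    and A4: "\<forall>\<theta>\<in>{-D..0}. P0 \<theta> 1 > s (\<theta> + D)"
    and A5: "b * X0 1 > \<Delta> 0 (P0 0) X0 (jet s D)"
    and k: "\<forall>i\<in>{1..n - 1}. k i > max 2 (k_check \<psi> k (P0 0) (jet s D) i)" "k n > 1"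
    and c: "\<forall>j\<in>{1..m - 1}. c j > max 2 (c_check b \<phi> c X0 (\<delta> (P0 0) X0 (jet s D)) j)" "c m > 1"
    and cl: "closed_loop n m b D \<psi> \<phi> s k c Y0 X0 \<xi> P0 Y X P"
  shows "\<exists>C R. tracking C R Y X P"
proof -
  note exact = predictor_exact[OF init \<xi> cl]
  let ?z = "\<lambda>i t. p_err (P t) (X t) (jet s (t + D)) i"
  let ?r = "\<lambda>j t. x_err (P t) (X t) (jet s (t + D)) j"
  have dynP: "P_dyn P X i t" if "t \<ge> 0" "i \<in> {1..n}" for i t
    unfolding P_dyn_def using that D_pos by (intro has_field_derivative_subset[OF exact(2)]) auto
  have dynX: "X_dyn P X j t" if "t \<ge> 0" "j \<in> {1..m}" for j t
    unfolding X_dyn_def using cl that unfolding closed_loop_def by blast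
  have chains: "filter_chain n k ?z" "filter_chain m c ?r"
    using dyn_iff_filter_chain[of P X] dynP dynX by blast+
  have k_gt: "k i > 1" if "i \<in> {1..n}" for i
    using k that by (cases "i = n") force+
  have c_gt: "c j > 1" if "j \<in> {1..m}" for j
    using c that by (cases "j = m") force+
  have zero_input: "?r (Suc m) t = 0" for t by (simp add: x_err_def)

  have P_init: "P 0 i = P0 0 i" if "i \<in> {1..n}" for i
    using cl that D_pos unfolding closed_loop_def by auto
  have X_init: "X 0 j = X0 j" if "j \<in> {1..m}" for j
    using cl that unfolding closed_loop_def by auto
  have r1: "x_err (P0 0) X0 (jet s D) 1 > 0"
    using A5 p_err_Suc_n[of "P0 0" X0 "jet s D"] by (simp add: p_err_def)
  have r_init: "x_err (P0 0) X0 (jet s D) j > 0" if "j \<in> {1..m}" for j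
  proof -
    from that have "1 \<le> j" "j \<le> m" by auto
    then show ?thesis
    proof (induction j rule: dec_induct)
      case (step j)
      then show ?case using c(1) by (intro x_err_Suc_pos) auto
    qed (rule r1)
  qed
  have z_init: "p_err (P0 0) X0 (jet s D) i > 0" if "i \<in> {1..n}" for i
  proof -
    from that have "1 \<le> i" "i \<le> n" by auto
    then show ?thesis
    proof (induction i rule: dec_induct)
      case base
      have "P0 0 1 > s D" using A4[rule_format, of 0] D_pos by simp
      then show ?case using n_ge by (simp add: p_err_def jet_def)
    next
      case (step i)
      then show ?case using k(1) by (intro p_err_Suc_pos) auto
    qed
  qed
  have r_nonneg: "?r j t \<ge> 0" if "j \<in> {1..m}" "t \<ge> 0" for j t
  proof (rule filter_chain_nonneg[OF chains(2)])
    fix i assume i: "i \<in> {1..m}"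
    have "x_err (P 0) (X 0) (jet s D) i = x_err (P0 0) X0 (jet s D) i"
      by (rule err_cong(2)) (use i P_init X_init in auto)
    then show "?r i 0 \<ge> 0" using r_init[OF i] by simp
  qed (use that zero_input in auto)
  have z_nonneg: "?z i t \<ge> 0" if "i \<in> {1..n}" "t \<ge> 0" for i t
  proof (rule filter_chain_nonneg[OF chains(1)])
    fix i assume i: "i \<in> {1..n}"
    have "p_err (P 0) (X 0) (jet s D) i = p_err (P0 0) X0 (jet s D) i"
      by (rule err_cong(1)) (use i P_init X_init in auto)
    then show "?z i 0 \<ge> 0" using z_init[OF i] by simp
  qed (use that m_ge r_nonneg[of 1] in \<open>auto simp: p_err_Suc_n\<close>)
  have r_decay: "\<exists>C. \<forall>t\<ge>0. \<bar>?r j t\<bar> \<le> C * exp (- t)" if "j \<in> {1..m}" for j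
    by (rule filter_chain_decay[OF chains(2) c_gt]) (use that in \<open>auto simp: zero_input intro: exI[of _ 0]\<close>)
  have z_decay: "\<exists>C. \<forall>t\<ge>0. \<bar>?z i t\<bar> \<le> C * exp (- t)" if "i \<in> {1..n}" for i
    by (rule filter_chain_decay[OF chains(1) k_gt]) (use that m_ge r_decay[of 1] in \<open>auto simp: p_err_Suc_n\<close>)
  obtain Cr where Cr: "\<And>j t. j \<in> {1..m} \<Longrightarrow> t \<ge> 0 \<Longrightarrow> \<bar>?r j t\<bar> \<le> Cr j * exp (- t)"
    using r_decay by metis
  obtain Cz where Cz: "\<And>i t. i \<in> {1..n} \<Longrightarrow> t \<ge> 0 \<Longrightarrow> \<bar>?z i t\<bar> \<le> Cz i * exp (- t)"
    using z_decay by metis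
  \<comment> \<open>Summing absolute values gives one nonnegative constant for all errors, whatever
    the individual constants are.\<close>
  define C where "C = (\<Sum>i\<in>{1..n}. \<bar>Cz i\<bar>) + (\<Sum>j\<in>{1..m}. \<bar>Cr j\<bar>)"
  have C_nonneg: "C \<ge> 0" unfolding C_def by (intro add_nonneg_nonneg sum_nonneg) auto
  have errs: "errors_le (P t) (X t) (jet s (t + D)) (C * exp (- t))" if t: "t \<ge> 0" for t
    unfolding errors_le_def
  proof (intro conjI ballI)
    fix i assume i: "i \<in> {1..n}"
    have "\<bar>Cz i\<bar> \<le> (\<Sum>i\<in>{1..n}. \<bar>Cz i\<bar>)" using i by (intro member_le_sum) auto
    then have "Cz i \<le> C" unfolding C_def using sum_nonneg[of "{1..m}" "\<lambda>j. \<bar>Cr j\<bar>"] by linarith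
    then show "\<bar>?z i t\<bar> \<le> C * exp (- t)"
      using Cz[OF i t] mult_right_mono[of "Cz i" C "exp (- t)"] by (meson exp_ge_zero order_trans)
  next
    fix j assume j: "j \<in> {1..m}"
    have "\<bar>Cr j\<bar> \<le> (\<Sum>j\<in>{1..m}. \<bar>Cr j\<bar>)" using j by (intro member_le_sum) auto
    then have "Cr j \<le> C" unfolding C_def using sum_nonneg[of "{1..n}" "\<lambda>j. \<bar>Cz j\<bar>"] by linarith
    then show "\<bar>?r j t\<bar> \<le> C * exp (- t)"
      using Cr[OF j t] mult_right_mono[of "Cr j" C "exp (- t)"] by (meson exp_ge_zero order_trans)
  qed

  have P_cont: "continuous_on {-D..0} (\<lambda>t. P t i)" if "i \<in> {1..n}" for i
    by (rule continuous_on_subset[OF has_derivative_halfline_imp_continuous[OF exact(2)[OF _ that]]]) auto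
  obtain RP where RP: "\<And>i. i \<in> {1..n} \<Longrightarrow> RP i \<ge> 0"
    "\<And>i t. i \<in> {1..n} \<Longrightarrow> t \<in> {-D..0} \<Longrightarrow> \<bar>P t i\<bar> \<le> RP i"
    using continuous_on_interval_abs_bounded[OF P_cont] by metis
  have "continuous_on {-D..0} (\<lambda>t. X t 1)" by (rule continuous_on_subset[OF exact(1)]) auto
  from continuous_on_interval_abs_bounded[OF this] obtain RX where RX: "RX \<ge> 0"
    "\<And>t. t \<in> {-D..0} \<Longrightarrow> \<bar>X t 1\<bar> \<le> RX" by blast
  have "continuous_on {0..} (\<lambda>t. Y t 1)"
  proof (rule has_derivative_halfline_imp_continuous)
    show "((\<lambda>t. Y t 1) has_real_derivative plant_f n \<psi> (Y t) (b * X (t - D) 1) 1) (at t within {0..})"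
      if "t \<ge> 0" for t using cl that n_ge unfolding closed_loop_def by auto
  qed
  then have "continuous_on {0..} (\<lambda>t. Y t 1 - s t)"
    using Cr_on_imp_continuous_on[OF s] by (intro continuous_intros)
  then have "continuous_on {0..D} (\<lambda>t. Y t 1 - s t)" by (rule continuous_on_subset) auto
  from continuous_on_interval_abs_bounded[OF this] obtain RY where RY: "RY \<ge> 0"
    "\<And>t. t \<in> {0..D} \<Longrightarrow> \<bar>Y t 1 - s t\<bar> \<le> RY" by blast
  define R where "R = (\<Sum>i\<in>{1..n}. RP i) + RX + RY"
  have RP_sum: "(\<Sum>i\<in>{1..n}. RP i) \<ge> 0" using RP(1) by (intro sum_nonneg) auto
  have "tracking C R Y X P"
    unfolding tracking_def
  proof (intro conjI allI ballI impI)
    show "C \<ge> 0" by (rule C_nonneg)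
    show "R \<ge> 0" using RP_sum RX RY by (simp add: R_def)
    show "\<bar>P t i\<bar> \<le> R" if "t \<in> {-D..0}" "i \<in> {1..n}" for t i
    proof -
      have "RP i \<le> (\<Sum>i\<in>{1..n}. RP i)" using that RP(1) by (intro member_le_sum) auto
      then show ?thesis using RP(2)[OF that(2,1)] RX(1) RY(1) by (simp add: R_def)
    qed
    show "\<bar>X t 1\<bar> \<le> R" if "t \<in> {-D..0}" for t
      using RX(2)[OF that] RP_sum RY(1) by (simp add: R_def)
    show "\<bar>Y t 1 - s t\<bar> \<le> R" if "t \<in> {0..D}" for t
      using RY(2)[OF that] RP_sum RX(1) by (simp add: R_def)
    \<comment> \<open>Before time \<open>D\<close> the output replays the predictor history, which
      (A4) controls; afterwards the tracking error is the first error \<open>z_1\<close> at time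
      \<open>t - D\<close>.\<close>
    show "Y t 1 - s t \<ge> 0" if t: "t \<ge> 0" for t
    proof (cases "t \<ge> D")
      case True
      then show ?thesis
        using z_nonneg[of 1 "t - D"] n_ge exact(3)[OF t, of 1] by (simp add: p_err_def jet_def)
    next
      case False
      then have h: "t - D \<in> {-D..0}" using t by auto
      have "P (t - D) 1 = P0 (t - D) 1"
        using cl h n_ge unfolding closed_loop_def by (metis atLeastAtMost_iff order_refl)
      moreover have "P0 (t - D) 1 > s t" using A4[rule_format, OF h] by simp
      ultimately show ?thesis using exact(3)[OF t, of 1] n_ge by simp
    qed
    show "continuous_on {-D..} (\<lambda>t. X t 1)" by (rule exact(1))
    show "Y t i = P (t - D) i" if "t \<ge> 0" "i \<in> {1..n}" for t i using that by (rule exact(3))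
    show "errors_le (P t) (X t) (jet s (t + D)) (C * exp (- t))" if "t \<ge> 0" for t using that by (rule errs)
  qed
  then show ?thesis by blast
qed

section \<open>Decay and bounds along tracking solutions\<close>

lemma tracking_output_decay:
  assumes "tracking C R Y X P"
  shows "exp_to_zero (\<lambda>t. \<bar>Y t 1 - s t\<bar>)"
  unfolding exp_to_zero_def
proof (intro exI conjI allI impI)
  fix t :: real assume t: "t \<ge> 0"
  note tr = assms[unfolded tracking_def]
  have CR: "0 \<le> C * exp D * exp (- t)" "0 \<le> R * exp D * exp (- t)" using tr by simp_all
  \<comment> \<open>The factor \<open>exp D\<close> pays for the delay: up to time \<open>D\<close>
    it keeps \<open>exp D * exp (- t)\<close> at least 1, which absorbs \<open>R\<close>; later it
    converts the error at \<open>t - D\<close> into a bound at \<open>t\<close>.\<close>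
  have "\<bar>Y t 1 - s t\<bar> \<le> C * exp D * exp (- t) + R * exp D * exp (- t)"
  proof (cases "t \<le> D")
    case True
    have "1 \<le> exp D * exp (- t)" using True by (simp flip: exp_add)
    then have "R \<le> R * exp D * exp (- t)" using tr by (simp add: mult_le_cancel_left1 mult.assoc)
    moreover have "\<bar>Y t 1 - s t\<bar> \<le> R" using tr True t by auto
    ultimately show ?thesis using CR by linarith
  next
    case False
    then have "errors_le (P (t - D)) (X (t - D)) (jet s t) (C * exp (- (t - D)))"
      using tr by (metis diff_add_cancel diff_ge_0_iff_ge less_imp_le linorder_not_le)
    then have "\<bar>p_err (P (t - D)) (X (t - D)) (jet s t) 1\<bar> \<le> C * exp (- (t - D))"
      using n_ge by (auto simp: errors_le_def)
    moreover have "p_err (P (t - D)) (X (t - D)) (jet s t) 1 = Y t 1 - s t"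
      using tr t n_ge by (simp add: p_err_def jet_def)
    moreover have "C * exp (- (t - D)) = C * exp D * exp (- t)"
      by (simp add: exp_diff exp_minus divide_inverse)
    ultimately show ?thesis using CR by (simp only:)
  qed
  then show "\<bar>\<bar>Y t 1 - s t\<bar>\<bar> \<le> (C * exp D + R * exp D) * exp (- 1 * t)"
    by (simp add: distrib_right)
qed simp

lemma errors_le_mono: "errors_le p x \<sigma> a \<Longrightarrow> a \<le> a' \<Longrightarrow> errors_le p x \<sigma> a'"
  unfolding errors_le_def by (meson order_trans)

text \<open>\<open>hist\<close> bites only while the window from \<open>t - D\<close> to
  \<open>t\<close> reaches back to time zero. For \<open>t > D\<close> it is vacuous, which permits
  a bound free of \<open>R\<close>.\<close>

lemma tracking_Psi_bounds:
  assumes tr: "tracking C R Y X P" and t: "t \<ge> 0" and r: "r \<ge> 0"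
    and hist: "\<And>\<tau>. t - D \<le> \<tau> \<Longrightarrow> \<tau> \<le> 0 \<Longrightarrow> R \<le> r"
    and P: "\<And>\<tau> i. t - D \<le> \<tau> \<Longrightarrow> 0 \<le> \<tau> \<Longrightarrow> \<tau> \<le> t \<Longrightarrow> i \<in> {1..n} \<Longrightarrow> \<bar>P \<tau> i\<bar> \<le> r"
    and X: "\<And>\<tau> j. t - D \<le> \<tau> \<Longrightarrow> 0 \<le> \<tau> \<Longrightarrow> \<tau> \<le> t \<Longrightarrow> j \<in> {1..m} \<Longrightarrow> \<bar>X \<tau> j\<bar> \<le> r"
  shows "0 \<le> Psi n m D Y X P t" "Psi n m D Y X P t \<le> (real m + 2 * real n + sqrt D) * r"
proof -
  note tr = tr[unfolded tracking_def]
  have Y': "Y t i = P (t - D) i" if "i \<in> {1..n}" for i using tr t that by blast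
  have P': "\<bar>P \<tau> i\<bar> \<le> r" if "t - D \<le> \<tau>" "\<tau> \<le> t" "i \<in> {1..n}" for \<tau> i
  proof (cases "\<tau> \<ge> 0")
    case False
    then have "\<tau> \<in> {-D..0}" using that t by auto
    then have "\<bar>P \<tau> i\<bar> \<le> R" using tr that by blast
    then show ?thesis using hist[of \<tau>] that False by simp
  qed (use that P in auto)
  have X1': "\<bar>X \<tau> 1\<bar> \<le> r" if "t - D \<le> \<tau>" "\<tau> \<le> t" for \<tau>
  proof (cases "\<tau> \<ge> 0")
    case False
    then have "\<tau> \<in> {-D..0}" using that t by auto
    then have "\<bar>X \<tau> 1\<bar> \<le> R" using tr by blast
    then show ?thesis using hist[of \<tau>] that False by simp
  qed (use that X m_ge in auto)
  have Xt: "\<bar>X t j\<bar> \<le> r" if "j \<in> {1..m}" for j using X[of t j] that t D_pos by simp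
  have cont: "continuous_on {t - D..t} (\<lambda>\<tau>. X \<tau> 1)"
    using tr t by (elim conjE continuous_on_subset) auto
  show "0 \<le> Psi n m D Y X P t" "Psi n m D Y X P t \<le> (real m + 2 * real n + sqrt D) * r"
    using Psi_bounds[of D r n Y t P m X, OF D_pos r Y' P' Xt X1' cont] by blast+
qed

lemma bounded_jets:
  assumes "\<forall>i<n + m. bounded (iter_deriv {0..} i s ` {0..})"
  obtains K where "K \<ge> 1" "\<And>t i. t \<ge> 0 \<Longrightarrow> i < n + m \<Longrightarrow> \<bar>jet s t i\<bar> \<le> K"
proof -
  have "\<exists>a. \<forall>t\<ge>0. \<bar>jet s t i\<bar> \<le> a" if "i < n + m" for i
  proof -
    have "bounded (iter_deriv {0..} i s ` {0..})" using assms that by blast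
    then obtain a where "\<forall>t\<in>{0..}. \<bar>iter_deriv {0..} i s t\<bar> \<le> a" by (auto simp: bounded_iff)
    then show ?thesis unfolding jet_def by (intro exI[of _ a]) simp
  qed
  then obtain a where a: "\<And>i t. i < n + m \<Longrightarrow> t \<ge> 0 \<Longrightarrow> \<bar>jet s t i\<bar> \<le> a i" by metis
  show thesis
  proof (rule that)
    \<comment> \<open>The added 1 leaves room in the box of size \<open>K\<close> for errors, which
      eventually are at most 1.\<close>
    show "1 \<le> 1 + (\<Sum>i<n + m. \<bar>a i\<bar>)" by (simp add: sum_nonneg)
    fix t :: real and i assume "t \<ge> 0" "i < n + m"
    then have "\<bar>jet s t i\<bar> \<le> \<bar>a i\<bar>" using a by (meson abs_ge_self order_trans)
    also have "\<dots> \<le> (\<Sum>i<n + m. \<bar>a i\<bar>)" using \<open>i < n + m\<close> by (intro member_le_sum) auto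
    finally show "\<bar>jet s t i\<bar> \<le> 1 + (\<Sum>i<n + m. \<bar>a i\<bar>)" by simp
  qed
qed

text \<open>Here the bound may depend on the solution: \<open>max C K\<close> covers errors and jet
  from time zero on, \<open>R\<close> covers the history.\<close>

lemma tracking_Psi_bounded:
  assumes "\<forall>i<n + m. bounded (iter_deriv {0..} i s ` {0..})" and trk: "tracking C R Y X P"
  shows "\<exists>M. \<forall>t\<ge>0. Psi n m D Y X P t \<le> M"
proof -
  obtain K where K: "K \<ge> 1" "\<And>t i. t \<ge> 0 \<Longrightarrow> i < n + m \<Longrightarrow> \<bar>jet s t i\<bar> \<le> K"
    using bounded_jets[OF assms(1)] by blast
  note tr = trk[unfolded tracking_def]
  obtain M where M: "M \<ge> 0"
    "\<And>p x \<sigma> i. (\<And>i. i < n + m \<Longrightarrow> \<bar>\<sigma> i\<bar> \<le> max C K) \<Longrightarrow> errors_le p x \<sigma> (max C K) \<Longrightarrow> i \<in> {1..n} \<Longrightarrow> \<bar>p i\<bar> \<le> M"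
    "\<And>p x \<sigma> j. (\<And>i. i < n + m \<Longrightarrow> \<bar>\<sigma> i\<bar> \<le> max C K) \<Longrightarrow> errors_le p x \<sigma> (max C K) \<Longrightarrow> j \<in> {1..m} \<Longrightarrow> \<bar>x j\<bar> \<le> M"
  proof -
    have "max C K \<ge> 0" using K(1) by simp
    from state_bounded[OF this] show thesis using that by blast
  qed
  have jets: "\<bar>jet s (t + D) i\<bar> \<le> max C K" if "t \<ge> 0" "i < n + m" for t i
    using K(2)[of "t + D" i] that D_pos by simp
  have errs: "errors_le (P t) (X t) (jet s (t + D)) (max C K)" if "t \<ge> 0" for t
  proof (rule errors_le_mono)
    show "errors_le (P t) (X t) (jet s (t + D)) (C * exp (- t))" using tr that by blast
    have "C * exp (- t) \<le> C" using tr that by (simp add: mult_left_le)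
    then show "C * exp (- t) \<le> max C K" by simp
  qed
  have "Psi n m D Y X P t \<le> (real m + 2 * real n + sqrt D) * max M R" if "t \<ge> 0" for t
  proof (rule tracking_Psi_bounds(2)[OF trk that])
    show "\<bar>P \<tau> i\<bar> \<le> max M R" if "0 \<le> \<tau>" "i \<in> {1..n}" for \<tau> i
      using M(2)[OF jets errs] that by (simp add: le_max_iff_disj)
    show "\<bar>X \<tau> j\<bar> \<le> max M R" if "0 \<le> \<tau>" "j \<in> {1..m}" for \<tau> j
      using M(3)[OF jets errs] that by (simp add: le_max_iff_disj)
  qed (use M(1) in auto)
  then show ?thesis by blast
qed

text \<open>The inverse transformation is bounded on a box of size \<open>K\<close>, fixed by the
  target alone, before any solution is considered; the solution decides only when its errors enter
  the box.\<close>

lemma ultimate_bound: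
  assumes "\<forall>i<n + m. bounded (iter_deriv {0..} i s ` {0..})"
  obtains B where "\<And>C R Y X P. tracking C R Y X P \<Longrightarrow> \<forall>\<^sub>F t in at_top. Psi n m D Y X P t \<le> B"
proof -
  obtain K where K: "K \<ge> 1" "\<And>t i. t \<ge> 0 \<Longrightarrow> i < n + m \<Longrightarrow> \<bar>jet s t i\<bar> \<le> K"
    using bounded_jets[OF assms(1)] by blast
  obtain M where M: "M \<ge> 0"
    "\<And>p x \<sigma> i. (\<And>i. i < n + m \<Longrightarrow> \<bar>\<sigma> i\<bar> \<le> K) \<Longrightarrow> errors_le p x \<sigma> K \<Longrightarrow> i \<in> {1..n} \<Longrightarrow> \<bar>p i\<bar> \<le> M"
    "\<And>p x \<sigma> j. (\<And>i. i < n + m \<Longrightarrow> \<bar>\<sigma> i\<bar> \<le> K) \<Longrightarrow> errors_le p x \<sigma> K \<Longrightarrow> j \<in> {1..m} \<Longrightarrow> \<bar>x j\<bar> \<le> M"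
  proof -
    have "K \<ge> 0" using K(1) by simp
    from state_bounded[OF this] show thesis using that by blast
  qed
  have jets: "\<bar>jet s (t + D) i\<bar> \<le> K" if "t \<ge> 0" "i < n + m" for t i
    using K(2)[of "t + D" i] that D_pos by simp
  show thesis
  proof (rule that)
    fix C R Y X P assume trk: "tracking C R Y X P"
    note tr = trk[unfolded tracking_def]
    have errs: "errors_le (P t) (X t) (jet s (t + D)) K" if "t \<ge> 0" "t \<ge> C" for t
    proof (rule errors_le_mono)
      show "errors_le (P t) (X t) (jet s (t + D)) (C * exp (- t))" using tr that by blast
      \<comment> \<open>By \<open>exp t \<ge> 1 + t\<close>, waiting until \<open>t \<ge> C\<close>
        brings the errors below 1.\<close>
      have "C \<le> exp t" using exp_ge_add_one_self[of t] that by linarith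
      then have "C * exp (- t) \<le> 1" by (simp add: exp_minus field_simps)
      then show "C * exp (- t) \<le> K" using K(1) by simp
    qed
    \<comment> \<open>Beyond \<open>C + D\<close> the whole window lies past time \<open>C\<close>,
      and so past the history as well.\<close>
    have "Psi n m D Y X P t \<le> (real m + 2 * real n + sqrt D) * M" if t: "t > C + D" for t
    proof (rule tracking_Psi_bounds(2)[OF trk])
      show "t \<ge> 0" using t tr D_pos by linarith
      show "R \<le> M" if "t - D \<le> \<tau>" "\<tau> \<le> 0" for \<tau> using that t tr by linarith
      show "\<bar>P \<tau> i\<bar> \<le> M" if "t - D \<le> \<tau>" "0 \<le> \<tau>" "i \<in> {1..n}" for \<tau> i
        using M(2)[OF jets errs] that t by simp
      show "\<bar>X \<tau> j\<bar> \<le> M" if "t - D \<le> \<tau>" "0 \<le> \<tau>" "j \<in> {1..m}" for \<tau> j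
        using M(3)[OF jets errs] that t by simp
    qed (rule M(1))
    then show "\<forall>\<^sub>F t in at_top. Psi n m D Y X P t \<le> (real m + 2 * real n + sqrt D) * M"
      using eventually_gt_at_top by (rule eventually_mono[rotated])
  qed
qed

text \<open>With a vanishing jet, errors and jet are bounded by \<open>C * \<epsilon>\<close> for
  \<open>\<epsilon> = exp (- t)\<close>, which lies in \<open>[0, 1]\<close>; the linear bound on
  the inverse transformation then transfers the rate to the state.\<close>

lemma tracking_Psi_decay:
  assumes s0: "\<forall>t\<ge>0. s t = 0" and trk: "tracking C R Y X P"
  shows "exp_to_zero (Psi n m D Y X P)"
proof -
  note tr = trk[unfolded tracking_def]
  have C: "C \<ge> 0" and R: "R \<ge> 0" using tr by auto
  obtain M where M: "M \<ge> 0"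
    "\<And>\<epsilon> p x \<sigma> i. \<epsilon> \<in> {0..1} \<Longrightarrow> (\<And>i. i < n + m \<Longrightarrow> \<bar>\<sigma> i\<bar> \<le> C * \<epsilon>) \<Longrightarrow> errors_le p x \<sigma> (C * \<epsilon>) \<Longrightarrow>
       i \<in> {1..n} \<Longrightarrow> \<bar>p i\<bar> \<le> M * \<epsilon>"
    "\<And>\<epsilon> p x \<sigma> j. \<epsilon> \<in> {0..1} \<Longrightarrow> (\<And>i. i < n + m \<Longrightarrow> \<bar>\<sigma> i\<bar> \<le> C * \<epsilon>) \<Longrightarrow> errors_le p x \<sigma> (C * \<epsilon>) \<Longrightarrow>
       j \<in> {1..m} \<Longrightarrow> \<bar>x j\<bar> \<le> M * \<epsilon>"
    using state_linearly_bounded[OF C] by blast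
  have jets: "jet s (t + D) i = 0" if "t \<ge> 0" for t i
    unfolding jet_def using that s0 D_pos by (intro iter_deriv_zero) auto
  have state: "\<bar>P t i\<bar> \<le> M * exp (- t)" "\<bar>X t j\<bar> \<le> M * exp (- t)"
    if "t \<ge> 0" "i \<in> {1..n}" "j \<in> {1..m}" for t i j
  proof -
    have "errors_le (P t) (X t) (jet s (t + D)) (C * exp (- t))" using tr that by blast
    moreover have "\<bar>jet s (t + D) l\<bar> \<le> C * exp (- t)" for l using jets that C by simp
    ultimately show "\<bar>P t i\<bar> \<le> M * exp (- t)" "\<bar>X t j\<bar> \<le> M * exp (- t)"
      using M(2,3)[of "exp (- t)" "jet s (t + D)" "P t" "X t"] that by auto
  qed
  \<comment> \<open>\<open>exp D\<close> makes up for the window starting at \<open>t - D\<close>,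
    and \<open>R\<close> accounts for the history as long as the window meets it.\<close>
  define r where "r = (\<lambda>t. (M + R) * exp D * exp (- t))"
  have r_ge: "M * exp (- \<tau>) \<le> r t" if "t - D \<le> \<tau>" for t \<tau>
  proof -
    have "exp (- \<tau>) \<le> exp D * exp (- t)" using that by (simp flip: exp_add)
    then have "M * exp (- \<tau>) \<le> M * (exp D * exp (- t))" using M(1) by (rule mult_left_mono)
    also have "\<dots> \<le> r t" using R by (simp add: r_def algebra_simps)
    finally show ?thesis .
  qed
  have bounds: "0 \<le> Psi n m D Y X P t \<and> Psi n m D Y X P t \<le> (real m + 2 * real n + sqrt D) * r t" if t: "t \<ge> 0" for t
  proof -
    have "r t \<ge> 0" using M(1) R by (simp add: r_def)
    moreover have "R \<le> r t" if "t - D \<le> \<tau>" "\<tau> \<le> 0" for \<tau>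
    proof -
      have "1 \<le> exp D * exp (- t)" using that by (simp flip: exp_add)
      then have "R \<le> R * (exp D * exp (- t))" using R by (simp add: mult_le_cancel_left1)
      also have "\<dots> \<le> r t" using M(1) by (simp add: r_def algebra_simps)
      finally show ?thesis .
    qed
    moreover have "\<bar>P \<tau> i\<bar> \<le> r t" if "t - D \<le> \<tau>" "0 \<le> \<tau>" "i \<in> {1..n}" for \<tau> i
      using state(1)[of \<tau> i 1] r_ge[OF that(1)] that m_ge by force
    moreover have "\<bar>X \<tau> j\<bar> \<le> r t" if "t - D \<le> \<tau>" "0 \<le> \<tau>" "j \<in> {1..m}" for \<tau> j
      using state(2)[of \<tau> 1 j] r_ge[OF that(1)] that n_ge by force
    ultimately show ?thesis using tracking_Psi_bounds[OF trk t, of "r t"] by blast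
  qed
  show ?thesis unfolding exp_to_zero_def
  proof (intro exI conjI allI impI)
    fix t :: real assume "t \<ge> 0"
    from bounds[OF this] show "\<bar>Psi n m D Y X P t\<bar>
        \<le> ((real m + 2 * real n + sqrt D) * ((M + R) * exp D)) * exp (- 1 * t)"
      by (simp add: r_def mult.assoc)
  qed simp
qed

end

theorem theorem1:
  fixes n m :: nat and b D :: real
    and \<psi> \<phi> :: "nat \<Rightarrow> (nat \<Rightarrow> real) \<Rightarrow> real"
    and s :: "real \<Rightarrow> real" and k c :: "nat \<Rightarrow> real"
  assumes "n \<ge> 1" and "m \<ge> 1" and "b \<noteq> 0" and "D > 0"
    and "\<forall>i\<in>{1..n}. Cr_fun i (n + m - i) (\<psi> i) \<and> \<psi> i (\<lambda>_. 0) = 0"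
    and "\<forall>j\<in>{1..m}. Cr_fun j (m - j) (\<phi> j) \<and> \<phi> j (\<lambda>_. 0) = 0"
    and "Cr_on {0..} (n + m) s"
  shows "\<exists>B. \<forall>Y0 X0 \<xi> P0.
      Cr_on {-D..0} (m - 1) \<xi> \<and> \<xi> 0 = X0 1 \<and>
      predictor_init n b D \<psi> Y0 \<xi> P0 \<and>
      (\<forall>\<theta>\<in>{-D..0}. P0 \<theta> 1 > s (\<theta> + D)) \<and>
      b * X0 1 > Delta_fun n b \<psi> \<phi> k 0 (P0 0) X0 (jet s D) \<and>
      (\<forall>i\<in>{1..n - 1}. k i > max 2 (k_check \<psi> k (P0 0) (jet s D) i)) \<and> k n > 1 \<and>
      (\<forall>j\<in>{1..m - 1}.
         c j > max 2 (c_check b \<phi> c X0 (Delta_jet n b \<psi> \<phi> k (P0 0) X0 (jet s D)) j)) \<and> c m > 1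
      \<longrightarrow>
      (\<exists>Y X P. closed_loop n m b D \<psi> \<phi> s k c Y0 X0 \<xi> P0 Y X P) \<and>
      (\<forall>Y X P. closed_loop n m b D \<psi> \<phi> s k c Y0 X0 \<xi> P0 Y X P \<longrightarrow>
         exp_to_zero (\<lambda>t. \<bar>Y t 1 - s t\<bar>) \<and>
         ((\<forall>i<n + m. bounded (iter_deriv {0..} i s ` {0..})) \<longrightarrow>
            (\<exists>M. \<forall>t\<ge>0. Psi n m D Y X P t \<le> M) \<and>
            (\<forall>\<^sub>F t in at_top. Psi n m D Y X P t \<le> B)) \<and>
         ((\<forall>t\<ge>0. s t = 0) \<longrightarrow> exp_to_zero (Psi n m D Y X P)) \<and>
         (\<forall>t\<ge>0. Y t 1 - s t \<ge> 0))"
proof -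
  interpret predictor_feedback n m b D \<psi> \<phi> s k c using assms by unfold_locales
  let ?J = "\<forall>i<n + m. bounded (iter_deriv {0..} i s ` {0..})"
  \<comment> \<open>\<open>B\<close> is fixed before initial data and trajectory, so it depends on
    the plant, the gains and the target only. Without bounded jets the implication is vacuous and
    any \<open>B\<close> serves.\<close>
  obtain B where B: "?J \<Longrightarrow> tracking C R Y X P \<Longrightarrow> \<forall>\<^sub>F t in at_top. Psi n m D Y X P t \<le> B" for C R Y X P
    by (cases ?J) (blast intro: ultimate_bound, blast)
  show ?thesis
  proof (intro exI[of _ B] allI impI, elim conjE)
    fix Y0 X0 :: "nat \<Rightarrow> real" and \<xi> P0
    assume init: "Cr_on {-D..0} (m - 1) \<xi>" "\<xi> 0 = X0 1" "predictor_init n b D \<psi> Y0 \<xi> P0"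
      and A: "\<forall>\<theta>\<in>{-D..0}. P0 \<theta> 1 > s (\<theta> + D)"
        "b * X0 1 > Delta_fun n b \<psi> \<phi> k 0 (P0 0) X0 (jet s D)"
      and gains: "\<forall>i\<in>{1..n - 1}. k i > max 2 (k_check \<psi> k (P0 0) (jet s D) i)" "k n > 1"
        "\<forall>j\<in>{1..m - 1}. c j > max 2 (c_check b \<phi> c X0 (Delta_jet n b \<psi> \<phi> k (P0 0) X0 (jet s D)) j)"
        "c m > 1"
    have \<xi>: "continuous_on {-D..0} \<xi>" by (rule Cr_on_imp_continuous_on[OF init(1)])
    show "(\<exists>Y X P. closed_loop n m b D \<psi> \<phi> s k c Y0 X0 \<xi> P0 Y X P) \<and>
      (\<forall>Y X P. closed_loop n m b D \<psi> \<phi> s k c Y0 X0 \<xi> P0 Y X P \<longrightarrow>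
         exp_to_zero (\<lambda>t. \<bar>Y t 1 - s t\<bar>) \<and>
         (?J \<longrightarrow>
            (\<exists>M. \<forall>t\<ge>0. Psi n m D Y X P t \<le> M) \<and>
            (\<forall>\<^sub>F t in at_top. Psi n m D Y X P t \<le> B)) \<and>
         ((\<forall>t\<ge>0. s t = 0) \<longrightarrow> exp_to_zero (Psi n m D Y X P)) \<and>
         (\<forall>t\<ge>0. Y t 1 - s t \<ge> 0))"
    proof (intro conjI allI impI)
      show "\<exists>Y X P. closed_loop n m b D \<psi> \<phi> s k c Y0 X0 \<xi> P0 Y X P"
        using init \<xi> by (intro closed_loop_exists)
    next
      fix Y X P assume "closed_loop n m b D \<psi> \<phi> s k c Y0 X0 \<xi> P0 Y X P"
      then obtain C R where tr: "tracking C R Y X P"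
        using closed_loop_tracking[OF init(3) \<xi> init(2) A gains] by blast
      show "exp_to_zero (\<lambda>t. \<bar>Y t 1 - s t\<bar>)" by (rule tracking_output_decay[OF tr])
      show "\<exists>M. \<forall>t\<ge>0. Psi n m D Y X P t \<le> M" if ?J by (rule tracking_Psi_bounded[OF that tr])
      show "\<forall>\<^sub>F t in at_top. Psi n m D Y X P t \<le> B" if ?J by (rule B[OF that tr])
      show "exp_to_zero (Psi n m D Y X P)" if "\<forall>t\<ge>0. s t = 0" by (rule tracking_Psi_decay[OF that tr])
      show "Y t 1 - s t \<ge> 0" if "t \<ge> 0" for t using tr that by (auto simp: tracking_def)
    qed
  qed
qed

end
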